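(* Let $m,n\geq 1$ be integers. For every $H\in\mathcal{G}_\tau(\mathbb{R}^{m+n})$, the integral operator $\widetilde H$ of kernel $H$ is a ($\overline{\mathbb{C}}$-)linear mapping from $\mathcal{G}_{\mathcal S}(\mathbb{R}^n)$ to $\mathcal{G}_\tau(\mathbb{R}^m)$. Moreover, the map $$\mathcal{G}_\tau(\mathbb{R}^{m+n})\to \mathbf{L}\left(\mathcal{G}_{\mathcal S}(\mathbb{R}^n),\mathcal{G}_\tau(\mathbb{R}^m)\right),\qquad H\mapsto\widetilde H,$$ is injective.
   Context: For $f\in C^\infty(\mathbb{R}^d)$, $r\in\mathbb{Z}$, $l\in\mathbb{N}$, put $\mu_{r,l}(f)=\sup_{x\in\mathbb{R}^d,\,|\alpha|\leq l}(1+|x|)^r|\partial^\alpha f(x)|\in[0,+\infty]$. All $\mathrm{O}(\cdot)$ are as $\varepsilon\to0$; nets are indexed by $\varepsilon\in(0,1]$. Rapidly decreasing generalized functions: $\mathcal{G}_{\mathcal S}(\mathbb{R}^d)=\mathcal{E}_{\mathcal S}(\mathbb{R}^d)/\mathcal{N}_{\mathcal S}(\mathbb{R}^d)$, where $\mathcal{E}_{\mathcal S}(\mathbb{R}^d)$ (resp. $\mathcal{N}_{\mathcal S}(\mathbb{R}^d)$) is the set of nets $(f_\varepsilon)_\varepsilon\in\mathcal{S}(\mathbb{R}^d)^{(0,1]}$ such that for all $(q,l)\in\mathbb{N}^2$ there exists $N\in\mathbb{N}$ with $\mu_{q,l}(f_\varepsilon)=\mathrm{O}(\varepsilon^{-N})$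 (resp. for all $(q,l)\in\mathbb{N}^2$ and all $p\in\mathbb{N}$, $\mu_{q,l}(f_\varepsilon)=\mathrm{O}(\varepsilon^{p})$). Tempered generalized functions: let $\mathcal{O}_M(\mathbb{R}^d)=\{f\in C^\infty(\mathbb{R}^d): \forall l\in\mathbb{N}\ \exists q\in\mathbb{N},\ \mu_{-q,l}(f)<+\infty\}$. Then $\mathcal{G}_\tau(\mathbb{R}^d)=\mathcal{E}_\tau(\mathbb{R}^d)/\mathcal{N}_\tau(\mathbb{R}^d)$, where $\mathcal{E}_\tau(\mathbb{R}^d)$ (resp. $\mathcal{N}_\tau(\mathbb{R}^d)$) is the set of nets $(f_\varepsilon)_\varepsilon\in\mathcal{O}_M(\mathbb{R}^d)^{(0,1]}$ such that $\forall l\in\mathbb{N}\ \exists q\in\mathbb{N}\ \exists N\in\mathbb{N}$, $\mu_{-q,l}(f_\varepsilon)=\mathrm{O}(\varepsilon^{-N})$ (resp. $\forall l\in\mathbb{N}\ \exists q\in\mathbb{N}\ \forall p\in\mathbb{N}$, $\mu_{-q,l}(f_\varepsilon)=\mathrm{O}(\varepsilon^{p})$). The class of a net in $\mathcal{G}_\tau$ is denoted $[\cdot]_\tau$. Both spaces are modules over the ring of generalized constants $\overline{\mathbb{C}}=\mathcal{E}_M(\mathbb{C})/\mathcal{N}(\mathbb{C})$, where $\mathcal{E}_M(\mathbb{C})$ (resp. $\mathcal{N}(\mathbb{C})$) is the set of nets $(x_\varepsilon)_\varepsilon\in\mathbb{C}^{(0,1]}$ with $|x_\varepsilon|=\mathrm{O}(\varepsilon^{-N})$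 for some $N\in\mathbb{N}$ (resp. $|x_\varepsilon|=\mathrm{O}(\varepsilon^p)$ for all $p\in\mathbb{N}$). $\mathbf{L}(\cdot,\cdot)$ denotes the space of $\overline{\mathbb{C}}$-linear maps. For $H\in\mathcal{G}_\tau(\mathbb{R}^{m+n})$, the integral operator of kernel $H$ is $$\widetilde H:\mathcal{G}_{\mathcal S}(\mathbb{R}^n)\to\mathcal{G}_\tau(\mathbb{R}^m),\quad \widetilde H(f)=\Big[\Big(x\mapsto\int_{\mathbb{R}^n} H_\varepsilon(x,y)f_\varepsilon(y)\,dy\Big)_\varepsilon\Big]_\tau,$$ where $(H_\varepsilon)_\varepsilon$, $(f_\varepsilon)_\varepsilon$ are arbitrary representatives of $H$, $f$ (the result does not depend on their choice). *)

theory Defs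
  imports "HOL-Analysis.Analysis" "HOL-Algebra.QuotRing" "HOL-Algebra.Module"
    "HOL-Library.Landau_Symbols"
begin

section \<open>Partial derivatives and seminorms\<close>

definition partial_deriv :: "'a::euclidean_space \<Rightarrow> ('a \<Rightarrow> complex) \<Rightarrow> 'a \<Rightarrow> complex" where
  "partial_deriv b f x = vector_derivative (\<lambda>t::real. f (x + t *\<^sub>R b)) (at 0)"

definition iter_partial :: "'a::euclidean_space list \<Rightarrow> ('a \<Rightarrow> complex) \<Rightarrow> 'a \<Rightarrow> complex" where
  "iter_partial bs f = foldr partial_deriv bs f"

definition C_infty :: "('a::euclidean_space \<Rightarrow> complex) set" where
  "C_infty = {f. \<forall>bs. set bs \<subseteq> Basis \<longrightarrow>
     continuous_on UNIV (iter_partial bs f) \<and>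
     (\<forall>b\<in>Basis. \<forall>x. (\<lambda>t::real. iter_partial bs f (x + t *\<^sub>R b)) differentiable at 0)}"

text \<open>
  A multi-index is a function \<open>\<alpha>\<close> on the standard basis; only its values on \<open>Basis\<close> matter.
  The derivative of order \<open>\<alpha>\<close> differentiates \<open>\<alpha> b\<close> times in each direction \<open>b\<close>. \<open>Basis\<close> carries no
  canonical order, so some order of differentiation is picked; on \<open>C_infty\<close>, the only place where
  this is used, the choice is immaterial by the symmetry of second derivatives.
\<close>

definition multi_deriv ::
    "('a::euclidean_space \<Rightarrow> nat) \<Rightarrow> ('a \<Rightarrow> complex) \<Rightarrow> 'a \<Rightarrow> complex" where
  "multi_deriv \<alpha> f =
     iter_partial (SOME bs. set bs \<subseteq> Basis \<and> (\<forall>b\<in>Basis. count_list bs b = \<alpha> b)) f"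

definition \<mu> :: "int \<Rightarrow> nat \<Rightarrow> ('a::euclidean_space \<Rightarrow> complex) \<Rightarrow> ennreal" where
  "\<mu> r l f = Sup {ennreal ((1 + norm x) powi r * cmod (multi_deriv \<alpha> f x)) | x \<alpha>.
                   (\<Sum>b\<in>Basis. \<alpha> b) \<le> l}"

definition schwartz :: "('a::euclidean_space \<Rightarrow> complex) set" where
  "schwartz = {f \<in> C_infty. \<forall>q l::nat. \<mu> (int q) l f < \<infinity>}"

definition O_M :: "('a::euclidean_space \<Rightarrow> complex) set" where
  "O_M = {f \<in> C_infty. \<forall>l::nat. \<exists>q::nat. \<mu> (- int q) l f < \<infinity>}"

section \<open>Nets\<close>

text \<open>
  Nets over \<open>(0,1]\<close> are functions on all reals whose values outside \<open>(0,1]\<close> are unconstrained.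
  The null nets below are also arbitrary there, so these values disappear in the quotients.
\<close>

type_synonym 'a net = "real \<Rightarrow> 'a \<Rightarrow> complex"

text \<open>\<open>u \<epsilon> = O(\<epsilon> ^ k)\<close> for extended-valued \<open>u\<close>; in particular \<open>u \<epsilon>\<close> is finite for small \<open>\<epsilon>\<close>.\<close>

definition bigO_powi :: "(real \<Rightarrow> ennreal) \<Rightarrow> int \<Rightarrow> bool" where
  "bigO_powi u k \<longleftrightarrow> (\<exists>C::real. \<forall>\<^sub>F \<epsilon> in at_right 0. u \<epsilon> \<le> ennreal (C * \<epsilon> powi k))"

definition moderate_S :: "'a::euclidean_space net set" where
  "moderate_S = {f. (\<forall>\<epsilon>\<in>{0<..1}. f \<epsilon> \<in> schwartz) \<and>
     (\<forall>q l::nat. \<exists>N::nat. bigO_powi (\<lambda>\<epsilon>. \<mu> (int q) l (f \<epsilon>)) (- int N))}"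

definition null_S :: "'a::euclidean_space net set" where
  "null_S = {f. (\<forall>\<epsilon>\<in>{0<..1}. f \<epsilon> \<in> schwartz) \<and>
     (\<forall>q l p::nat. bigO_powi (\<lambda>\<epsilon>. \<mu> (int q) l (f \<epsilon>)) (int p))}"

definition moderate_tau :: "'a::euclidean_space net set" where
  "moderate_tau = {f. (\<forall>\<epsilon>\<in>{0<..1}. f \<epsilon> \<in> O_M) \<and>
     (\<forall>l::nat. \<exists>q N::nat. bigO_powi (\<lambda>\<epsilon>. \<mu> (- int q) l (f \<epsilon>)) (- int N))}"

definition null_tau :: "'a::euclidean_space net set" where
  "null_tau = {f. (\<forall>\<epsilon>\<in>{0<..1}. f \<epsilon> \<in> O_M) \<and>
     (\<forall>l::nat. \<exists>q::nat. \<forall>p::nat. bigO_powi (\<lambda>\<epsilon>. \<mu> (- int q) l (f \<epsilon>)) (int p))}"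

section \<open>Generalized constants and modules over them\<close>

definition moderate_const :: "(real \<Rightarrow> complex) ring" where
  "moderate_const =
    \<lparr>carrier = {x. \<exists>N::nat. (\<lambda>\<epsilon>. cmod (x \<epsilon>)) \<in> O[at_right 0](\<lambda>\<epsilon>. \<epsilon> powi (- int N))},
     mult = (\<lambda>x y \<epsilon>. x \<epsilon> * y \<epsilon>), one = (\<lambda>_. 1), zero = (\<lambda>_. 0),
     add = (\<lambda>x y \<epsilon>. x \<epsilon> + y \<epsilon>)\<rparr>"

definition null_const :: "(real \<Rightarrow> complex) set" where
  "null_const = {x. \<forall>p::nat. (\<lambda>\<epsilon>. cmod (x \<epsilon>)) \<in> O[at_right 0](\<lambda>\<epsilon>. \<epsilon> ^ p)}"

definition gen_const :: "(real \<Rightarrow> complex) set ring" where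
  "gen_const = moderate_const Quot null_const"

text \<open>
  The fields \<open>mult\<close> and \<open>one\<close> play no role in the module structure; they are filled with the
  pointwise operations.
\<close>

definition net_module :: "'a net set \<Rightarrow> (real \<Rightarrow> complex, 'a net) module" where
  "net_module E =
    \<lparr>carrier = E, mult = (\<lambda>f g \<epsilon> x. f \<epsilon> x * g \<epsilon> x), one = (\<lambda>_ _. 1), zero = (\<lambda>_ _. 0),
     add = (\<lambda>f g \<epsilon> x. f \<epsilon> x + g \<epsilon> x), smult = (\<lambda>c f \<epsilon> x. c \<epsilon> * f \<epsilon> x)\<rparr>"

text \<open>Analogue of \<open>FactRing\<close>, with scalars that are themselves cosets of nets.\<close>

definition FactModule :: "('r, 'm) module \<Rightarrow> 'm set \<Rightarrow> ('r set, 'm set) module" where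
  "FactModule M N =
    \<lparr>carrier = a_rcosets\<^bsub>M\<^esub> N, mult = rcoset_mult M N, one = N +>\<^bsub>M\<^esub> \<one>\<^bsub>M\<^esub>, zero = N,
     add = set_add M, smult = (\<lambda>a u. \<Union>c\<in>a. \<Union>f\<in>u. N +>\<^bsub>M\<^esub> (c \<odot>\<^bsub>M\<^esub> f))\<rparr>"

definition G_S :: "((real \<Rightarrow> complex) set, 'a::euclidean_space net set) module" where
  "G_S = FactModule (net_module moderate_S) null_S"

definition G_tau :: "((real \<Rightarrow> complex) set, 'a::euclidean_space net set) module" where
  "G_tau = FactModule (net_module moderate_tau) null_tau"

definition class_tau :: "'a::euclidean_space net \<Rightarrow> 'a net set" where
  "class_tau f = null_tau +>\<^bsub>net_module moderate_tau\<^esub> f"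

definition linear_maps ::
    "('r, 'k) ring_scheme \<Rightarrow> ('r, 'a, 'c) module_scheme \<Rightarrow> ('r, 'b, 'd) module_scheme
      \<Rightarrow> ('a \<Rightarrow> 'b) set" where
  "linear_maps R M M' = {T \<in> carrier M \<rightarrow>\<^sub>E carrier M'.
     (\<forall>u\<in>carrier M. \<forall>v\<in>carrier M. T (u \<oplus>\<^bsub>M\<^esub> v) = T u \<oplus>\<^bsub>M'\<^esub> T v) \<and>
     (\<forall>a\<in>carrier R. \<forall>u\<in>carrier M. T (a \<odot>\<^bsub>M\<^esub> u) = a \<odot>\<^bsub>M'\<^esub> T u)}"

section \<open>Integral operators\<close>

text \<open>
  The union runs over all representatives. It is an element of \<open>carrier G_tau\<close> exactly when every
  choice of representatives yields a net in \<open>moderate_tau\<close> and all these nets have the same class,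
  which is then the value. The space of dimension \<open>m + n\<close> is the Euclidean product space.
\<close>

definition integral_op ::
    "('a::euclidean_space \<times> 'b::euclidean_space) net set \<Rightarrow> 'b net set \<Rightarrow> 'a net set" where
  "integral_op H = (\<lambda>f\<in>carrier G_S.
     \<Union>h\<in>H. \<Union>\<phi>\<in>f. class_tau (\<lambda>\<epsilon> x. LINT y|lborel. h \<epsilon> (x, y) * \<phi> \<epsilon> y))"

end

theory Submission
  imports Defs
begin

text \<open>
  Linearity and independence of representatives follow from one bilinear estimate: by differentiation
  under the integral, \<open>\<mu> (-q) l\<close> of \<open>x \<mapsto> \<integral> h (x, y) \<phi> y dy\<close> is at most a constant times
  \<open>\<mu> (-q) l h\<close> times \<open>\<mu> (q + n + 2) 0 \<phi>\<close>, where \<open>n\<close> is the dimension of the space of \<open>y\<close>.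

  For injectivity let \<open>h\<close> be a moderate kernel net whose integrals against all moderate nets are
  negligible, and suppose that some estimate \<open>\<bar>h \<epsilon> z\<bar> \<le> \<epsilon> ^ p * (1 + \<bar>z\<bar>) ^ (q + 1)\<close> fails for
  arbitrarily small \<open>\<epsilon>\<close>, where \<open>h\<close> has growth of order \<open>q\<close>. Comparing with the moderate bound,
  the points \<open>z = (x, a)\<close> of failure are bounded by a negative power of \<open>\<epsilon>\<close>. Hence Gaussians of width
  \<open>\<epsilon> ^ s\<close> centred at these \<open>a\<close> form a moderate net, and for large \<open>s\<close> the integral at \<open>x\<close> is bounded
  below by a power of \<open>\<epsilon>\<close>, a contradiction. So \<open>h\<close> itself is negligible, and its derivatives are then
  negligible by interpolation with the moderate bounds on the higher derivatives.
\<close>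

section \<open>Symmetry of partial derivatives\<close>

text \<open>The quantifiers of \<open>null_tau\<close> are the obstacle: one growth order must serve
  every p. It is \<open>q0 + 1\<close>, where \<open>q0\<close> comes from a moderate bound on the
  kernel and its first derivatives. The extra factor \<open>1 + norm z\<close> pays for
  localisation: cancelling the common power \<open>q0\<close> leaves a bound on z itself. This
  controls both coordinates of a failing point. The one in y-space makes the moving Gaussians
  moderate; the one in x-space makes the weight \<open>(1 + norm x) ^ q1\<close> of the negligible
  integral cost only a power of \<epsilon>. The order \<open>q1\<close> depends on the test net,
  hence on p; this is harmless, since negligibility supplies any order after \<open>q1\<close> is
  known. With one failing point chosen for each \<epsilon>, a single net tests all of them, so no
  uniformity over test functions has to be proved. First derivatives enter because the kernel value
  is recovered from an average at scale \<epsilon> ^ s, with an error of order \<epsilon> ^ (s - N)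
  up to the weight. Symmetry of mixed derivatives comes first because \<open>multi_deriv\<close>
  fixes an unspecified order, while the estimates differentiate along lists.\<close>

lemma iter_partial_Nil [simp]: "iter_partial [] f = f"
  by (simp add: iter_partial_def)

lemma iter_partial_Cons: "iter_partial (b # bs) f = partial_deriv b (iter_partial bs f)"
  by (simp add: iter_partial_def)

text \<open>\<open>partial_deriv\<close> differentiates at parameter 0 only. Moving the base point
  along b gives the derivative at every parameter, as the mean value arguments require.\<close>

lemma has_vector_derivative_line_shift:
  fixes x b :: "'a::real_vector"
  assumes "((\<lambda>t. f (x + s *\<^sub>R b + t *\<^sub>R b)) has_vector_derivative D) (at 0)"
  shows "((\<lambda>t. f (x + t *\<^sub>R b)) has_vector_derivative D) (at s)"
proof -
  have "((\<lambda>t. t - s) has_vector_derivative 1) (at s)"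
    by (auto intro!: derivative_eq_intros)
  moreover have "((\<lambda>t. f (x + s *\<^sub>R b + t *\<^sub>R b)) has_vector_derivative D) (at (s - s))"
    using assms by simp
  ultimately have "((\<lambda>t. f (x + s *\<^sub>R b + t *\<^sub>R b)) \<circ> (\<lambda>t. t - s) has_vector_derivative 1 *\<^sub>R D) (at s)"
    by (rule vector_diff_chain_at)
  then show ?thesis
    by (simp add: o_def algebra_simps)
qed

lemma C_infty_has_vector_derivative:
  assumes "f \<in> C_infty" "set bs \<subseteq> Basis" "b \<in> Basis"
  shows "((\<lambda>t. iter_partial bs f (x + t *\<^sub>R b)) has_vector_derivative
           iter_partial (b # bs) f (x + s *\<^sub>R b)) (at s)"
proof (rule has_vector_derivative_line_shift)
  have "(\<lambda>t. iter_partial bs f (x + s *\<^sub>R b + t *\<^sub>R b)) differentiable at 0"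
    using assms by (auto simp: C_infty_def)
  then show "((\<lambda>t. iter_partial bs f (x + s *\<^sub>R b + t *\<^sub>R b)) has_vector_derivative
      iter_partial (b # bs) f (x + s *\<^sub>R b)) (at 0)"
    unfolding iter_partial_Cons partial_deriv_def by (simp add: vector_derivative_works)
qed

lemma C_infty_continuous_on:
  "f \<in> C_infty \<Longrightarrow> set bs \<subseteq> Basis \<Longrightarrow> continuous_on A (iter_partial bs f)"
  using continuous_on_subset by (fastforce simp: C_infty_def)

text \<open>A guess \<open>G\<close> for all iterated derivatives at once is verified by induction
  on the list; since x is arbitrary, derivatives at 0 suffice. Linear combinations, kernel integrals
  and rescaled functions get their smoothness and their derivative formulas from the same
  guess.\<close>

lemma
  assumes "G [] = f"
    and cont: "\<And>bs. set bs \<subseteq> Basis \<Longrightarrow> continuous_on UNIV (G bs)"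
    and deriv: "\<And>bs b x. set bs \<subseteq> Basis \<Longrightarrow> b \<in> Basis \<Longrightarrow>
      ((\<lambda>t. G bs (x + t *\<^sub>R b)) has_vector_derivative G (b # bs) x) (at 0)"
  shows C_inftyI: "f \<in> C_infty"
    and iter_partial_eqI: "set bs \<subseteq> Basis \<Longrightarrow> iter_partial bs f = G bs"
proof -
  have eq: "iter_partial bs f = G bs" if "set bs \<subseteq> Basis" for bs
    using that
  proof (induction bs)
    case (Cons b bs)
    then show ?case
      using vector_derivative_at[OF deriv[of bs b]]
      by (auto simp: iter_partial_Cons partial_deriv_def)
  qed (simp add: assms(1))
  show "set bs \<subseteq> Basis \<Longrightarrow> iter_partial bs f = G bs"
    by (rule eq)
  show "f \<in> C_infty"
    unfolding C_infty_def using cont differentiableI_vector[OF deriv]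
    by (auto simp: eq)
qed

lemma mean_value_norm_bound:
  fixes u :: "real \<Rightarrow> 'a::real_normed_vector"
  assumes "\<And>s. \<bar>s\<bar> \<le> \<bar>h\<bar> \<Longrightarrow> (u has_vector_derivative u' s) (at s)"
    and "\<And>s. \<bar>s\<bar> \<le> \<bar>h\<bar> \<Longrightarrow> norm (u' s) \<le> B"
  shows "norm (u h - u 0) \<le> B * \<bar>h\<bar>"
proof -
  have "norm (u h - u 0) \<le> B * norm (h - 0)"
  proof (rule differentiable_bound[where S = "{-\<bar>h\<bar>..\<bar>h\<bar>}" and f' = "\<lambda>s t. t *\<^sub>R u' s"])
    show "(u has_derivative (\<lambda>t. t *\<^sub>R u' s)) (at s within {-\<bar>h\<bar>..\<bar>h\<bar>})"
      if "s \<in> {-\<bar>h\<bar>..\<bar>h\<bar>}" for s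
      using that assms(1)[of s]
      by (auto simp: has_vector_derivative_def intro: has_derivative_at_withinI)
    show "onorm (\<lambda>t. t *\<^sub>R u' s) \<le> B" if "s \<in> {-\<bar>h\<bar>..\<bar>h\<bar>}" for s
      using that assms(2)[of s] by (auto simp: onorm_scaleR_left onorm_id)
  qed auto
  then show ?thesis by simp
qed

text \<open>The mean value bound is applied twice, to an increment in direction b of an increment in
  direction c. Only values of one mixed derivative near x enter, so its continuity makes e
  small.\<close>

lemma second_difference_bound:
  assumes f: "f \<in> C_infty" and bs: "set bs \<subseteq> Basis" and b: "b \<in> Basis" "c \<in> Basis"
    and h: "h > 0"
    and B: "\<And>s t. \<bar>s\<bar> \<le> h \<Longrightarrow> \<bar>t\<bar> \<le> h \<Longrightarrow>
      cmod (iter_partial (c # b # bs) f (x + s *\<^sub>R b + t *\<^sub>R c) - D) \<le> e"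
  defines "F \<equiv> iter_partial bs f"
  shows "cmod (F (x + h *\<^sub>R b + h *\<^sub>R c) - F (x + h *\<^sub>R b) - F (x + h *\<^sub>R c) + F x
    - complex_of_real (h\<^sup>2) * D) \<le> e * h\<^sup>2"
proof -
  \<comment> \<open>\<open>u h - u 0\<close> is the second difference minus h^2 D, and its
    derivative \<open>u'\<close> is again an increment, in direction c, of the derivative in
    direction b.\<close>
  define u where "u s = F (x + s *\<^sub>R b + h *\<^sub>R c) - F (x + s *\<^sub>R b) - s * h * D" for s :: real
  define u' where "u' s = iter_partial (b # bs) f (x + s *\<^sub>R b + h *\<^sub>R c)
      - iter_partial (b # bs) f (x + s *\<^sub>R b) - h * D" for s :: real
  have "cmod (u' s) \<le> e * h" if s: "\<bar>s\<bar> \<le> h" for s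
  proof -
    define v where "v t = iter_partial (b # bs) f (x + s *\<^sub>R b + t *\<^sub>R c) - t * D" for t :: real
    have "cmod (v h - v 0) \<le> e * \<bar>h\<bar>"
    proof (rule mean_value_norm_bound)
      fix t assume t: "\<bar>t\<bar> \<le> \<bar>h\<bar>"
      show "(v has_vector_derivative (iter_partial (c # b # bs) f (x + s *\<^sub>R b + t *\<^sub>R c) - D)) (at t)"
        unfolding v_def
        by (rule derivative_eq_intros C_infty_has_vector_derivative f | use b bs in simp)+
      show "cmod (iter_partial (c # b # bs) f (x + s *\<^sub>R b + t *\<^sub>R c) - D) \<le> e"
        using B s t h by auto
    qed
    then show ?thesis
      using h by (simp add: v_def u'_def algebra_simps)
  qed
  moreover have "(u has_vector_derivative u' s) (at s)" for s
  proof -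
    have 1: "((\<lambda>s. F (x + s *\<^sub>R b + h *\<^sub>R c)) has_vector_derivative
         iter_partial (b # bs) f (x + s *\<^sub>R b + h *\<^sub>R c)) (at s)"
      using C_infty_has_vector_derivative[OF f bs b(1), of "x + h *\<^sub>R c" s]
      by (simp add: F_def algebra_simps)
    have 2: "((\<lambda>s. F (x + s *\<^sub>R b)) has_vector_derivative
         iter_partial (b # bs) f (x + s *\<^sub>R b)) (at s)"
      using C_infty_has_vector_derivative[OF f bs b(1)] by (simp add: F_def)
    show ?thesis
      unfolding u_def u'_def
      by (rule derivative_eq_intros 1 2 | simp)+
  qed
  ultimately have "cmod (u h - u 0) \<le> e * h * \<bar>h\<bar>"
    using h by (intro mean_value_norm_bound) auto
  then show ?thesis
    using h by (simp add: u_def algebra_simps power2_eq_square)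
qed

text \<open>Schwarz's theorem: the second difference \<Delta> is symmetric in b and c, and for small
  h its quotient by h^2 is within e/2 of either mixed derivative at x.\<close>

lemma iter_partial_swap:
  assumes f: "f \<in> C_infty" and bs: "set bs \<subseteq> Basis" and b: "b \<in> Basis" "c \<in> Basis"
  shows "iter_partial (b # c # bs) f = iter_partial (c # b # bs) f"
proof
  fix x
  define D where "D = iter_partial (c # b # bs) f x"
  define D' where "D' = iter_partial (b # c # bs) f x"
  have near: "\<exists>d>0. \<forall>s t. \<bar>s\<bar> \<le> d \<longrightarrow> \<bar>t\<bar> \<le> d \<longrightarrow>
      cmod (iter_partial us f (x + s *\<^sub>R b' + t *\<^sub>R c') - iter_partial us f x) \<le> e"
    if us: "set us \<subseteq> Basis" and e: "e > 0" and b': "b' \<in> Basis" "c' \<in> Basis" for us b' c' e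
  proof -
    have "continuous_on UNIV (iter_partial us f)"
      using f us by (rule C_infty_continuous_on)
    then obtain d where d: "d > 0"
      "\<And>y. dist y x < d \<Longrightarrow> dist (iter_partial us f y) (iter_partial us f x) < e"
      using e unfolding continuous_on_iff by (metis UNIV_I)
    have "cmod (iter_partial us f (x + s *\<^sub>R b' + t *\<^sub>R c') - iter_partial us f x) \<le> e"
      if st: "\<bar>s\<bar> \<le> d / 3" "\<bar>t\<bar> \<le> d / 3" for s t
    proof -
      have "norm (s *\<^sub>R b' + t *\<^sub>R c') \<le> \<bar>s\<bar> + \<bar>t\<bar>"
        using norm_triangle_ineq[of "s *\<^sub>R b'" "t *\<^sub>R c'"] b' by simp
      also have "\<dots> < d" using st d(1) by linarith
      finally have "dist (x + s *\<^sub>R b' + t *\<^sub>R c') x < d"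
        by (simp add: dist_norm algebra_simps)
      from d(2)[OF this] show ?thesis by (simp add: dist_norm)
    qed
    then show ?thesis using d(1) by (intro exI[of _ "d / 3"]) auto
  qed
  have "cmod (D - D') \<le> e" if "e > 0" for e :: real
  proof -
    have "e / 2 > 0" using that by simp
    obtain d1 where d1: "d1 > 0" "\<And>s t. \<bar>s\<bar> \<le> d1 \<Longrightarrow> \<bar>t\<bar> \<le> d1 \<Longrightarrow>
      cmod (iter_partial (c # b # bs) f (x + s *\<^sub>R b + t *\<^sub>R c) - D) \<le> e / 2"
      using near[of "c # b # bs" "e / 2" b c] b bs \<open>e / 2 > 0\<close> unfolding D_def by auto
    obtain d2 where d2: "d2 > 0" "\<And>s t. \<bar>s\<bar> \<le> d2 \<Longrightarrow> \<bar>t\<bar> \<le> d2 \<Longrightarrow>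
      cmod (iter_partial (b # c # bs) f (x + s *\<^sub>R c + t *\<^sub>R b) - D') \<le> e / 2"
      using near[of "b # c # bs" "e / 2" c b] b bs \<open>e / 2 > 0\<close> unfolding D'_def by auto
    define h where "h = min d1 d2"
    have h: "h > 0" "h \<le> d1" "h \<le> d2" using d1(1) d2(1) by (auto simp: h_def)
    define F where "F = iter_partial bs f"
    define \<Delta> where "\<Delta> = F (x + h *\<^sub>R b + h *\<^sub>R c) - F (x + h *\<^sub>R b) - F (x + h *\<^sub>R c) + F x"
    have 1: "cmod (\<Delta> - h\<^sup>2 * D) \<le> e / 2 * h\<^sup>2"
      unfolding \<Delta>_def F_def
      by (rule second_difference_bound[OF f bs b h(1)], rule d1(2)) (use h in auto)
    have eq: "x + h *\<^sub>R c + h *\<^sub>R b = x + h *\<^sub>R b + h *\<^sub>R c"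
      by (simp only: add.assoc add.commute[of "h *\<^sub>R c"])
    have "cmod (F (x + h *\<^sub>R c + h *\<^sub>R b) - F (x + h *\<^sub>R c) - F (x + h *\<^sub>R b) + F x - h\<^sup>2 * D')
        \<le> e / 2 * h\<^sup>2"
      unfolding F_def
      by (rule second_difference_bound[OF f bs b(2,1) h(1)], rule d2(2)) (use h in auto)
    moreover have "\<Delta> = F (x + h *\<^sub>R b + h *\<^sub>R c) - F (x + h *\<^sub>R c) - F (x + h *\<^sub>R b) + F x"
      unfolding \<Delta>_def by simp
    ultimately have 2: "cmod (\<Delta> - h\<^sup>2 * D') \<le> e / 2 * h\<^sup>2"
      by (simp only: eq)
    have "h\<^sup>2 * cmod (D - D') = cmod (complex_of_real (h\<^sup>2) * (D - D'))"
      by (simp only: norm_mult norm_of_real abs_power2)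
    also have "complex_of_real (h\<^sup>2) * (D - D')
        = (\<Delta> - complex_of_real (h\<^sup>2) * D') - (\<Delta> - complex_of_real (h\<^sup>2) * D)"
      unfolding right_diff_distrib by simp
    also have "cmod \<dots> \<le> e / 2 * h\<^sup>2 + e / 2 * h\<^sup>2"
      by (rule order_trans[OF norm_triangle_ineq4 add_mono[OF 2 1]])
    also have "\<dots> = h\<^sup>2 * e" by simp
    finally have "h\<^sup>2 * cmod (D - D') \<le> h\<^sup>2 * e" .
    then show ?thesis
      by (rule mult_left_le_imp_le) (rule zero_less_power[OF h(1)])
  qed
  then have "cmod (D - D') \<le> 0" by (rule field_le_epsilon) simp
  then show "iter_partial (b # c # bs) f x = iter_partial (c # b # bs) f x"
    by (simp add: D_def D'_def)
qed

lemma iter_partial_move: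
  assumes "f \<in> C_infty" "set (us @ b # vs) \<subseteq> Basis"
  shows "iter_partial (us @ b # vs) f = iter_partial (b # us @ vs) f"
  using assms(2)
proof (induction us)
  case (Cons u us)
  then have "iter_partial ((u # us) @ b # vs) f = iter_partial (u # b # us @ vs) f"
    by (simp add: iter_partial_Cons)
  also have "\<dots> = iter_partial (b # u # us @ vs) f"
    using Cons.prems by (intro iter_partial_swap assms(1)) auto
  finally show ?case by simp
qed simp

text \<open>The head of \<open>bs\<close> is pulled to the front of \<open>cs\<close> by swaps, and
  induction handles the rest. This frees the estimates from the unspecified order chosen in
  \<open>multi_deriv\<close>.\<close>

lemma iter_partial_cong_mset:
  assumes "f \<in> C_infty" "set bs \<subseteq> Basis" "mset bs = mset cs"
  shows "iter_partial bs f = iter_partial cs f"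
  using assms(2,3)
proof (induction bs arbitrary: cs)
  case (Cons b bs)
  have "b \<in> set cs" using Cons.prems by (metis list.set_intros(1) set_mset_mset)
  then obtain us vs where cs: "cs = us @ b # vs" by (meson split_list)
  have sub: "set cs \<subseteq> Basis" using Cons.prems by (metis set_mset_mset)
  have "iter_partial bs f = iter_partial (us @ vs) f"
    using Cons by (intro Cons.IH) (auto simp: cs)
  then have "iter_partial (b # bs) f = iter_partial (b # us @ vs) f"
    by (simp add: iter_partial_Cons)
  also have "\<dots> = iter_partial cs f"
    using iter_partial_move assms(1) sub cs by metis
  finally show ?case .
qed simp

section \<open>Multi-indices, lists of directions and weighted bounds\<close>

definition multi_list :: "('a::euclidean_space \<Rightarrow> nat) \<Rightarrow> 'a list" where
  "multi_list \<alpha> = (SOME bs. set bs \<subseteq> Basis \<and> (\<forall>b\<in>Basis. count_list bs b = \<alpha> b))"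

lemma multi_list:
  fixes \<alpha> :: "'a::euclidean_space \<Rightarrow> nat"
  shows "set (multi_list \<alpha>) \<subseteq> Basis" "b \<in> Basis \<Longrightarrow> count_list (multi_list \<alpha>) b = \<alpha> b"
proof -
  \<comment> \<open>The multiplicities vanish off the finite \<open>Basis\<close>, so they form a
    multiset, and any enumeration of it is a witness for the choice.\<close>
  define M where "M = Abs_multiset (\<lambda>b. if b \<in> Basis then \<alpha> b else 0)"
  have count: "count M b = (if b \<in> Basis then \<alpha> b else 0)" for b
    unfolding M_def
    by (subst count_Abs_multiset) (auto intro: finite_subset[OF _ finite_Basis] split: if_splits)
  obtain bs where bs: "mset bs = M" using ex_mset by blast
  have "set bs \<subseteq> Basis \<and> (\<forall>b\<in>Basis. count_list bs b = \<alpha> b)"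
    using count by (metis bs count_mset count_mset_0_iff subsetI)
  then have "set (multi_list \<alpha>) \<subseteq> Basis \<and> (\<forall>b\<in>Basis. count_list (multi_list \<alpha>) b = \<alpha> b)"
    unfolding multi_list_def by (rule someI)
  then show "set (multi_list \<alpha>) \<subseteq> Basis" "b \<in> Basis \<Longrightarrow> count_list (multi_list \<alpha>) b = \<alpha> b"
    by auto
qed

lemma length_multi_list: "length (multi_list \<alpha>) = (\<Sum>b\<in>Basis. \<alpha> b)"
  using sum_count_set[OF multi_list(1) finite_Basis, of \<alpha>] by (simp add: multi_list(2))

lemma multi_deriv_eq_iter_partial: "multi_deriv \<alpha> f = iter_partial (multi_list \<alpha>) f"
  by (simp add: multi_deriv_def multi_list_def)

lemma iter_partial_eq_multi_deriv:
  assumes "f \<in> C_infty" "set bs \<subseteq> Basis"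
  shows "iter_partial bs f = multi_deriv (count_list bs) f"
  unfolding multi_deriv_eq_iter_partial
proof (rule iter_partial_cong_mset[OF assms])
  show "mset bs = mset (multi_list (count_list bs))"
  proof (rule multiset_eqI)
    fix b
    have "b \<notin> Basis \<Longrightarrow> b \<notin> set bs \<and> b \<notin> set (multi_list (count_list bs))"
      using assms(2) multi_list(1) by blast
    then show "count (mset bs) b = count (mset (multi_list (count_list bs))) b"
      by (cases "b \<in> Basis") (auto simp: count_mset multi_list(2) count_list_0_iff)
  qed
qed

text \<open>A real-valued substitute for bounds on \<open>\<mu>\<close>. Lists allow one direction
  to be split off at a time, which multi-indices do not.\<close>

definition deriv_bound :: "int \<Rightarrow> nat \<Rightarrow> ('a::euclidean_space \<Rightarrow> complex) \<Rightarrow> real \<Rightarrow> bool" where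
  "deriv_bound r l f C \<longleftrightarrow> (\<forall>bs x. set bs \<subseteq> Basis \<longrightarrow> length bs \<le> l \<longrightarrow>
     (1 + norm x) powi r * cmod (iter_partial bs f x) \<le> C)"

lemma deriv_boundD:
  "deriv_bound r l f C \<Longrightarrow> set bs \<subseteq> Basis \<Longrightarrow> length bs \<le> l \<Longrightarrow>
     (1 + norm x) powi r * cmod (iter_partial bs f x) \<le> C"
  by (auto simp: deriv_bound_def)

lemma deriv_bound_nonneg: "deriv_bound r l f C \<Longrightarrow> 0 \<le> C"
  using deriv_boundD[of r l f C "[]" 0] by (simp add: order_trans[OF norm_ge_zero])

text \<open>By symmetry of derivatives, lists and multi-indices run through the same functions.
  Nonnegativity of C matters because \<open>ennreal\<close> sends negative numbers to 0.\<close>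

lemma \<mu>_le_iff:
  fixes f :: "'a::euclidean_space \<Rightarrow> complex"
  assumes "f \<in> C_infty" "C \<ge> 0"
  shows "\<mu> r l f \<le> ennreal C \<longleftrightarrow> deriv_bound r l f C"
proof
  assume le: "\<mu> r l f \<le> ennreal C"
  show "deriv_bound r l f C"
    unfolding deriv_bound_def
  proof (intro allI impI)
    fix bs :: "'a list" and x :: 'a
    assume bs: "set bs \<subseteq> Basis" "length bs \<le> l"
    have "ennreal ((1 + norm x) powi r * cmod (iter_partial bs f x)) \<le> \<mu> r l f"
      unfolding \<mu>_def iter_partial_eq_multi_deriv[OF assms(1) bs(1)]
      using sum_count_set[OF bs(1)] bs(2)
      by (intro Sup_upper CollectI exI[of _ x] exI[of _ "count_list bs"]) auto
    then show "(1 + norm x) powi r * cmod (iter_partial bs f x) \<le> C"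
      using order_trans[OF _ le] ennreal_le_iff[OF assms(2)] by blast
  qed
next
  assume "deriv_bound r l f C"
  then show "\<mu> r l f \<le> ennreal C"
    unfolding \<mu>_def multi_deriv_eq_iter_partial
    by (intro Sup_least)
       (auto intro!: ennreal_leI deriv_boundD[of r l] dest: subsetD[OF multi_list(1)]
         simp: length_multi_list)
qed

lemma \<mu>_finite_iff:
  assumes "f \<in> C_infty"
  shows "\<mu> r l f < \<infinity> \<longleftrightarrow> (\<exists>C. deriv_bound r l f C)"
proof
  assume "\<mu> r l f < \<infinity>"
  then have "\<mu> r l f \<le> ennreal (enn2real (\<mu> r l f))" by simp
  then show "\<exists>C. deriv_bound r l f C" using \<mu>_le_iff[OF assms] enn2real_nonneg by blast
next
  assume "\<exists>C. deriv_bound r l f C"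
  then show "\<mu> r l f < \<infinity>"
    using \<mu>_le_iff[OF assms] deriv_bound_nonneg ennreal_less_top
    unfolding infinity_ennreal_def by (blast intro: le_less_trans)
qed

section \<open>Estimates for functions and nets\<close>

lemma
  assumes f: "f \<in> C_infty" and g: "g \<in> C_infty"
  shows C_infty_lincomb: "(\<lambda>x. a * f x + b * g x) \<in> C_infty"
    and iter_partial_lincomb: "set bs \<subseteq> Basis \<Longrightarrow>
      iter_partial bs (\<lambda>x. a * f x + b * g x) = (\<lambda>x. a * iter_partial bs f x + b * iter_partial bs g x)"
proof -
  note * = C_inftyI[where G = "\<lambda>bs x. a * iter_partial bs f x + b * iter_partial bs g x"]
    iter_partial_eqI[where G = "\<lambda>bs x. a * iter_partial bs f x + b * iter_partial bs g x"]
  have deriv: "((\<lambda>t. a * iter_partial bs f (x + t *\<^sub>R c) + b * iter_partial bs g (x + t *\<^sub>R c))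
      has_vector_derivative a * iter_partial (c # bs) f x + b * iter_partial (c # bs) g x) (at 0)"
    if "set bs \<subseteq> Basis" "c \<in> Basis" for bs c x
    using that C_infty_has_vector_derivative[OF f, of bs c x 0] C_infty_has_vector_derivative[OF g, of bs c x 0]
    by (auto intro!: has_vector_derivative_add has_vector_derivative_mult_right)
  show "(\<lambda>x. a * f x + b * g x) \<in> C_infty"
    by (rule *(1)) (use deriv in \<open>auto intro!: continuous_intros C_infty_continuous_on f g\<close>)
  show "set bs \<subseteq> Basis \<Longrightarrow>
      iter_partial bs (\<lambda>x. a * f x + b * g x) = (\<lambda>x. a * iter_partial bs f x + b * iter_partial bs g x)"
    by (rule *(2)) (use deriv in \<open>auto intro!: continuous_intros C_infty_continuous_on f g\<close>)
qed

lemma deriv_bound_lincomb: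
  assumes "f \<in> C_infty" "g \<in> C_infty" and A: "deriv_bound r l f A" and B: "deriv_bound r l g B"
  shows "deriv_bound r l (\<lambda>x. a * f x + b * g x) (cmod a * A + cmod b * B)"
  unfolding deriv_bound_def
proof (intro allI impI)
  fix bs and x :: 'a
  assume bs: "set bs \<subseteq> (Basis :: 'a set)" "length bs \<le> l"
  define w where "w = (1 + norm x) powi r"
  have "w \<ge> 0" by (simp add: w_def)
  have "w * cmod (a * iter_partial bs f x + b * iter_partial bs g x)
      \<le> w * (cmod a * cmod (iter_partial bs f x) + cmod b * cmod (iter_partial bs g x))"
    using \<open>w \<ge> 0\<close> by (intro mult_left_mono order_trans[OF norm_triangle_ineq]) (simp_all add: norm_mult)
  also have "\<dots> = cmod a * (w * cmod (iter_partial bs f x)) + cmod b * (w * cmod (iter_partial bs g x))"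
    by (simp add: algebra_simps)
  also have "\<dots> \<le> cmod a * A + cmod b * B"
    using deriv_boundD[OF A bs] deriv_boundD[OF B bs]
    by (intro add_mono mult_left_mono) (simp_all add: w_def)
  finally show "(1 + norm x) powi r * cmod (iter_partial bs (\<lambda>x. a * f x + b * g x) x)
      \<le> cmod a * A + cmod b * B"
    by (simp add: iter_partial_lincomb assms bs w_def)
qed

lemma deriv_bound_mono:
  assumes "deriv_bound r l f A" "r' \<le> r" "l' \<le> l" "A \<le> B"
  shows "deriv_bound r' l' f B"
  unfolding deriv_bound_def
proof (intro allI impI)
  fix bs and x :: 'a
  assume bs: "set bs \<subseteq> (Basis :: 'a set)" "length bs \<le> l'"
  have "(1 + norm x) powi r' * cmod (iter_partial bs f x) \<le> (1 + norm x) powi r * cmod (iter_partial bs f x)"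
    using assms by (intro mult_right_mono power_int_increasing) auto
  also have "\<dots> \<le> A" using bs assms(3) by (intro deriv_boundD[OF assms(1)]) auto
  finally show "(1 + norm x) powi r' * cmod (iter_partial bs f x) \<le> B" using assms(4) by simp
qed

lemma schwartz_iff:
  "f \<in> schwartz \<longleftrightarrow> f \<in> C_infty \<and> (\<forall>q l. \<exists>C. deriv_bound (int q) l f C)"
  by (auto simp: schwartz_def \<mu>_finite_iff simp del: infinity_ennreal_def)

lemma O_M_iff: "f \<in> O_M \<longleftrightarrow> f \<in> C_infty \<and> (\<forall>l. \<exists>q C. deriv_bound (- int q) l f C)"
  by (auto simp: O_M_def \<mu>_finite_iff simp del: infinity_ennreal_def)

section \<open>Asymptotic bounds for nets of functions and of scalars\<close>

lemma eventually_at_right_0_1: "\<forall>\<^sub>F \<epsilon> in at_right (0::real). \<epsilon> \<in> {0<..1}"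
  unfolding eventually_at_right_field by (intro exI[of _ 1]) auto

text \<open>A larger k is a stronger bound: moderateness asks for some k = -N, negligibility for
  every k = p. Both cases are treated uniformly through integer exponents.\<close>

definition net_bound :: "int \<Rightarrow> nat \<Rightarrow> 'a::euclidean_space net \<Rightarrow> int \<Rightarrow> bool" where
  "net_bound r l f k \<longleftrightarrow> (\<exists>C. \<forall>\<^sub>F \<epsilon> in at_right 0. deriv_bound r l (f \<epsilon>) (C * \<epsilon> powi k))"

definition const_bound :: "(real \<Rightarrow> complex) \<Rightarrow> int \<Rightarrow> bool" where
  "const_bound c k \<longleftrightarrow> (\<exists>C. \<forall>\<^sub>F \<epsilon> in at_right 0. cmod (c \<epsilon>) \<le> C * \<epsilon> powi k)"

lemma net_boundE:
  assumes "net_bound r l f k"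
  obtains C where "C \<ge> 0" "\<forall>\<^sub>F \<epsilon> in at_right 0. deriv_bound r l (f \<epsilon>) (C * \<epsilon> powi k)"
proof -
  obtain C where C: "\<forall>\<^sub>F \<epsilon> in at_right 0. deriv_bound r l (f \<epsilon>) (C * \<epsilon> powi k)"
    using assms by (auto simp: net_bound_def)
  have "\<forall>\<^sub>F \<epsilon> in at_right 0. deriv_bound r l (f \<epsilon>) (\<bar>C\<bar> * \<epsilon> powi k)"
    using C eventually_at_right_0_1
    by eventually_elim (auto intro: deriv_bound_mono mult_right_mono)
  then show ?thesis using that[of "\<bar>C\<bar>"] by simp
qed

lemma const_boundE:
  assumes "const_bound c k"
  obtains C where "C \<ge> 0" "\<forall>\<^sub>F \<epsilon> in at_right 0. cmod (c \<epsilon>) \<le> C * \<epsilon> powi k"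
proof -
  obtain C where C: "\<forall>\<^sub>F \<epsilon> in at_right 0. cmod (c \<epsilon>) \<le> C * \<epsilon> powi k"
    using assms by (auto simp: const_bound_def)
  have "\<forall>\<^sub>F \<epsilon> in at_right 0. cmod (c \<epsilon>) \<le> \<bar>C\<bar> * \<epsilon> powi k"
    using C eventually_at_right_0_1
    by eventually_elim (auto intro: order_trans mult_right_mono)
  then show ?thesis using that[of "\<bar>C\<bar>"] by simp
qed

lemma bigO_powi_\<mu>_iff:
  assumes "\<And>\<epsilon>. \<epsilon> \<in> {0<..1} \<Longrightarrow> f \<epsilon> \<in> C_infty"
  shows "bigO_powi (\<lambda>\<epsilon>. \<mu> r l (f \<epsilon>)) k \<longleftrightarrow> net_bound r l f k"
proof
  assume "bigO_powi (\<lambda>\<epsilon>. \<mu> r l (f \<epsilon>)) k"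
  then obtain C where C: "\<forall>\<^sub>F \<epsilon> in at_right 0. \<mu> r l (f \<epsilon>) \<le> ennreal (C * \<epsilon> powi k)"
    by (auto simp: bigO_powi_def)
  have "\<forall>\<^sub>F \<epsilon> in at_right 0. deriv_bound r l (f \<epsilon>) (\<bar>C\<bar> * \<epsilon> powi k)"
    using C eventually_at_right_0_1
  proof eventually_elim
    case (elim \<epsilon>)
    have "\<mu> r l (f \<epsilon>) \<le> ennreal (\<bar>C\<bar> * \<epsilon> powi k)"
      using elim by (intro order_trans[OF elim(1)] ennreal_leI mult_right_mono) auto
    then show ?case using elim assms by (subst (asm) \<mu>_le_iff) auto
  qed
  then show "net_bound r l f k" by (auto simp: net_bound_def)
next
  assume "net_bound r l f k"
  then obtain C where C: "C \<ge> 0" "\<forall>\<^sub>F \<epsilon> in at_right 0. deriv_bound r l (f \<epsilon>) (C * \<epsilon> powi k)"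
    by (rule net_boundE)
  have "\<forall>\<^sub>F \<epsilon> in at_right 0. \<mu> r l (f \<epsilon>) \<le> ennreal (C * \<epsilon> powi k)"
    using C(2) eventually_at_right_0_1 by eventually_elim (use assms C(1) in \<open>auto simp: \<mu>_le_iff\<close>)
  then show "bigO_powi (\<lambda>\<epsilon>. \<mu> r l (f \<epsilon>)) k" by (auto simp: bigO_powi_def)
qed

lemma net_bound_mono:
  assumes "net_bound r l f k" "r' \<le> r" "l' \<le> l" "k' \<le> k"
  shows "net_bound r' l' f k'"
proof -
  obtain C where C: "C \<ge> 0" "\<forall>\<^sub>F \<epsilon> in at_right 0. deriv_bound r l (f \<epsilon>) (C * \<epsilon> powi k)"
    using assms(1) by (rule net_boundE)
  have "\<forall>\<^sub>F \<epsilon> in at_right 0. deriv_bound r' l' (f \<epsilon>) (C * \<epsilon> powi k')"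
    using C(2) eventually_at_right_0_1
  proof eventually_elim
    case (elim \<epsilon>)
    have "\<epsilon> powi k \<le> \<epsilon> powi k'"
      using elim(2) assms(4) by (intro power_int_decreasing) auto
    then show ?case
      using C(1) by (intro deriv_bound_mono[OF elim(1) assms(2,3)] mult_left_mono)
  qed
  then show ?thesis by (auto simp: net_bound_def)
qed

text \<open>The orders of scalar and net add, and k may be any common lower bound, so one statement
  serves moderate and null combinations alike.\<close>

lemma net_bound_lincomb:
  assumes f: "\<And>\<epsilon>. \<epsilon> \<in> {0<..1} \<Longrightarrow> f \<epsilon> \<in> C_infty" and g: "\<And>\<epsilon>. \<epsilon> \<in> {0<..1} \<Longrightarrow> g \<epsilon> \<in> C_infty"
    and c: "const_bound c i" "const_bound d i'"
    and fg: "net_bound r l f j" "net_bound r l g j'"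
    and k: "k \<le> i + j" "k \<le> i' + j'"
  shows "net_bound r l (\<lambda>\<epsilon> x. c \<epsilon> * f \<epsilon> x + d \<epsilon> * g \<epsilon> x) k"
proof -
  obtain A where A: "A \<ge> 0" "\<forall>\<^sub>F \<epsilon> in at_right 0. cmod (c \<epsilon>) \<le> A * \<epsilon> powi i"
    using c(1) by (rule const_boundE)
  obtain B where B: "B \<ge> 0" "\<forall>\<^sub>F \<epsilon> in at_right 0. cmod (d \<epsilon>) \<le> B * \<epsilon> powi i'"
    using c(2) by (rule const_boundE)
  obtain A' where A': "A' \<ge> 0" "\<forall>\<^sub>F \<epsilon> in at_right 0. deriv_bound r l (f \<epsilon>) (A' * \<epsilon> powi j)"
    using fg(1) by (rule net_boundE)
  obtain B' where B': "B' \<ge> 0" "\<forall>\<^sub>F \<epsilon> in at_right 0. deriv_bound r l (g \<epsilon>) (B' * \<epsilon> powi j')"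
    using fg(2) by (rule net_boundE)
  have "\<forall>\<^sub>F \<epsilon> in at_right 0. deriv_bound r l (\<lambda>x. c \<epsilon> * f \<epsilon> x + d \<epsilon> * g \<epsilon> x)
      ((A * A' + B * B') * \<epsilon> powi k)"
    using A(2) B(2) A'(2) B'(2) eventually_at_right_0_1
  proof eventually_elim
    case (elim \<epsilon>)
    have *: "u * v \<le> (U * V) * \<epsilon> powi k"
      if "u \<le> U * \<epsilon> powi n" "v = V * \<epsilon> powi n'" "k \<le> n + n'" "u \<ge> 0" "U \<ge> 0" "V \<ge> 0"
      for u v U V n n'
    proof -
      have "u * v \<le> (U * \<epsilon> powi n) * (V * \<epsilon> powi n')"
        using that elim by (auto intro!: mult_right_mono)
      also have "\<dots> = (U * V) * \<epsilon> powi (n + n')"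
        using elim by (simp add: power_int_add)
      also have "\<dots> \<le> (U * V) * \<epsilon> powi k"
        using that elim by (intro mult_left_mono power_int_decreasing) auto
      finally show ?thesis .
    qed
    have "cmod (c \<epsilon>) * (A' * \<epsilon> powi j) + cmod (d \<epsilon>) * (B' * \<epsilon> powi j')
        \<le> A * A' * \<epsilon> powi k + B * B' * \<epsilon> powi k"
      by (intro add_mono *[OF elim(1) refl k(1)] *[OF elim(2) refl k(2)]) (use A B A' B' in auto)
    then show ?case
      using elim f g by (intro deriv_bound_mono[OF deriv_bound_lincomb[of _ _ r l "A' * \<epsilon> powi j" "B' * \<epsilon> powi j'"]])
        (auto simp: algebra_simps)
  qed
  then show ?thesis by (auto simp: net_bound_def)
qed

lemma bigo_iff_const_bound:
  "(\<lambda>\<epsilon>. cmod (c \<epsilon>)) \<in> O[at_right 0](\<lambda>\<epsilon>. \<epsilon> powi k) \<longleftrightarrow> const_bound c k"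
proof
  assume "(\<lambda>\<epsilon>. cmod (c \<epsilon>)) \<in> O[at_right 0](\<lambda>\<epsilon>. \<epsilon> powi k)"
  then obtain C where C: "\<forall>\<^sub>F \<epsilon> in at_right 0. norm (cmod (c \<epsilon>)) \<le> C * norm (\<epsilon> powi k)"
    by (auto elim!: landau_o.bigE)
  have "\<forall>\<^sub>F \<epsilon> in at_right 0. cmod (c \<epsilon>) \<le> C * \<epsilon> powi k"
    using C eventually_at_right_0_1 by eventually_elim auto
  then show "const_bound c k" by (auto simp: const_bound_def)
next
  assume "const_bound c k"
  then obtain C where C: "\<forall>\<^sub>F \<epsilon> in at_right 0. cmod (c \<epsilon>) \<le> C * \<epsilon> powi k"
    by (auto simp: const_bound_def)
  have "\<forall>\<^sub>F \<epsilon> in at_right 0. norm (cmod (c \<epsilon>)) \<le> C * norm (\<epsilon> powi k)"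
    using C eventually_at_right_0_1 by eventually_elim auto
  then show "(\<lambda>\<epsilon>. cmod (c \<epsilon>)) \<in> O[at_right 0](\<lambda>\<epsilon>. \<epsilon> powi k)" by (rule bigoI)
qed

lemma carrier_moderate_const_iff: "c \<in> carrier moderate_const \<longleftrightarrow> (\<exists>N::nat. const_bound c (- int N))"
  by (simp add: moderate_const_def bigo_iff_const_bound)

lemma null_const_iff: "c \<in> null_const \<longleftrightarrow> (\<forall>p::nat. const_bound c (int p))"
  by (simp add: null_const_def flip: bigo_iff_const_bound)

lemma const_bound_constant: "const_bound (\<lambda>_. c) 0"
  by (auto simp: const_bound_def)

lemma constant_moderate: "(\<lambda>_. c) \<in> carrier moderate_const"
  using const_bound_constant by (auto simp: carrier_moderate_const_iff intro!: exI[of _ 0])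

lemma moderate_S_iff: "f \<in> moderate_S \<longleftrightarrow> (\<forall>\<epsilon>\<in>{0<..1}. f \<epsilon> \<in> schwartz) \<and>
     (\<forall>q l. \<exists>N. net_bound (int q) l f (- int N))"
  unfolding moderate_S_def using bigO_powi_\<mu>_iff[of f] by (auto simp: schwartz_iff)

lemma null_S_iff: "f \<in> null_S \<longleftrightarrow> (\<forall>\<epsilon>\<in>{0<..1}. f \<epsilon> \<in> schwartz) \<and>
     (\<forall>q l p. net_bound (int q) l f (int p))"
  unfolding null_S_def using bigO_powi_\<mu>_iff[of f] by (auto simp: schwartz_iff)

lemma moderate_tau_iff: "f \<in> moderate_tau \<longleftrightarrow> (\<forall>\<epsilon>\<in>{0<..1}. f \<epsilon> \<in> O_M) \<and>
     (\<forall>l. \<exists>q N. net_bound (- int q) l f (- int N))"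
  unfolding moderate_tau_def using bigO_powi_\<mu>_iff[of f] by (auto simp: O_M_iff)

lemma null_tau_iff: "f \<in> null_tau \<longleftrightarrow> (\<forall>\<epsilon>\<in>{0<..1}. f \<epsilon> \<in> O_M) \<and>
     (\<forall>l. \<exists>q. \<forall>p. net_bound (- int q) l f (int p))"
  unfolding null_tau_def using bigO_powi_\<mu>_iff[of f] by (auto simp: O_M_iff)

lemma schwartz_lincomb:
  assumes "f \<in> schwartz" "g \<in> schwartz"
  shows "(\<lambda>x. a * f x + b * g x) \<in> schwartz"
  using assms unfolding schwartz_iff by (blast intro: C_infty_lincomb deriv_bound_lincomb)

lemma O_M_lincomb:
  assumes "f \<in> O_M" "g \<in> O_M"
  shows "(\<lambda>x. a * f x + b * g x) \<in> O_M"
  unfolding O_M_iff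
proof (intro conjI allI)
  fix l
  obtain q q' A B where "deriv_bound (- int q) l f A" "deriv_bound (- int q') l g B"
    using assms by (auto simp: O_M_iff) meson
  then have "deriv_bound (- int (max q q')) l f A" "deriv_bound (- int (max q q')) l g B"
    by (auto elim!: deriv_bound_mono)
  then show "\<exists>q C. deriv_bound (- int q) l (\<lambda>x. a * f x + b * g x) C"
    using assms by (blast intro: deriv_bound_lincomb dest: O_M_iff[THEN iffD1])
qed (use assms in \<open>auto simp: O_M_iff intro: C_infty_lincomb\<close>)

lemma moderate_tau_lincomb:
  assumes f: "f \<in> moderate_tau" and g: "g \<in> moderate_tau"
    and c: "c \<in> carrier moderate_const" and d: "d \<in> carrier moderate_const"
  shows "(\<lambda>\<epsilon> x. c \<epsilon> * f \<epsilon> x + d \<epsilon> * g \<epsilon> x) \<in> moderate_tau"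
  unfolding moderate_tau_iff
proof (intro conjI allI ballI)
  fix l
  obtain q N where 1: "net_bound (- int q) l f (- int N)" using f unfolding moderate_tau_iff by blast
  obtain q' N' where 2: "net_bound (- int q') l g (- int N')" using g unfolding moderate_tau_iff by blast
  obtain M where 3: "const_bound c (- int M)" using c by (auto simp: carrier_moderate_const_iff)
  obtain M' where 4: "const_bound d (- int M')" using d by (auto simp: carrier_moderate_const_iff)
  have "net_bound (- int (max q q')) l (\<lambda>\<epsilon> x. c \<epsilon> * f \<epsilon> x + d \<epsilon> * g \<epsilon> x) (- int (M + M' + N + N'))"
    by (rule net_bound_lincomb[OF _ _ 3 4 net_bound_mono[OF 1] net_bound_mono[OF 2]])
       (use f g in \<open>auto simp: moderate_tau_iff O_M_iff\<close>)
  then show "\<exists>q N. net_bound (- int q) l (\<lambda>\<epsilon> x. c \<epsilon> * f \<epsilon> x + d \<epsilon> * g \<epsilon> x) (- int N)" by blast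
qed (use f g in \<open>auto simp: moderate_tau_iff intro: O_M_lincomb\<close>)

lemma moderate_S_lincomb:
  assumes f: "f \<in> moderate_S" and g: "g \<in> moderate_S"
    and c: "c \<in> carrier moderate_const" and d: "d \<in> carrier moderate_const"
  shows "(\<lambda>\<epsilon> x. c \<epsilon> * f \<epsilon> x + d \<epsilon> * g \<epsilon> x) \<in> moderate_S"
  unfolding moderate_S_iff
proof (intro conjI allI ballI)
  fix q l
  obtain N where 1: "net_bound (int q) l f (- int N)" using f unfolding moderate_S_iff by blast
  obtain N' where 2: "net_bound (int q) l g (- int N')" using g unfolding moderate_S_iff by blast
  obtain M where 3: "const_bound c (- int M)" using c by (auto simp: carrier_moderate_const_iff)
  obtain M' where 4: "const_bound d (- int M')" using d by (auto simp: carrier_moderate_const_iff)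
  have "net_bound (int q) l (\<lambda>\<epsilon> x. c \<epsilon> * f \<epsilon> x + d \<epsilon> * g \<epsilon> x) (- int (M + M' + N + N'))"
    by (rule net_bound_lincomb[OF _ _ 3 4 1 2])
       (use f g in \<open>auto simp: moderate_S_iff schwartz_iff\<close>)
  then show "\<exists>N. net_bound (int q) l (\<lambda>\<epsilon> x. c \<epsilon> * f \<epsilon> x + d \<epsilon> * g \<epsilon> x) (- int N)" by blast
qed (use f g in \<open>auto simp: moderate_S_iff intro: schwartz_lincomb\<close>)

lemma null_tau_lincomb:
  assumes f: "f \<in> null_tau" and g: "g \<in> null_tau"
    and c: "c \<in> carrier moderate_const" and d: "d \<in> carrier moderate_const"
  shows "(\<lambda>\<epsilon> x. c \<epsilon> * f \<epsilon> x + d \<epsilon> * g \<epsilon> x) \<in> null_tau"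
  unfolding null_tau_iff
proof (intro conjI allI ballI)
  fix l
  obtain q where 1: "\<And>p. net_bound (- int q) l f (int p)" using f unfolding null_tau_iff by blast
  obtain q' where 2: "\<And>p. net_bound (- int q') l g (int p)" using g unfolding null_tau_iff by blast
  obtain M where 3: "const_bound c (- int M)" using c by (auto simp: carrier_moderate_const_iff)
  obtain M' where 4: "const_bound d (- int M')" using d by (auto simp: carrier_moderate_const_iff)
  \<comment> \<open>The growth order \<open>max q q'\<close> is fixed before p, as negligibility
    demands. The losses M and M' of the scalars are made up by using the nets at orders
    \<open>M + p\<close> and \<open>M' + p\<close>.\<close>
  have "net_bound (- int (max q q')) l (\<lambda>\<epsilon> x. c \<epsilon> * f \<epsilon> x + d \<epsilon> * g \<epsilon> x) (int p)" for p
    by (rule net_bound_lincomb[OF _ _ 3 4 net_bound_mono[OF 1[of "M + p"]] net_bound_mono[OF 2[of "M' + p"]]])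
       (use f g in \<open>auto simp: null_tau_iff O_M_iff\<close>)
  then show "\<exists>q. \<forall>p. net_bound (- int q) l (\<lambda>\<epsilon> x. c \<epsilon> * f \<epsilon> x + d \<epsilon> * g \<epsilon> x) (int p)" by blast
qed (use f g in \<open>auto simp: null_tau_iff intro: O_M_lincomb\<close>)

lemma null_S_lincomb:
  assumes f: "f \<in> null_S" and g: "g \<in> null_S"
    and c: "c \<in> carrier moderate_const" and d: "d \<in> carrier moderate_const"
  shows "(\<lambda>\<epsilon> x. c \<epsilon> * f \<epsilon> x + d \<epsilon> * g \<epsilon> x) \<in> null_S"
  unfolding null_S_iff
proof (intro conjI allI ballI)
  fix q l p
  have 1: "\<And>q p. net_bound (int q) l f (int p)" using f unfolding null_S_iff by blast
  have 2: "\<And>q p. net_bound (int q) l g (int p)" using g unfolding null_S_iff by blast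
  obtain M where 3: "const_bound c (- int M)" using c by (auto simp: carrier_moderate_const_iff)
  obtain M' where 4: "const_bound d (- int M')" using d by (auto simp: carrier_moderate_const_iff)
  show "net_bound (int q) l (\<lambda>\<epsilon> x. c \<epsilon> * f \<epsilon> x + d \<epsilon> * g \<epsilon> x) (int p)"
    by (rule net_bound_lincomb[OF _ _ 3 4 1[of q "M + p"] 2[of q "M' + p"]])
       (use f g in \<open>auto simp: null_S_iff schwartz_iff\<close>)
qed (use f g in \<open>auto simp: null_S_iff intro: schwartz_lincomb\<close>)

lemma null_const_smult_tau:
  assumes f: "f \<in> moderate_tau" and c: "c \<in> null_const"
  shows "(\<lambda>\<epsilon> x. c \<epsilon> * f \<epsilon> x) \<in> null_tau"
  unfolding null_tau_iff
proof (intro conjI allI ballI)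
  fix l
  obtain q N where 1: "net_bound (- int q) l f (- int N)" using f unfolding moderate_tau_iff by blast
  \<comment> \<open>The vanishing second summand gives the product the shape of a linear
    combination; the order \<open>N + p\<close> of c absorbs the loss N of f.\<close>
  have "net_bound (- int q) l (\<lambda>\<epsilon> x. c \<epsilon> * f \<epsilon> x + 0 * f \<epsilon> x) (int p)" for p
  proof (rule net_bound_lincomb[OF _ _ _ _ 1 1])
    show "const_bound c (int (N + p))" using c by (simp only: null_const_iff)
    show "const_bound (\<lambda>_. 0) (int (N + p))" by (auto simp: const_bound_def intro!: exI[of _ 0])
  qed (use f in \<open>auto simp: moderate_tau_iff O_M_iff\<close>)
  then show "\<exists>q. \<forall>p. net_bound (- int q) l (\<lambda>\<epsilon> x. c \<epsilon> * f \<epsilon> x) (int p)" by auto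
next
  fix \<epsilon> :: real assume "\<epsilon> \<in> {0<..1}"
  then show "(\<lambda>x. c \<epsilon> * f \<epsilon> x) \<in> O_M"
    using f O_M_lincomb[of "f \<epsilon>" "f \<epsilon>" "c \<epsilon>" 0] by (auto simp: moderate_tau_iff)
qed

lemma null_const_smult_S:
  assumes f: "f \<in> moderate_S" and c: "c \<in> null_const"
  shows "(\<lambda>\<epsilon> x. c \<epsilon> * f \<epsilon> x) \<in> null_S"
  unfolding null_S_iff
proof (intro conjI allI ballI)
  fix q l p
  obtain N where 1: "net_bound (int q) l f (- int N)" using f unfolding moderate_S_iff by blast
  have "net_bound (int q) l (\<lambda>\<epsilon> x. c \<epsilon> * f \<epsilon> x + 0 * f \<epsilon> x) (int p)"
  proof (rule net_bound_lincomb[OF _ _ _ _ 1 1])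
    show "const_bound c (int (N + p))" using c by (simp only: null_const_iff)
    show "const_bound (\<lambda>_. 0) (int (N + p))" by (auto simp: const_bound_def intro!: exI[of _ 0])
  qed (use f in \<open>auto simp: moderate_S_iff schwartz_iff\<close>)
  then show "net_bound (int q) l (\<lambda>\<epsilon> x. c \<epsilon> * f \<epsilon> x) (int p)" by simp
next
  fix \<epsilon> :: real assume "\<epsilon> \<in> {0<..1}"
  then show "(\<lambda>x. c \<epsilon> * f \<epsilon> x) \<in> schwartz"
    using f schwartz_lincomb[of "f \<epsilon>" "f \<epsilon>" "c \<epsilon>" 0] by (auto simp: moderate_S_iff)
qed

lemma null_tau_subset_moderate: "null_tau \<subseteq> moderate_tau"
proof
  fix f :: "'a net" assume f: "f \<in> null_tau"
  have "\<exists>q N. net_bound (- int q) l f (- int N)" for l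
  proof -
    obtain q where "\<And>p. net_bound (- int q) l f (int p)" using f unfolding null_tau_iff by blast
    from this[of 0] show ?thesis by (intro exI[of _ q] exI[of _ 0]) simp
  qed
  then show "f \<in> moderate_tau" using f unfolding moderate_tau_iff null_tau_iff by blast
qed

lemma null_S_subset_moderate: "null_S \<subseteq> moderate_S"
proof
  fix f :: "'a net" assume f: "f \<in> null_S"
  have "\<exists>N. net_bound (int q) l f (- int N)" for q l
  proof -
    have "\<And>p. net_bound (int q) l f (int p)" using f unfolding null_S_iff by blast
    from this[of 0] show ?thesis by (intro exI[of _ 0]) simp
  qed
  then show "f \<in> moderate_S" using f unfolding moderate_S_iff null_S_iff by blast
qed

lemma C_infty_zero: "(\<lambda>x. 0) \<in> C_infty"
  by (rule C_inftyI[where G = "\<lambda>_ _. 0"]) auto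

lemma deriv_bound_zero: "deriv_bound r l (\<lambda>x. 0) 0"
proof -
  have "iter_partial bs (\<lambda>x::'a. 0) = (\<lambda>x. 0)" if "set bs \<subseteq> Basis" for bs :: "'a::euclidean_space list"
    using that by (intro iter_partial_eqI[where G = "\<lambda>_ _. 0"]) auto
  then show ?thesis by (auto simp: deriv_bound_def)
qed

lemma null_tau_zero: "(\<lambda>_ _. 0) \<in> null_tau"
proof -
  have "net_bound r l (\<lambda>_ _. 0) k" for r l k
    unfolding net_bound_def by (rule exI[of _ 0]) (simp add: deriv_bound_zero)
  moreover have "(\<lambda>x. 0) \<in> O_M"
    unfolding O_M_iff using C_infty_zero deriv_bound_zero by blast
  ultimately show ?thesis unfolding null_tau_iff by blast
qed

lemma null_S_zero: "(\<lambda>_ _. 0) \<in> null_S"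
proof -
  have "net_bound r l (\<lambda>_ _. 0) k" for r l k
    unfolding net_bound_def by (rule exI[of _ 0]) (simp add: deriv_bound_zero)
  moreover have "(\<lambda>x. 0) \<in> schwartz"
    unfolding schwartz_iff using C_infty_zero deriv_bound_zero by blast
  ultimately show ?thesis unfolding null_S_iff by blast
qed

section \<open>Quotient modules of nets\<close>

text \<open>What \<open>G_S\<close> and \<open>G_tau\<close> have in common. The last two
  assumptions and closure of \<open>N\<close> under moderate scalars are what makes the product of a
  scalar coset and a net coset a single coset.\<close>

locale net_quotient =
  fixes E N :: "'a net set"
  assumes zero: "(\<lambda>_ _. 0) \<in> N"
    and null_subset: "N \<subseteq> E"
    and null_lincomb: "f \<in> N \<Longrightarrow> g \<in> N \<Longrightarrow> c \<in> carrier moderate_const \<Longrightarrow> d \<in> carrier moderate_const \<Longrightarrow>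
      (\<lambda>\<epsilon> x. c \<epsilon> * f \<epsilon> x + d \<epsilon> * g \<epsilon> x) \<in> N"
    and lincomb: "f \<in> E \<Longrightarrow> g \<in> E \<Longrightarrow> c \<in> carrier moderate_const \<Longrightarrow> d \<in> carrier moderate_const \<Longrightarrow>
      (\<lambda>\<epsilon> x. c \<epsilon> * f \<epsilon> x + d \<epsilon> * g \<epsilon> x) \<in> E"
    and null_smult: "f \<in> E \<Longrightarrow> c \<in> null_const \<Longrightarrow> (\<lambda>\<epsilon> x. c \<epsilon> * f \<epsilon> x) \<in> N"
begin

abbreviation cls :: "'a net \<Rightarrow> 'a net set" where
  "cls f \<equiv> N +>\<^bsub>net_module E\<^esub> f"

lemma null_add: "f \<in> N \<Longrightarrow> g \<in> N \<Longrightarrow> (\<lambda>\<epsilon> x. f \<epsilon> x + g \<epsilon> x) \<in> N"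
  using null_lincomb[of f g "\<lambda>_. 1" "\<lambda>_. 1"] by (simp add: constant_moderate)

lemma null_diff: "f \<in> N \<Longrightarrow> g \<in> N \<Longrightarrow> (\<lambda>\<epsilon> x. f \<epsilon> x - g \<epsilon> x) \<in> N"
  using null_lincomb[of f g "\<lambda>_. 1" "\<lambda>_. -1"] by (simp add: constant_moderate)

lemma add: "f \<in> E \<Longrightarrow> g \<in> E \<Longrightarrow> (\<lambda>\<epsilon> x. f \<epsilon> x + g \<epsilon> x) \<in> E"
  using lincomb[of f g "\<lambda>_. 1" "\<lambda>_. 1"] by (simp add: constant_moderate)

lemma diff: "f \<in> E \<Longrightarrow> g \<in> E \<Longrightarrow> (\<lambda>\<epsilon> x. f \<epsilon> x - g \<epsilon> x) \<in> E"
  using lincomb[of f g "\<lambda>_. 1" "\<lambda>_. -1"] by (simp add: constant_moderate)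

lemma smult: "f \<in> E \<Longrightarrow> c \<in> carrier moderate_const \<Longrightarrow> (\<lambda>\<epsilon> x. c \<epsilon> * f \<epsilon> x) \<in> E"
  using lincomb[of f f c "\<lambda>_. 0"] by (simp add: constant_moderate)

lemma null_scale: "f \<in> N \<Longrightarrow> c \<in> carrier moderate_const \<Longrightarrow> (\<lambda>\<epsilon> x. c \<epsilon> * f \<epsilon> x) \<in> N"
  using null_lincomb[of f f c "\<lambda>_. 0"] by (simp add: constant_moderate)

lemma mem_cls_iff: "g \<in> cls f \<longleftrightarrow> (\<lambda>\<epsilon> x. g \<epsilon> x - f \<epsilon> x) \<in> N"
proof -
  have "g \<in> cls f \<longleftrightarrow> (\<exists>h\<in>N. g = (\<lambda>\<epsilon> x. h \<epsilon> x + f \<epsilon> x))"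
    by (simp add: a_r_coset_def r_coset_def net_module_def)
  also have "\<dots> \<longleftrightarrow> (\<lambda>\<epsilon> x. g \<epsilon> x - f \<epsilon> x) \<in> N"
  proof
    assume "(\<lambda>\<epsilon> x. g \<epsilon> x - f \<epsilon> x) \<in> N"
    then show "\<exists>h\<in>N. g = (\<lambda>\<epsilon> x. h \<epsilon> x + f \<epsilon> x)"
      by (intro bexI[of _ "\<lambda>\<epsilon> x. g \<epsilon> x - f \<epsilon> x"]) simp_all
  qed auto
  finally show ?thesis .
qed

lemma self_mem_cls: "f \<in> cls f"
  using zero by (simp add: mem_cls_iff)

lemma cls_eq_iff: "cls f = cls g \<longleftrightarrow> (\<lambda>\<epsilon> x. f \<epsilon> x - g \<epsilon> x) \<in> N"
proof
  assume "cls f = cls g"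
  then show "(\<lambda>\<epsilon> x. f \<epsilon> x - g \<epsilon> x) \<in> N"
    using self_mem_cls[of f] by (simp add: mem_cls_iff)
next
  assume fg: "(\<lambda>\<epsilon> x. f \<epsilon> x - g \<epsilon> x) \<in> N"
  show "cls f = cls g"
  proof (intro Set.set_eqI iffI)
    fix h assume "h \<in> cls f"
    then show "h \<in> cls g" using null_add[OF _ fg, of "\<lambda>\<epsilon> x. h \<epsilon> x - f \<epsilon> x"] by (simp add: mem_cls_iff)
  next
    fix h assume "h \<in> cls g"
    then show "h \<in> cls f" using null_diff[OF _ fg, of "\<lambda>\<epsilon> x. h \<epsilon> x - g \<epsilon> x"] by (simp add: mem_cls_iff)
  qed
qed

lemma cls_subset: "f \<in> E \<Longrightarrow> cls f \<subseteq> E"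
proof
  fix g assume "f \<in> E" "g \<in> cls f"
  then show "g \<in> E"
    using add[of "\<lambda>\<epsilon> x. g \<epsilon> x - f \<epsilon> x" f] null_subset by (auto simp: mem_cls_iff)
qed

lemma carrier_FactModule: "carrier (FactModule (net_module E) N) = cls ` E"
  by (auto simp: FactModule_def A_RCOSETS_def RCOSETS_def a_r_coset_def net_module_def)

lemma add_FactModule:
  "cls f \<oplus>\<^bsub>FactModule (net_module E) N\<^esub> cls g = cls (\<lambda>\<epsilon> x. f \<epsilon> x + g \<epsilon> x)"
proof -
  have "cls f \<oplus>\<^bsub>FactModule (net_module E) N\<^esub> cls g
      = (\<Union>u\<in>cls f. \<Union>v\<in>cls g. {\<lambda>\<epsilon> x. u \<epsilon> x + v \<epsilon> x})"
    by (simp add: FactModule_def set_add_def set_mult_def net_module_def)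
  also have "\<dots> = cls (\<lambda>\<epsilon> x. f \<epsilon> x + g \<epsilon> x)"
  proof (intro Set.set_eqI iffI)
    fix h assume "h \<in> (\<Union>u\<in>cls f. \<Union>v\<in>cls g. {\<lambda>\<epsilon> x. u \<epsilon> x + v \<epsilon> x})"
    then obtain u v where "u \<in> cls f" "v \<in> cls g" "h = (\<lambda>\<epsilon> x. u \<epsilon> x + v \<epsilon> x)" by auto
    then show "h \<in> cls (\<lambda>\<epsilon> x. f \<epsilon> x + g \<epsilon> x)"
      using null_add[of "\<lambda>\<epsilon> x. u \<epsilon> x - f \<epsilon> x" "\<lambda>\<epsilon> x. v \<epsilon> x - g \<epsilon> x"]
      by (simp add: mem_cls_iff algebra_simps)
  next
    fix h assume "h \<in> cls (\<lambda>\<epsilon> x. f \<epsilon> x + g \<epsilon> x)"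
    \<comment> \<open>The decomposition is h = (h - g) + g, with g representing its own
      class.\<close>
    then have "(\<lambda>\<epsilon> x. h \<epsilon> x - g \<epsilon> x) \<in> cls f"
      by (simp add: mem_cls_iff algebra_simps)
    then show "h \<in> (\<Union>u\<in>cls f. \<Union>v\<in>cls g. {\<lambda>\<epsilon> x. u \<epsilon> x + v \<epsilon> x})"
      using self_mem_cls[of g] by (intro UN_I) auto
  qed
  finally show ?thesis .
qed

text \<open>From d g - c f = d (g - f) + (d - c) f: the first term is a moderate scalar times a null
  net, the second a null scalar times a moderate net.\<close>

lemma cls_smult_eq:
  assumes f: "f \<in> E" "g \<in> cls f"
    and c: "c \<in> carrier moderate_const" "d \<in> carrier moderate_const" "(\<lambda>\<epsilon>. d \<epsilon> - c \<epsilon>) \<in> null_const"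
  shows "cls (\<lambda>\<epsilon> x. d \<epsilon> * g \<epsilon> x) = cls (\<lambda>\<epsilon> x. c \<epsilon> * f \<epsilon> x)"
proof -
  have "(\<lambda>\<epsilon> x. d \<epsilon> * (g \<epsilon> x - f \<epsilon> x) + (d \<epsilon> - c \<epsilon>) * f \<epsilon> x) \<in> N"
    using f c by (intro null_add null_scale null_smult) (simp_all add: mem_cls_iff)
  then show ?thesis by (simp add: cls_eq_iff algebra_simps)
qed

end

text \<open>Unfolds a coset of scalars into the data that \<open>smult_FactModule\<close> consumes:
  one representative, and for every other member its moderateness and its null distance from that
  representative.\<close>

lemma carrier_gen_const:
  assumes "a \<in> carrier gen_const"
  obtains c where "c \<in> carrier moderate_const" "c \<in> a"
    "\<forall>d\<in>a. d \<in> carrier moderate_const \<and> (\<lambda>\<epsilon>. d \<epsilon> - c \<epsilon>) \<in> null_const"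
proof -
  obtain c where c: "c \<in> carrier moderate_const" and a: "a = (\<Union>h\<in>null_const. {\<lambda>\<epsilon>. h \<epsilon> + c \<epsilon>})"
    using assms
    by (auto simp: gen_const_def FactRing_def A_RCOSETS_def RCOSETS_def r_coset_def moderate_const_def)
  have "(\<lambda>_. 0) \<in> null_const"
    unfolding null_const_iff const_bound_def by (auto intro!: exI[of _ 0])
  then have "c \<in> a" by (force simp: a)
  moreover have "d \<in> carrier moderate_const \<and> (\<lambda>\<epsilon>. d \<epsilon> - c \<epsilon>) \<in> null_const" if "d \<in> a" for d
  proof -
    obtain h where h: "h \<in> null_const" and d: "d = (\<lambda>\<epsilon>. h \<epsilon> + c \<epsilon>)"
      using \<open>d \<in> a\<close> unfolding a by blast
    obtain N where N: "const_bound c (- int N)" using c by (auto simp: carrier_moderate_const_iff)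
    obtain C where C: "C \<ge> 0" "\<forall>\<^sub>F \<epsilon> in at_right 0. cmod (c \<epsilon>) \<le> C * \<epsilon> powi (- int N)"
      using N by (rule const_boundE)
    \<comment> \<open>Order 0 is enough: h is bounded near 0, and constants are dominated by
      \<epsilon> ^ (-N) because \<epsilon> \<le> 1.\<close>
    have "const_bound h (int 0)" using h unfolding null_const_iff by blast
    then obtain C' where C': "C' \<ge> 0" "\<forall>\<^sub>F \<epsilon> in at_right 0. cmod (h \<epsilon>) \<le> C' * \<epsilon> powi (int 0)"
      by (rule const_boundE)
    have "\<forall>\<^sub>F \<epsilon> in at_right 0. cmod (d \<epsilon>) \<le> (C' + C) * \<epsilon> powi (- int N)"
      using C(2) C'(2) eventually_at_right_0_1
    proof eventually_elim
      case (elim \<epsilon>)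
      have "1 \<le> \<epsilon> powi (- int N)"
        using elim(3) power_int_decreasing[of "- int N" 0 \<epsilon>] by simp
      then have "C' * 1 \<le> C' * \<epsilon> powi (- int N)" using C'(1) by (rule mult_left_mono)
      then have "cmod (h \<epsilon>) \<le> C' * \<epsilon> powi (- int N)" using elim(2) by simp
      then have "cmod (h \<epsilon>) + cmod (c \<epsilon>) \<le> C' * \<epsilon> powi (- int N) + C * \<epsilon> powi (- int N)"
        using elim(1) by (rule add_mono)
      then show ?case
        using norm_triangle_ineq[of "h \<epsilon>" "c \<epsilon>"] by (simp add: d distrib_right)
    qed
    then have "d \<in> carrier moderate_const"
      unfolding carrier_moderate_const_iff const_bound_def by blast
    moreover have "(\<lambda>\<epsilon>. d \<epsilon> - c \<epsilon>) \<in> null_const" using h by (simp add: d)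
    ultimately show ?thesis ..
  qed
  ultimately show ?thesis using c that by blast
qed

text \<open>By \<open>cls_smult_eq\<close> all cosets in the defining union coincide; c and f
  themselves show that the union is not empty.\<close>

lemma (in net_quotient) smult_FactModule:
  assumes f: "f \<in> E" and c: "c \<in> carrier moderate_const" "c \<in> a"
    and a: "\<forall>d\<in>a. d \<in> carrier moderate_const \<and> (\<lambda>\<epsilon>. d \<epsilon> - c \<epsilon>) \<in> null_const"
  shows "a \<odot>\<^bsub>FactModule (net_module E) N\<^esub> cls f = cls (\<lambda>\<epsilon> x. c \<epsilon> * f \<epsilon> x)"
proof -
  have "a \<odot>\<^bsub>FactModule (net_module E) N\<^esub> cls f
      = (\<Union>d\<in>a. \<Union>g\<in>cls f. cls (\<lambda>\<epsilon> x. d \<epsilon> * g \<epsilon> x))"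
    by (simp add: FactModule_def) (simp add: net_module_def)
  also have "\<dots> = (\<Union>d\<in>a. \<Union>g\<in>cls f. cls (\<lambda>\<epsilon> x. c \<epsilon> * f \<epsilon> x))"
    by (intro SUP_cong refl cls_smult_eq f c(1)) (use a in auto)
  also have "\<dots> = cls (\<lambda>\<epsilon> x. c \<epsilon> * f \<epsilon> x)"
    using c(2) self_mem_cls[of f] by auto
  finally show ?thesis .
qed

interpretation tau: net_quotient moderate_tau "null_tau :: 'a::euclidean_space net set"
  by unfold_locales
    (use null_tau_zero null_tau_subset_moderate null_tau_lincomb moderate_tau_lincomb null_const_smult_tau
     in auto)

interpretation S: net_quotient moderate_S "null_S :: 'a::euclidean_space net set"
  by unfold_locales
    (use null_S_zero null_S_subset_moderate null_S_lincomb moderate_S_lincomb null_const_smult_S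
     in auto)

section \<open>Differentiation under the integral sign\<close>

text \<open>With n the dimension, the shell j \<le> |y| < j + 1 carries a weight of at most (1 +
  j)^(-n-2) and lies in a ball of volume V (1 + j)^n, so the integral is dominated by the convergent
  sum of V / (1 + j)^2. Estimating by whole balls is the reason for n + 2 in the exponent.\<close>

lemma integrable_inverse_weight:
  "integrable lborel (\<lambda>y::'a::euclidean_space. inverse ((1 + norm y) ^ (DIM('a) + 2)))"
proof (rule integrableI_bounded)
  define n where "n = DIM('a)"
  define V where "V = unit_ball_vol (real n)"
  have V: "V \<ge> 0" by (simp add: V_def)
  have "ennreal (norm (inverse ((1 + norm y) ^ (n + 2))))
      \<le> (\<Sum>j. ennreal (inverse ((1 + real j) ^ (n + 2))) * indicator (ball 0 (1 + real j)) y)"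
    (is "_ \<le> (\<Sum>j. ?u j)") for y :: 'a
  proof -
    define j where "j = nat \<lfloor>norm y\<rfloor>"
    have j: "real j \<le> norm y" "norm y < 1 + real j"
      by (simp_all add: j_def) linarith
    have "inverse ((1 + norm y) ^ (n + 2)) \<le> inverse ((1 + real j) ^ (n + 2))"
      using j(1) by (intro le_imp_inverse_le power_mono) auto
    moreover have "norm (inverse ((1 + norm y) ^ (n + 2))) = inverse ((1 + norm y) ^ (n + 2))"
      by (simp only: real_norm_def) (intro abs_of_nonneg, simp)
    moreover have "indicator (ball 0 (1 + real j)) y = (1::ennreal)"
      using j(2) by (simp add: dist_norm)
    ultimately have "ennreal (norm (inverse ((1 + norm y) ^ (n + 2)))) \<le> ?u j"
      by (simp only: mult_1_right ennreal_leI)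
    also have "\<dots> = sum ?u {j}"
      by (simp only: sum.insert finite.emptyI empty_iff not_False_eq_True sum.empty add_0_right)
    also have "\<dots> \<le> (\<Sum>j. ?u j)"
      by (rule sum_le_suminf[OF summableI]) auto
    finally show ?thesis .
  qed
  then have "(\<integral>\<^sup>+ y. ennreal (norm (inverse ((1 + norm y) ^ (n + 2)))) \<partial>(lborel :: 'a measure))
      \<le> (\<integral>\<^sup>+ y. (\<Sum>j. ennreal (inverse ((1 + real j) ^ (n + 2))) * indicator (ball 0 (1 + real j)) y)
            \<partial>(lborel :: 'a measure))"
    by (rule nn_integral_mono)
  also have "\<dots> = (\<Sum>j. ennreal (inverse ((1 + real j) ^ (n + 2))) * emeasure lborel (ball (0::'a) (1 + real j)))"
    by (subst nn_integral_suminf)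
       (intro borel_measurable_times_ennreal borel_measurable_const borel_measurable_indicator,
        simp_all add: nn_integral_cmult_indicator)
  also have "\<dots> = (\<Sum>j. ennreal (V * inverse ((1 + real j) ^ 2)))"
  proof (rule suminf_cong)
    fix j :: nat
    have "inverse (r ^ (n + 2)) * (V * r ^ n) = V * inverse (r ^ 2)" if "r > 0" for r
      using that by (simp add: power_add power2_eq_square field_simps)
    from this[of "1 + real j"]
    have "inverse ((1 + real j) ^ (n + 2)) * (V * (1 + real j) ^ n) = V * inverse ((1 + real j) ^ 2)"
      by simp
    then show "ennreal (inverse ((1 + real j) ^ (n + 2))) * emeasure lborel (ball (0::'a) (1 + real j))
        = ennreal (V * inverse ((1 + real j) ^ 2))"
      using V by (simp add: emeasure_ball flip: ennreal_mult n_def V_def)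
  qed
  also have "\<dots> < \<infinity>"
  proof -
    have "summable (\<lambda>j. V * inverse ((1 + real j) ^ 2))"
      using summable_Suc_iff[of "\<lambda>j. inverse (real j ^ 2)"] inverse_power_summable[of 2, where 'a = real]
      by (intro summable_mult) (simp add: add.commute)
    then show ?thesis
      using V by (subst suminf_ennreal2) auto
  qed
  finally show "(\<integral>\<^sup>+ y. ennreal (norm (inverse ((1 + norm y) ^ (DIM('a) + 2)))) \<partial>(lborel :: 'a measure)) < \<infinity>"
    by (simp add: n_def)
qed measurable

text \<open>Domination is asked only near each point, because the kernels grow in x and admit no
  global dominating function.\<close>

lemma integral_continuous_parameter:
  fixes F :: "'a::euclidean_space \<Rightarrow> 'b::euclidean_space \<Rightarrow> complex"
  assumes meas: "\<And>x. F x \<in> borel_measurable lborel"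
    and cont: "\<And>y. continuous_on UNIV (\<lambda>x. F x y)"
    and dom: "\<And>x0. \<exists>w. integrable lborel w \<and> (\<forall>x y. dist x x0 \<le> 1 \<longrightarrow> norm (F x y) \<le> w y)"
  shows "continuous_on UNIV (\<lambda>x. LINT y|lborel. F x y)"
proof (rule continuous_on_sequentiallyI)
  fix u and a :: 'a assume u: "u \<longlonglongrightarrow> a"
  obtain w where w: "integrable lborel w" "\<And>x y. dist x a \<le> 1 \<Longrightarrow> norm (F x y) \<le> w y"
    using dom by blast
  obtain N where N: "\<And>n. n \<ge> N \<Longrightarrow> dist (u n) a < 1"
    using u unfolding lim_sequentially by (meson zero_less_one)
  have "(\<lambda>i. LINT y|lborel. F (u (i + N)) y) \<longlonglongrightarrow> (LINT y|lborel. F a y)"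
  proof (rule integral_dominated_convergence[OF meas meas w(1)])
    show "AE y in lborel. (\<lambda>i. F (u (i + N)) y) \<longlonglongrightarrow> F a y"
    proof (rule AE_I2)
      fix y
      have "(\<lambda>i. u (i + N)) \<longlonglongrightarrow> a" using u by (rule LIMSEQ_ignore_initial_segment)
      then show "(\<lambda>i. F (u (i + N)) y) \<longlonglongrightarrow> F a y"
        using cont[of y] continuous_on_tendsto_compose[of UNIV "\<lambda>x. F x y"] by auto
    qed
    show "AE y in lborel. norm (F (u (i + N)) y) \<le> w y" for i
      using N[of "i + N"] by (intro AE_I2 w(2)) auto
  qed
  then show "(\<lambda>n. LINT y|lborel. F (u n) y) \<longlonglongrightarrow> (LINT y|lborel. F a y)"
    by (rule LIMSEQ_offset)
qed

text \<open>Dominated convergence for the first-order remainder divided by t. It is at most 2 w: one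
  w for the increment, by the mean value bound, and one for the linear term.\<close>

lemma integral_has_vector_derivative_parameter:
  fixes F F' :: "real \<Rightarrow> 'b::euclidean_space \<Rightarrow> complex"
  assumes int: "\<And>t. integrable lborel (F t)" and meas: "F' 0 \<in> borel_measurable lborel"
    and deriv: "\<And>t y. \<bar>t\<bar> \<le> 1 \<Longrightarrow> ((\<lambda>t. F t y) has_vector_derivative F' t y) (at t)"
    and w: "integrable lborel w" "\<And>t y. \<bar>t\<bar> \<le> 1 \<Longrightarrow> norm (F' t y) \<le> w y"
  shows "((\<lambda>t. LINT y|lborel. F t y) has_vector_derivative (LINT y|lborel. F' 0 y)) (at 0)"
  unfolding has_vector_derivative_def has_derivative_iff_norm
proof (intro conjI bounded_linear_scaleR_left, subst tendsto_at_iff_sequentially, intro allI impI)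
  have int': "integrable lborel (F' 0)"
    by (rule Bochner_Integration.integrable_bound[OF w(1) meas])
       (intro AE_I2 order_trans[OF w(2)], simp_all)
  fix X :: "nat \<Rightarrow> real"
  assume X0: "\<forall>i. X i \<in> UNIV - {0}" and X: "X \<longlonglongrightarrow> 0"
  define Q where "Q t y = ((F t y - F 0 y) - t *\<^sub>R F' 0 y) /\<^sub>R t" for t y
  \<comment> \<open>Domination is available for parameters of modulus at most 1, so the sequence is
    cut at N and the limit is restored by \<open>LIMSEQ_offset\<close>.\<close>
  obtain N where N: "\<And>n. n \<ge> N \<Longrightarrow> \<bar>X n\<bar> < 1"
    using X unfolding lim_sequentially by (metis dist_0_norm dist_commute real_norm_def zero_less_one)
  have "(\<lambda>i. LINT y|lborel. Q (X (i + N)) y) \<longlonglongrightarrow> (LINT y|(lborel :: 'b measure). 0)"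
  proof (rule integral_dominated_convergence)
    show "integrable lborel (\<lambda>y. 2 * w y)" using w(1) by simp
    show "(\<lambda>y. Q (X (i + N)) y) \<in> borel_measurable lborel" for i
      unfolding Q_def using int int' by (auto intro!: borel_measurable_integrable)
    show "AE y in lborel. (\<lambda>i. Q (X (i + N)) y) \<longlonglongrightarrow> 0"
    proof (rule AE_I2)
      fix y
      have "((\<lambda>t. norm ((F t y - F 0 y) - (t - 0) *\<^sub>R F' 0 y) / norm (t - 0)) \<longlongrightarrow> 0) (at 0)"
        using deriv[of 0 y] unfolding has_vector_derivative_def has_derivative_iff_norm by simp
      then have "((\<lambda>t. norm (Q t y)) \<longlongrightarrow> 0) (at 0)"
        by (simp add: Q_def divide_inverse mult.commute)
      then have "(\<lambda>i. norm (Q (X i) y)) \<longlonglongrightarrow> 0"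
        using X0 X unfolding tendsto_at_iff_sequentially o_def by blast
      then have "(\<lambda>i. Q (X i) y) \<longlonglongrightarrow> 0" by (rule tendsto_norm_zero_cancel)
      then show "(\<lambda>i. Q (X (i + N)) y) \<longlonglongrightarrow> 0" by (rule LIMSEQ_ignore_initial_segment)
    qed
    show "AE y in lborel. norm (Q (X (i + N)) y) \<le> 2 * w y" for i
    proof (rule AE_I2)
      fix y
      define t where "t = X (i + N)"
      have t: "t \<noteq> 0" "\<bar>t\<bar> \<le> 1" using X0 N[of "i + N"] by (auto simp: t_def less_imp_le)
      have "norm (F t y - F 0 y) \<le> w y * \<bar>t\<bar>"
        by (rule mean_value_norm_bound[where u' = "\<lambda>s. F' s y"]) (use t deriv w(2) in auto)
      moreover have "norm (t *\<^sub>R F' 0 y) \<le> w y * \<bar>t\<bar>"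
        using mult_right_mono[OF w(2)[of 0 y], of "\<bar>t\<bar>"] by (simp add: mult.commute)
      ultimately have "norm ((F t y - F 0 y) - t *\<^sub>R F' 0 y) \<le> 2 * w y * \<bar>t\<bar>"
        using norm_triangle_ineq4[of "F t y - F 0 y" "t *\<^sub>R F' 0 y"] by linarith
      moreover have "norm (Q t y) = norm ((F t y - F 0 y) - t *\<^sub>R F' 0 y) / \<bar>t\<bar>"
        unfolding Q_def norm_scaleR by (simp add: divide_inverse mult.commute)
      ultimately have "norm (Q t y) \<le> 2 * w y"
        using t(1) by (simp add: pos_divide_le_eq)
      then show "norm (Q (X (i + N)) y) \<le> 2 * w y" by (simp only: t_def)
    qed
  qed simp
  then have "(\<lambda>i. LINT y|lborel. Q (X (i + N)) y) \<longlonglongrightarrow> 0" by simp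
  then have "(\<lambda>i. LINT y|lborel. Q (X i) y) \<longlonglongrightarrow> 0" by (rule LIMSEQ_offset)
  then have "(\<lambda>i. norm (LINT y|lborel. Q (X i) y)) \<longlonglongrightarrow> 0" by (rule tendsto_norm_zero)
  moreover have "norm (LINT y|lborel. Q t y) =
      norm ((LINT y|lborel. F t y) - (LINT y|lborel. F 0 y) - (t - 0) *\<^sub>R (LINT y|lborel. F' 0 y)) / norm (t - 0)"
    for t
    unfolding Q_def using int int' by (simp add: divide_inverse mult.commute)
  ultimately show "((\<lambda>t. norm ((LINT y|lborel. F t y) - (LINT y|lborel. F 0 y) - (t - 0) *\<^sub>R (LINT y|lborel. F' 0 y))
      / norm (t - 0)) \<circ> X) \<longlonglongrightarrow> 0"
    by (simp add: o_def)
qed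

section \<open>Kernel integrals and the bilinear estimate\<close>

lemma deriv_bound_neg_iff:
  "deriv_bound (- int q) l f A \<longleftrightarrow> (\<forall>bs x. set bs \<subseteq> Basis \<longrightarrow> length bs \<le> l \<longrightarrow>
     cmod (iter_partial bs f x) \<le> A * (1 + norm x) ^ q)"
proof -
  have "(1 + norm x) powi (- int q) * z \<le> A \<longleftrightarrow> z \<le> A * (1 + norm x) ^ q" for x :: 'a and z
  proof -
    have "(1 + norm x) ^ q > 0" by (simp add: add_pos_nonneg)
    then show ?thesis by (simp add: power_int_minus field_simps)
  qed
  then show ?thesis by (simp add: deriv_bound_def)
qed

lemma deriv_bound_neg_zeroD: "deriv_bound (- int q) l f A \<Longrightarrow> cmod (f x) \<le> A * (1 + norm x) ^ q"
  unfolding deriv_bound_neg_iff by (metis empty_subsetI iter_partial_Nil le0 list.set(1) list.size(3))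

text \<open>Submultiplicativity of the weight. It splits growth in (x, y) into separate factors and
  transfers decay from one centre to another.\<close>

lemma weight_add_le: "1 + norm (x + y) \<le> (1 + norm x) * (1 + norm y)"
proof -
  have "1 + norm (x + y) \<le> 1 + (norm x + norm y)" by (simp add: norm_triangle_ineq)
  also have "\<dots> \<le> (1 + norm x) * (1 + norm y)" by (simp add: algebra_simps)
  finally show ?thesis .
qed

lemma weight_Pair_le: "1 + norm (x, y) \<le> (1 + norm x) * (1 + norm y)"
  using weight_add_le[of "(x, 0)" "(0, y)"] by simp

text \<open>Differentiating the integral in direction b differentiates the kernel in direction (b,
  0), which is a basis vector of the product space.\<close>

definition inl_dirs :: "'a::euclidean_space list \<Rightarrow> ('a \<times> 'b::euclidean_space) list" where
  "inl_dirs bs = map (\<lambda>b. (b, 0)) bs"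

lemma set_inl_dirs: "set bs \<subseteq> Basis \<Longrightarrow> set (inl_dirs bs) \<subseteq> Basis"
  by (auto simp: inl_dirs_def Basis_prod_def)

lemma length_inl_dirs [simp]: "length (inl_dirs bs) = length bs"
  by (simp add: inl_dirs_def)

definition kernel_int :: "('a::euclidean_space \<times> 'b::euclidean_space \<Rightarrow> complex) \<Rightarrow> ('b \<Rightarrow> complex) \<Rightarrow> 'a \<Rightarrow> complex" where
  "kernel_int h \<phi> x = (LINT y|lborel. h (x, y) * \<phi> y)"

definition weight_integral :: "'b::euclidean_space itself \<Rightarrow> real" where
  "weight_integral _ = (LINT y|lborel. inverse ((1 + norm (y::'b)) ^ (DIM('b) + 2)))"

lemma weight_integral_nonneg: "weight_integral TYPE('b::euclidean_space) \<ge> 0"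
  by (simp add: weight_integral_def)

text \<open>Of the decay of \<phi>, q powers cancel the growth of the kernel in y, and
  \<open>DIM('b) + 2\<close> powers remain for integrability. A bound of derivative order 0 on
  \<phi> is enough, since x-derivatives fall on the kernel alone.\<close>

lemma kernel_integrand_bound:
  fixes h :: "'a::euclidean_space \<times> 'b::euclidean_space \<Rightarrow> complex"
  assumes h: "deriv_bound (- int q) l h A" and bs: "set bs \<subseteq> Basis" "length bs \<le> l"
    and \<phi>: "deriv_bound (int (q + DIM('b) + 2)) 0 \<phi> B"
  shows "cmod (iter_partial bs h (x, y) * \<phi> y)
    \<le> A * B * (1 + norm x) ^ q * inverse ((1 + norm y) ^ (DIM('b) + 2))"
proof -
  define d where "d = DIM('b) + 2"
  define Y where "Y = 1 + norm y"
  have Y: "Y > 0" by (simp add: Y_def add_pos_nonneg)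
  have A: "A \<ge> 0" using h by (rule deriv_bound_nonneg)
  have "cmod (iter_partial bs h (x, y)) \<le> A * (1 + norm (x, y)) ^ q"
    using h bs by (simp add: deriv_bound_neg_iff)
  also have "\<dots> \<le> A * ((1 + norm x) * Y) ^ q"
    unfolding Y_def by (intro mult_left_mono power_mono weight_Pair_le A) auto
  finally have 1: "cmod (iter_partial bs h (x, y)) \<le> A * (1 + norm x) ^ q * Y ^ q"
    by (simp add: power_mult_distrib mult.assoc)
  have "Y powi int (q + d) * cmod (\<phi> y) \<le> B"
    using deriv_boundD[OF \<phi>, of "[]" y] by (simp add: Y_def d_def add.assoc)
  then have "Y ^ (q + d) * cmod (\<phi> y) \<le> B"
    by (simp only: power_int_of_nat)
  then have 2: "cmod (\<phi> y) \<le> B * inverse (Y ^ q * Y ^ d)"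
    using Y by (simp add: power_add field_simps)
  have "cmod (iter_partial bs h (x, y) * \<phi> y) \<le> (A * (1 + norm x) ^ q * Y ^ q) * (B * inverse (Y ^ q * Y ^ d))"
    unfolding norm_mult using 1 2 A Y by (intro mult_mono) auto
  also have "\<dots> = A * B * (1 + norm x) ^ q * inverse (Y ^ d)"
    using Y by (simp add: field_simps)
  finally show ?thesis by (simp only: Y_def d_def)
qed

lemma kernel_integrand_measurable:
  fixes h :: "'a::euclidean_space \<times> 'b::euclidean_space \<Rightarrow> complex"
  assumes h: "h \<in> C_infty" and \<phi>: "\<phi> \<in> C_infty" and bs: "set bs \<subseteq> Basis"
  shows "(\<lambda>y. iter_partial bs h (x, y) * \<phi> y) \<in> borel_measurable lborel"
proof -
  have "continuous_on UNIV (\<lambda>y. iter_partial bs h (x, y) * \<phi> y)"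
    using C_infty_continuous_on[OF \<phi>, of "[]" UNIV]
    by (intro continuous_intros continuous_on_compose2[OF C_infty_continuous_on[OF h bs, of UNIV]]) auto
  then show ?thesis by (simp add: borel_measurable_continuous_onI)
qed

lemma integrable_kernel_integrand:
  fixes h :: "'a::euclidean_space \<times> 'b::euclidean_space \<Rightarrow> complex"
  assumes h: "h \<in> O_M" and \<phi>: "\<phi> \<in> schwartz" and bs: "set bs \<subseteq> Basis"
  shows "integrable lborel (\<lambda>y. iter_partial bs h (x, y) * \<phi> y)"
proof -
  obtain q A where A: "deriv_bound (- int q) (length bs) h A" using h unfolding O_M_iff by blast
  obtain B where B: "deriv_bound (int (q + DIM('b) + 2)) 0 \<phi> B" using \<phi> unfolding schwartz_iff by blast
  have AB: "A \<ge> 0" "B \<ge> 0" using A B by (auto intro: deriv_bound_nonneg)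
  have "norm (iter_partial bs h (x, y) * \<phi> y)
      \<le> norm (A * B * (1 + norm x) ^ q * inverse ((1 + norm y) ^ (DIM('b) + 2)))" for y
    using kernel_integrand_bound[OF A bs order_refl B, of x y] AB by (simp add: abs_mult)
  then show ?thesis
    by (intro Bochner_Integration.integrable_bound[OF integrable_mult_right[OF integrable_inverse_weight]]
        kernel_integrand_measurable AE_I2 bs)
      (use h \<phi> in \<open>auto simp: O_M_iff schwartz_iff\<close>)
qed

text \<open>The guess fed to \<open>C_inftyI\<close> differentiates under the integral. Its
  domination rests on the decay of \<phi>, which can be matched to the growth order of the kernel at
  each number of derivatives.\<close>

lemma
  fixes h :: "'a::euclidean_space \<times> 'b::euclidean_space \<Rightarrow> complex"
  assumes h: "h \<in> O_M" and \<phi>: "\<phi> \<in> schwartz"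
  shows kernel_int_C_infty: "kernel_int h \<phi> \<in> C_infty"
    and iter_partial_kernel_int: "set bs \<subseteq> Basis \<Longrightarrow>
      iter_partial bs (kernel_int h \<phi>) = (\<lambda>x. LINT y|lborel. iter_partial (inl_dirs bs) h (x, y) * \<phi> y)"
proof -
  define G where "G bs x = (LINT y|lborel. iter_partial (inl_dirs bs) h (x, y) * \<phi> y)" for bs x
  have hC: "h \<in> C_infty" and \<phi>C: "\<phi> \<in> C_infty" using h \<phi> by (auto simp: O_M_iff schwartz_iff)
  have dom: "\<exists>w. integrable lborel w \<and>
      (\<forall>x y. dist x x0 \<le> 1 \<longrightarrow> norm (iter_partial (inl_dirs bs) h (x, y) * \<phi> y) \<le> w y)"
    if bs: "set bs \<subseteq> Basis" for bs and x0 :: 'a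
  proof -
    obtain q A where A: "deriv_bound (- int q) (length bs) h A" using h unfolding O_M_iff by blast
    obtain B where B: "deriv_bound (int (q + DIM('b) + 2)) 0 \<phi> B" using \<phi> unfolding schwartz_iff by blast
    have AB: "A \<ge> 0" "B \<ge> 0" using A B by (auto intro: deriv_bound_nonneg)
    \<comment> \<open>On the unit ball around x0, \<open>1 + norm x\<close> is at most
      \<open>2 + norm x0\<close>.\<close>
    define w where "w y = A * B * (2 + norm x0) ^ q * inverse ((1 + norm y) ^ (DIM('b) + 2))" for y :: 'b
    have "norm (iter_partial (inl_dirs bs) h (x, y) * \<phi> y) \<le> w y" if "dist x x0 \<le> 1" for x y
    proof -
      have x: "norm x \<le> norm x0 + 1" using that norm_triangle_sub[of x x0] by (simp add: dist_norm)
      have "norm (iter_partial (inl_dirs bs) h (x, y) * \<phi> y)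
          \<le> A * B * (1 + norm x) ^ q * inverse ((1 + norm y) ^ (DIM('b) + 2))"
        using A B bs by (intro kernel_integrand_bound[of q "length bs"] set_inl_dirs) auto
      also have "\<dots> \<le> w y"
        unfolding w_def using x AB by (intro mult_right_mono mult_left_mono power_mono) auto
      finally show ?thesis .
    qed
    moreover have "integrable lborel w"
      unfolding w_def by (intro integrable_mult_right integrable_inverse_weight)
    ultimately show ?thesis by blast
  qed
  have cont: "continuous_on UNIV (G bs)" if "set bs \<subseteq> Basis" for bs
    unfolding G_def
  proof (rule integral_continuous_parameter)
    show "continuous_on UNIV (\<lambda>x. iter_partial (inl_dirs bs) h (x, y) * \<phi> y)" for y
      using that
      by (intro continuous_intros
          continuous_on_compose2[OF C_infty_continuous_on[OF hC set_inl_dirs, of _ UNIV]]) auto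
  qed (use dom that kernel_integrand_measurable[OF hC \<phi>C set_inl_dirs] in auto)
  have deriv: "((\<lambda>t. G bs (x + t *\<^sub>R b)) has_vector_derivative G (b # bs) x) (at 0)"
    if bs: "set bs \<subseteq> Basis" "b \<in> Basis" for bs b x
  proof -
    have sub: "set (inl_dirs bs :: ('a \<times> 'b) list) \<subseteq> Basis" "(b, 0::'b) \<in> Basis"
      "set (inl_dirs (b # bs) :: ('a \<times> 'b) list) \<subseteq> Basis" "set (b # bs) \<subseteq> Basis"
      using bs set_inl_dirs[of bs] by (auto simp: Basis_prod_def inl_dirs_def)
    obtain w where w: "integrable lborel w"
      "\<And>x' y. dist x' x \<le> 1 \<Longrightarrow> norm (iter_partial (inl_dirs (b # bs)) h (x', y) * \<phi> y) \<le> w y"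
      using dom[OF sub(4), of x] by blast
    have "((\<lambda>t. LINT y|lborel. iter_partial (inl_dirs bs) h (x + t *\<^sub>R b, y) * \<phi> y) has_vector_derivative
       (LINT y|lborel. iter_partial (inl_dirs (b # bs)) h (x + 0 *\<^sub>R b, y) * \<phi> y)) (at 0)"
    proof (rule integral_has_vector_derivative_parameter
        [where F' = "\<lambda>t y. iter_partial (inl_dirs (b # bs)) h (x + t *\<^sub>R b, y) * \<phi> y", OF _ _ _ w(1)])
      show "((\<lambda>t. iter_partial (inl_dirs bs) h (x + t *\<^sub>R b, y) * \<phi> y) has_vector_derivative
          iter_partial (inl_dirs (b # bs)) h (x + t *\<^sub>R b, y) * \<phi> y) (at t)" for t y
        using C_infty_has_vector_derivative[OF hC sub(1,2), of "(x, y)" t]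
        by (intro has_vector_derivative_mult_left) (simp add: inl_dirs_def)
      show "norm (iter_partial (inl_dirs (b # bs)) h (x + t *\<^sub>R b, y) * \<phi> y) \<le> w y" if "\<bar>t\<bar> \<le> 1" for t y
        using that bs by (intro w(2)) (simp add: dist_norm)
    qed (use integrable_kernel_integrand[OF h \<phi> sub(1)] kernel_integrand_measurable[OF hC \<phi>C sub(3)] in auto)
    then show ?thesis by (simp add: G_def)
  qed
  have G0: "G [] = kernel_int h \<phi>" by (simp add: G_def kernel_int_def inl_dirs_def fun_eq_iff)
  show "kernel_int h \<phi> \<in> C_infty" by (rule C_inftyI[OF G0 cont deriv])
  show "set bs \<subseteq> Basis \<Longrightarrow>
      iter_partial bs (kernel_int h \<phi>) = (\<lambda>x. LINT y|lborel. iter_partial (inl_dirs bs) h (x, y) * \<phi> y)"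
    using iter_partial_eqI[OF G0 cont deriv] by (simp add: G_def fun_eq_iff)
qed

text \<open>The growth order q and the derivative order l pass unchanged from kernel to integral,
  and B concerns a seminorm depending on q only. Hence the quantifier pattern of
  \<open>null_tau\<close> survives integration.\<close>

lemma deriv_bound_kernel_int:
  fixes h :: "'a::euclidean_space \<times> 'b::euclidean_space \<Rightarrow> complex"
  assumes h: "h \<in> O_M" "deriv_bound (- int q) l h A"
    and \<phi>: "\<phi> \<in> schwartz" "deriv_bound (int (q + DIM('b) + 2)) 0 \<phi> B"
  shows "deriv_bound (- int q) l (kernel_int h \<phi>) (A * B * weight_integral TYPE('b))"
  unfolding deriv_bound_neg_iff
proof (intro allI impI)
  fix bs and x :: 'a assume bs: "set bs \<subseteq> (Basis :: 'a set)" "length bs \<le> l"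
  have "cmod (iter_partial bs (kernel_int h \<phi>) x)
      \<le> (LINT y|lborel. A * B * (1 + norm x) ^ q * inverse ((1 + norm (y::'b)) ^ (DIM('b) + 2)))"
    unfolding iter_partial_kernel_int[OF h(1) \<phi>(1) bs(1)]
  proof (rule order_trans[OF integral_norm_bound integral_mono])
    show "integrable lborel (\<lambda>y. norm (iter_partial (inl_dirs bs) h (x, y) * \<phi> y))"
      using bs by (intro integrable_norm integrable_kernel_integrand h \<phi> set_inl_dirs)
    show "integrable lborel (\<lambda>y::'b. A * B * (1 + norm x) ^ q * inverse ((1 + norm y) ^ (DIM('b) + 2)))"
      by (intro integrable_mult_right integrable_inverse_weight)
    show "norm (iter_partial (inl_dirs bs) h (x, y) * \<phi> y)
        \<le> A * B * (1 + norm x) ^ q * inverse ((1 + norm y) ^ (DIM('b) + 2))" for y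
      using bs by (intro kernel_integrand_bound[OF h(2) _ _ \<phi>(2)] set_inl_dirs) auto
  qed
  also have "\<dots> = A * B * weight_integral TYPE('b) * (1 + norm x) ^ q"
    by (simp only: integral_mult_right_zero weight_integral_def mult_ac)
  finally show "cmod (iter_partial bs (kernel_int h \<phi>) x) \<le> A * B * weight_integral TYPE('b) * (1 + norm x) ^ q" .
qed

lemma kernel_int_O_M:
  fixes h :: "'a::euclidean_space \<times> 'b::euclidean_space \<Rightarrow> complex"
  assumes h: "h \<in> O_M" and \<phi>: "\<phi> \<in> schwartz"
  shows "kernel_int h \<phi> \<in> O_M"
  unfolding O_M_iff
proof (intro conjI allI kernel_int_C_infty assms)
  fix l
  obtain q A where "deriv_bound (- int q) l h A" using h unfolding O_M_iff by blast
  moreover obtain B where "deriv_bound (int (q + DIM('b) + 2)) 0 \<phi> B" using \<phi> unfolding schwartz_iff by blast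
  ultimately show "\<exists>q C. deriv_bound (- int q) l (kernel_int h \<phi>) C"
    using deriv_bound_kernel_int[OF h _ \<phi>] by blast
qed

text \<open>Since orders add, the three cases below are instances: a null factor is taken at an
  order that exceeds p by the loss of the moderate factor.\<close>

lemma net_bound_kernel_int:
  fixes h :: "('a::euclidean_space \<times> 'b::euclidean_space) net"
  assumes h: "\<And>\<epsilon>. \<epsilon> \<in> {0<..1} \<Longrightarrow> h \<epsilon> \<in> O_M" "net_bound (- int q) l h i"
    and \<phi>: "\<And>\<epsilon>. \<epsilon> \<in> {0<..1} \<Longrightarrow> \<phi> \<epsilon> \<in> schwartz" "net_bound (int (q + DIM('b) + 2)) 0 \<phi> j"
  shows "net_bound (- int q) l (\<lambda>\<epsilon>. kernel_int (h \<epsilon>) (\<phi> \<epsilon>)) (i + j)"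
proof -
  obtain A where A: "\<forall>\<^sub>F \<epsilon> in at_right 0. deriv_bound (- int q) l (h \<epsilon>) (A * \<epsilon> powi i)"
    using h(2) by (rule net_boundE)
  obtain B where B: "\<forall>\<^sub>F \<epsilon> in at_right 0. deriv_bound (int (q + DIM('b) + 2)) 0 (\<phi> \<epsilon>) (B * \<epsilon> powi j)"
    using \<phi>(2) by (rule net_boundE)
  have "\<forall>\<^sub>F \<epsilon> in at_right 0. deriv_bound (- int q) l (kernel_int (h \<epsilon>) (\<phi> \<epsilon>))
      (A * B * weight_integral TYPE('b) * \<epsilon> powi (i + j))"
    using A B eventually_at_right_0_1
  proof eventually_elim
    case (elim \<epsilon>)
    have "A * B * weight_integral TYPE('b) * \<epsilon> powi (i + j)
        = (A * \<epsilon> powi i) * (B * \<epsilon> powi j) * weight_integral TYPE('b)"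
      using elim(3) by (simp add: power_int_add)
    then show ?case
      using deriv_bound_kernel_int[OF h(1)[OF elim(3)] elim(1) \<phi>(1)[OF elim(3)] elim(2)] by (simp only:)
  qed
  then show ?thesis by (auto simp: net_bound_def)
qed

lemma kernel_int_moderate:
  fixes h :: "('a::euclidean_space \<times> 'b::euclidean_space) net"
  assumes h: "h \<in> moderate_tau" and \<phi>: "\<phi> \<in> moderate_S"
  shows "(\<lambda>\<epsilon>. kernel_int (h \<epsilon>) (\<phi> \<epsilon>)) \<in> moderate_tau"
  unfolding moderate_tau_iff
proof (intro conjI allI ballI)
  fix l
  obtain q N where 1: "net_bound (- int q) l h (- int N)" using h unfolding moderate_tau_iff by blast
  obtain M where 2: "net_bound (int (q + DIM('b) + 2)) 0 \<phi> (- int M)" using \<phi> unfolding moderate_S_iff by blast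
  have "net_bound (- int q) l (\<lambda>\<epsilon>. kernel_int (h \<epsilon>) (\<phi> \<epsilon>)) (- int N + - int M)"
    by (rule net_bound_kernel_int[OF _ 1 _ 2]) (use h \<phi> in \<open>auto simp: moderate_tau_iff moderate_S_iff\<close>)
  then have "net_bound (- int q) l (\<lambda>\<epsilon>. kernel_int (h \<epsilon>) (\<phi> \<epsilon>)) (- int (N + M))"
    by (rule net_bound_mono) auto
  then show "\<exists>q N. net_bound (- int q) l (\<lambda>\<epsilon>. kernel_int (h \<epsilon>) (\<phi> \<epsilon>)) (- int N)" by blast
qed (use h \<phi> in \<open>auto simp: moderate_tau_iff moderate_S_iff intro: kernel_int_O_M\<close>)

lemma kernel_int_null_left:
  fixes h :: "('a::euclidean_space \<times> 'b::euclidean_space) net"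
  assumes h: "h \<in> null_tau" and \<phi>: "\<phi> \<in> moderate_S"
  shows "(\<lambda>\<epsilon>. kernel_int (h \<epsilon>) (\<phi> \<epsilon>)) \<in> null_tau"
  unfolding null_tau_iff
proof (intro conjI allI ballI)
  fix l
  obtain q where 1: "\<And>p. net_bound (- int q) l h (int p)" using h unfolding null_tau_iff by blast
  obtain M where 2: "net_bound (int (q + DIM('b) + 2)) 0 \<phi> (- int M)" using \<phi> unfolding moderate_S_iff by blast
  have "net_bound (- int q) l (\<lambda>\<epsilon>. kernel_int (h \<epsilon>) (\<phi> \<epsilon>)) (int p)" for p
  proof -
    have "net_bound (- int q) l (\<lambda>\<epsilon>. kernel_int (h \<epsilon>) (\<phi> \<epsilon>)) (int (p + M) + - int M)"
      by (rule net_bound_kernel_int[OF _ 1 _ 2]) (use h \<phi> in \<open>auto simp: null_tau_iff moderate_S_iff\<close>)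
    then show ?thesis by simp
  qed
  then show "\<exists>q. \<forall>p. net_bound (- int q) l (\<lambda>\<epsilon>. kernel_int (h \<epsilon>) (\<phi> \<epsilon>)) (int p)" by blast
qed (use h \<phi> in \<open>auto simp: null_tau_iff moderate_S_iff intro: kernel_int_O_M\<close>)

lemma kernel_int_null_right:
  fixes h :: "('a::euclidean_space \<times> 'b::euclidean_space) net"
  assumes h: "h \<in> moderate_tau" and \<phi>: "\<phi> \<in> null_S"
  shows "(\<lambda>\<epsilon>. kernel_int (h \<epsilon>) (\<phi> \<epsilon>)) \<in> null_tau"
  unfolding null_tau_iff
proof (intro conjI allI ballI)
  fix l
  obtain q N where 1: "net_bound (- int q) l h (- int N)" using h unfolding moderate_tau_iff by blast
  have 2: "\<And>p. net_bound (int (q + DIM('b) + 2)) 0 \<phi> (int p)" using \<phi> unfolding null_S_iff by blast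
  have "net_bound (- int q) l (\<lambda>\<epsilon>. kernel_int (h \<epsilon>) (\<phi> \<epsilon>)) (int p)" for p
  proof -
    have "net_bound (- int q) l (\<lambda>\<epsilon>. kernel_int (h \<epsilon>) (\<phi> \<epsilon>)) (- int N + int (N + p))"
      by (rule net_bound_kernel_int[OF _ 1 _ 2]) (use h \<phi> in \<open>auto simp: moderate_tau_iff null_S_iff\<close>)
    then show ?thesis by simp
  qed
  then show "\<exists>q. \<forall>p. net_bound (- int q) l (\<lambda>\<epsilon>. kernel_int (h \<epsilon>) (\<phi> \<epsilon>)) (int p)" by blast
qed (use h \<phi> in \<open>auto simp: moderate_tau_iff null_S_iff intro: kernel_int_O_M\<close>)

section \<open>Interpolation of derivatives\<close>

lemma weight_line_le:
  fixes x v :: "'a::real_normed_vector"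
  assumes "norm v \<le> 1"
  shows "1 + norm (x + v) \<le> 2 * (1 + norm x)"
  using norm_triangle_ineq[of x v] assms norm_ge_zero[of x] unfolding distrib_left by linarith

text \<open>A Landau-Kolmogorov type inequality along a segment of length t: \<open>t * u' 0\<close>
  is an increment of u, of size 2 A, up to a remainder of size B t^2. As t \<le> 1, weights along
  the segment are comparable to the one at x, up to the factor \<open>2 ^ q\<close>.\<close>

lemma deriv_bound_interpolate:
  fixes f :: "'a::euclidean_space \<Rightarrow> complex"
  assumes f: "f \<in> C_infty" and A: "deriv_bound (- int q) l f A"
    and B: "deriv_bound (- int q) (Suc (Suc l)) f B" and t: "0 < t" "t \<le> 1"
  shows "deriv_bound (- int q) (Suc l) f (2 ^ q * (t * B + 2 * A / t))"
  unfolding deriv_bound_neg_iff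
proof (intro allI impI)
  fix bs :: "'a list" and x :: 'a
  assume bs: "set bs \<subseteq> Basis" "length bs \<le> Suc l"
  have AB: "A \<ge> 0" "B \<ge> 0" using A B by (auto intro: deriv_bound_nonneg)
  define w where "w = (1 + norm x) ^ q"
  have w: "w \<ge> 0" by (simp add: w_def)
  show "cmod (iter_partial bs f x) \<le> 2 ^ q * (t * B + 2 * A / t) * (1 + norm x) ^ q"
  proof (cases "length bs = Suc l")
    case False
    then have "cmod (iter_partial bs f x) \<le> A * w"
      using A bs by (simp add: deriv_bound_neg_iff w_def)
    \<comment> \<open>Derivatives of order at most l already satisfy the bound A; it only has to be
      compared with the target, using t \<le> 1.\<close>
    also have "\<dots> \<le> (2 ^ q * (t * B + 2 * A / t)) * w"
    proof (intro mult_right_mono w)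
      have "A \<le> A / t" using t AB mult_left_le[of t A] by (simp add: pos_le_divide_eq)
      also have "\<dots> \<le> 2 * A / t" using t AB by (simp add: divide_right_mono)
      also have "\<dots> \<le> t * B + 2 * A / t" using t AB by simp
      also have "\<dots> \<le> 2 ^ q * (t * B + 2 * A / t)"
        using t AB mult_right_mono[of 1 "2 ^ q" "t * B + 2 * A / t"] by simp
      finally show "A \<le> 2 ^ q * (t * B + 2 * A / t)" .
    qed
    finally show ?thesis by (simp add: w_def)
  next
    case True
    then obtain b cs where bs_eq: "bs = b # cs" and cs: "length cs = l" by (cases bs) auto
    have sub: "set cs \<subseteq> Basis" "b \<in> Basis" using bs(1) by (auto simp: bs_eq)
    define u u' u'' where "u s = iter_partial cs f (x + s *\<^sub>R b)"
      and "u' s = iter_partial (b # cs) f (x + s *\<^sub>R b)"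
      and "u'' s = iter_partial (b # b # cs) f (x + s *\<^sub>R b)" for s
    have deriv: "(u has_vector_derivative u' s) (at s)" "(u' has_vector_derivative u'' s) (at s)" for s
      unfolding u_def u'_def u''_def using sub by (auto intro!: C_infty_has_vector_derivative f)
    have weight: "(1 + norm (x + s *\<^sub>R b)) ^ q \<le> 2 ^ q * w" if "\<bar>s\<bar> \<le> 1" for s
      unfolding w_def power_mult_distrib[symmetric]
      by (intro power_mono weight_line_le) (use that sub in auto)
    have u: "cmod (u s) \<le> A * (2 ^ q * w)" if "\<bar>s\<bar> \<le> 1" for s
    proof -
      have "cmod (u s) \<le> A * (1 + norm (x + s *\<^sub>R b)) ^ q"
        using A sub cs by (simp add: deriv_bound_neg_iff u_def)
      also have "\<dots> \<le> A * (2 ^ q * w)" using weight[OF that] AB by (intro mult_left_mono)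
      finally show ?thesis .
    qed
    have u'': "cmod (u'' s) \<le> B * (2 ^ q * w)" if "\<bar>s\<bar> \<le> 1" for s
    proof -
      have "cmod (u'' s) \<le> B * (1 + norm (x + s *\<^sub>R b)) ^ q"
        using B sub cs by (simp add: deriv_bound_neg_iff u''_def)
      also have "\<dots> \<le> B * (2 ^ q * w)" using weight[OF that] AB by (intro mult_left_mono)
      finally show ?thesis .
    qed
    have u': "cmod (u' s - u' 0) \<le> B * (2 ^ q * w) * t" if "\<bar>s\<bar> \<le> t" for s
    proof -
      have "cmod (u' s - u' 0) \<le> B * (2 ^ q * w) * \<bar>s\<bar>"
        using that t by (intro mean_value_norm_bound[OF deriv(2) u'']) auto
      also have "\<dots> \<le> B * (2 ^ q * w) * t" using that AB w by (intro mult_left_mono) auto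
      finally show ?thesis .
    qed
    \<comment> \<open>Taylor remainder: subtracting the linear part leaves a function whose
      derivative \<open>u' s - u' 0\<close> is of size t, so its increment over a step t is of size
      t^2.\<close>
    have "cmod ((u t - t *\<^sub>R u' 0) - (u 0 - 0 *\<^sub>R u' 0)) \<le> B * (2 ^ q * w) * t * \<bar>t\<bar>"
    proof (rule mean_value_norm_bound[where u' = "\<lambda>s. u' s - u' 0"])
      show "((\<lambda>s. u s - s *\<^sub>R u' 0) has_vector_derivative u' s - u' 0) (at s)" for s
        by (auto intro!: derivative_eq_intros deriv)
      show "cmod (u' s - u' 0) \<le> B * (2 ^ q * w) * t" if "\<bar>s\<bar> \<le> \<bar>t\<bar>" for s
        using that t by (intro u') auto
    qed
    moreover have "cmod (t *\<^sub>R u' 0)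
        \<le> cmod ((u t - t *\<^sub>R u' 0) - (u 0 - 0 *\<^sub>R u' 0)) + (cmod (u t) + cmod (u 0))"
    proof -
      have "t *\<^sub>R u' 0 = (u t - u 0) - ((u t - t *\<^sub>R u' 0) - (u 0 - 0 *\<^sub>R u' 0))" by simp
      then have "cmod (t *\<^sub>R u' 0)
          \<le> cmod (u t - u 0) + cmod ((u t - t *\<^sub>R u' 0) - (u 0 - 0 *\<^sub>R u' 0))"
        by (metis norm_triangle_ineq4)
      with norm_triangle_ineq4[of "u t" "u 0"] show ?thesis by linarith
    qed
    moreover have "cmod (u t) + cmod (u 0) \<le> 2 * (A * (2 ^ q * w))"
      using u[of t] u[of 0] t by simp
    ultimately have "t * cmod (u' 0) \<le> B * (2 ^ q * w) * t * t + 2 * (A * (2 ^ q * w))"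
      using t by simp
    also have "\<dots> = t * (2 ^ q * (t * B + 2 * A / t) * w)"
      using t by (simp add: field_simps)
    finally have "cmod (u' 0) \<le> 2 ^ q * (t * B + 2 * A / t) * w"
      using t(1) by (rule mult_left_le_imp_le)
    then show ?thesis by (simp add: u'_def bs_eq w_def)
  qed
qed

text \<open>The step \<open>t = \<epsilon> ^ (p + N)\<close> turns a negligible bound of order \<open>2 * p + N\<close> on the function and
  the bound of order \<open>- N\<close> on the second derivatives into a bound of order \<open>p\<close> on the first ones.\<close>

lemma null_tauI_order_zero:
  assumes f: "f \<in> moderate_tau" and zero: "\<And>p. net_bound (- int q0) 0 f (int p)"
  shows "f \<in> null_tau"
proof -
  have C: "f \<epsilon> \<in> C_infty" if "\<epsilon> \<in> {0<..1}" for \<epsilon>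
    using f that unfolding moderate_tau_iff O_M_iff by blast
  have "\<exists>q. \<forall>p. net_bound (- int q) l f (int p)" for l
  proof (induction l)
    case 0
    then show ?case using zero by blast
  next
    case (Suc l)
    then obtain q1 where q1: "\<And>p. net_bound (- int q1) l f (int p)" by blast
    obtain q2 N where q2: "net_bound (- int q2) (Suc (Suc l)) f (- int N)"
      using f unfolding moderate_tau_iff by blast
    \<comment> \<open>Both \<open>q1\<close> and \<open>q2\<close> are known before p is chosen, so
      the growth order stays independent of p through the induction.\<close>
    define q where "q = max q1 q2"
    have "net_bound (- int q) (Suc l) f (int p)" for p
    proof -
      have "net_bound (- int q) l f (int (2 * p + N))"
        by (rule net_bound_mono[OF q1[of "2 * p + N"]]) (auto simp: q_def)
      then obtain A where A: "\<forall>\<^sub>F \<epsilon> in at_right 0. deriv_bound (- int q) l (f \<epsilon>) (A * \<epsilon> powi int (2 * p + N))"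
        by (rule net_boundE)
      have "net_bound (- int q) (Suc (Suc l)) f (- int N)"
        by (rule net_bound_mono[OF q2]) (auto simp: q_def)
      then obtain B where B: "\<forall>\<^sub>F \<epsilon> in at_right 0. deriv_bound (- int q) (Suc (Suc l)) (f \<epsilon>) (B * \<epsilon> powi - int N)"
        by (rule net_boundE)
      have "\<forall>\<^sub>F \<epsilon> in at_right 0. deriv_bound (- int q) (Suc l) (f \<epsilon>) (2 ^ q * (B + 2 * A) * \<epsilon> powi int p)"
        using A B eventually_at_right_0_1
      proof eventually_elim
        case (elim \<epsilon>)
        then have \<epsilon>: "0 < \<epsilon>" "\<epsilon> \<le> 1" by auto
        have "deriv_bound (- int q) (Suc l) (f \<epsilon>)
            (2 ^ q * (\<epsilon> ^ (p + N) * (B * \<epsilon> powi - int N) + 2 * (A * \<epsilon> powi int (2 * p + N)) / \<epsilon> ^ (p + N)))"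
          using \<epsilon> by (intro deriv_bound_interpolate[OF C[OF elim(3)] elim(1,2)] power_le_one) auto
        moreover have "\<epsilon> ^ (p + N) * (B * \<epsilon> powi - int N) = B * \<epsilon> ^ p"
          using \<epsilon> by (simp add: power_int_minus power_add)
        moreover have "2 * (A * \<epsilon> powi int (2 * p + N)) / \<epsilon> ^ (p + N) = 2 * A * \<epsilon> ^ p"
        proof -
          have "\<epsilon> powi int (2 * p + N) = \<epsilon> ^ p * \<epsilon> ^ (p + N)"
            unfolding power_int_of_nat power_add[symmetric] by (simp add: mult_2 add.assoc)
          then show ?thesis using \<epsilon> by simp
        qed
        ultimately have "deriv_bound (- int q) (Suc l) (f \<epsilon>) (2 ^ q * (B * \<epsilon> ^ p + 2 * A * \<epsilon> ^ p))"
          by (simp only:)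
        moreover have "2 ^ q * (B * \<epsilon> ^ p + 2 * A * \<epsilon> ^ p) = 2 ^ q * (B + 2 * A) * \<epsilon> powi int p"
          by (simp add: algebra_simps)
        ultimately show ?case by (simp only:)
      qed
      then show ?thesis by (auto simp: net_bound_def)
    qed
    then show ?case by blast
  qed
  then show ?thesis using f unfolding null_tau_iff moderate_tau_iff by blast
qed

section \<open>Gaussian test functions\<close>

text \<open>Closure of polynomials under directional derivatives, so that derivatives of the
  Gaussian keep the form polynomial times Gaussian.\<close>

lemma real_polynomial_function_directional_deriv:
  assumes "real_polynomial_function p"
  shows "\<exists>d. real_polynomial_function d \<and> (\<forall>x. ((\<lambda>t. p (x + t *\<^sub>R b)) has_real_derivative d x) (at 0))"
  using assms
proof induction
  case (linear f)
  then have "f (x + t *\<^sub>R b) = f x + t * f b" for x t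
    by (simp add: bounded_linear.linear linear_add linear_scale)
  then show ?case
    by (intro exI[of _ "\<lambda>_. f b"]) (auto intro!: derivative_eq_intros real_polynomial_function.intros(2))
next
  case (const c)
  then show ?case by (intro exI[of _ "\<lambda>_. 0"]) auto
next
  case (add f g)
  then obtain d e where "real_polynomial_function d" "real_polynomial_function e"
    "\<And>x. ((\<lambda>t. f (x + t *\<^sub>R b)) has_real_derivative d x) (at 0)"
    "\<And>x. ((\<lambda>t. g (x + t *\<^sub>R b)) has_real_derivative e x) (at 0)" by blast
  then show ?case
    by (intro exI[of _ "\<lambda>x. d x + e x"]) (auto intro!: derivative_eq_intros)
next
  case (mult f g)
  then obtain d e where de: "real_polynomial_function d" "real_polynomial_function e"
    "\<And>x. ((\<lambda>t. f (x + t *\<^sub>R b)) has_real_derivative d x) (at 0)"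
    "\<And>x. ((\<lambda>t. g (x + t *\<^sub>R b)) has_real_derivative e x) (at 0)" by blast
  show ?case
  proof (intro exI[of _ "\<lambda>x. d x * g x + e x * f x"] conjI allI)
    show "real_polynomial_function (\<lambda>x. d x * g x + e x * f x)"
      using de(1,2) mult.hyps by (intro real_polynomial_function.intros(3) real_polynomial_function.intros(4))
    show "((\<lambda>t. f (x + t *\<^sub>R b) * g (x + t *\<^sub>R b)) has_real_derivative d x * g x + e x * f x) (at 0)" for x
      using DERIV_mult[OF de(3)[of x] de(4)[of x]] by simp
  qed
qed

lemma real_polynomial_function_growth:
  assumes "real_polynomial_function p"
  shows "\<exists>C k. C \<ge> 0 \<and> (\<forall>x. \<bar>p x\<bar> \<le> C * (1 + norm x) ^ k)"
  using assms
proof induction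
  case (linear f)
  then obtain K where "K > 0" "\<And>x. norm (f x) \<le> norm x * K" by (meson bounded_linear.pos_bounded)
  moreover from this(1) have "norm x * K \<le> K * (1 + norm x) ^ 1" for x :: 'a by (simp add: algebra_simps)
  ultimately show ?case
    by (intro exI[of _ K] exI[of _ 1]) (metis less_imp_le order_trans real_norm_def)
next
  case (const c)
  then show ?case by (intro exI[of _ "\<bar>c\<bar>"] exI[of _ 0]) auto
next
  case (add f g)
  then obtain C k D m where *: "C \<ge> 0" "D \<ge> 0" "\<And>x. \<bar>f x\<bar> \<le> C * (1 + norm x) ^ k" "\<And>x. \<bar>g x\<bar> \<le> D * (1 + norm x) ^ m"
    by blast
  have "\<bar>f x + g x\<bar> \<le> (C + D) * (1 + norm x) ^ (k + m)" for x
  proof -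
    have "\<bar>f x + g x\<bar> \<le> C * (1 + norm x) ^ k + D * (1 + norm x) ^ m"
      using *(3,4)[of x] by linarith
    also have "\<dots> \<le> C * (1 + norm x) ^ (k + m) + D * (1 + norm x) ^ (k + m)"
      using *(1,2) by (intro add_mono mult_left_mono power_increasing) auto
    finally show ?thesis by (simp add: algebra_simps)
  qed
  then show ?case using *(1,2) by (intro exI[of _ "C + D"] exI[of _ "k + m"]) auto
next
  case (mult f g)
  then obtain C k D m where *: "C \<ge> 0" "D \<ge> 0" "\<And>x. \<bar>f x\<bar> \<le> C * (1 + norm x) ^ k" "\<And>x. \<bar>g x\<bar> \<le> D * (1 + norm x) ^ m"
    by blast
  have "\<bar>f x * g x\<bar> \<le> (C * D) * (1 + norm x) ^ (k + m)" for x
    using mult_mono[OF *(3)[of x] *(4)[of x]] *(1,2) by (simp add: abs_mult power_add mult_ac)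
  then show ?case using *(1,2) by (intro exI[of _ "C * D"] exI[of _ "k + m"]) auto
qed

definition gauss :: "'a::euclidean_space \<Rightarrow> complex" where
  "gauss x = of_real (exp (- (x \<bullet> x)))"

lemma real_polynomial_function_inner: "real_polynomial_function (\<lambda>x::'a::euclidean_space. x \<bullet> b)"
  by (rule real_polynomial_function.intros(1)) (rule bounded_linear_inner_left)

lemma polynomial_gauss_deriv:
  assumes "real_polynomial_function p"
  shows "\<exists>d. real_polynomial_function d \<and>
    (\<forall>x::'a::euclidean_space. ((\<lambda>t. of_real (p (x + t *\<^sub>R b)) * gauss (x + t *\<^sub>R b)) has_vector_derivative
       of_real (d x) * gauss x) (at 0))"
proof -
  obtain d where d: "real_polynomial_function d"
    "\<And>x. ((\<lambda>t. p (x + t *\<^sub>R b)) has_real_derivative d x) (at 0)"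
    using real_polynomial_function_directional_deriv[OF assms] by blast
  \<comment> \<open>Product rule: the Gaussian contributes the factor
    \<open>- 2 * (x \<bullet> b)\<close>.\<close>
  define e where "e x = d x + p x * (- 2 * (x \<bullet> b))" for x
  have "real_polynomial_function e"
    unfolding e_def by (intro real_polynomial_function.intros(3) real_polynomial_function.intros(4) d assms
        real_polynomial_function.intros(2) real_polynomial_function_inner)
  moreover have "((\<lambda>t. of_real (p (x + t *\<^sub>R b)) * gauss (x + t *\<^sub>R b)) has_vector_derivative
       of_real (e x) * gauss x) (at 0)" for x
  proof -
    have "((\<lambda>t. exp (- ((x + t *\<^sub>R b) \<bullet> (x + t *\<^sub>R b)))) has_real_derivative
        exp (- (x \<bullet> x)) * (- 2 * (x \<bullet> b))) (at 0)"
      by (auto intro!: derivative_eq_intros simp: inner_commute algebra_simps)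
    from DERIV_mult[OF d(2)[of x] this]
    have "((\<lambda>t. p (x + t *\<^sub>R b) * exp (- ((x + t *\<^sub>R b) \<bullet> (x + t *\<^sub>R b)))) has_real_derivative
        e x * exp (- (x \<bullet> x))) (at 0)"
      by (simp add: e_def algebra_simps)
    then have "((\<lambda>t. of_real (p (x + t *\<^sub>R b) * exp (- ((x + t *\<^sub>R b) \<bullet> (x + t *\<^sub>R b)))) :: complex)
        has_vector_derivative of_real (e x * exp (- (x \<bullet> x)))) (at 0)"
      by (intro has_vector_derivative_of_real) (simp add: has_real_derivative_iff_has_vector_derivative)
    then show ?thesis by (simp add: gauss_def)
  qed
  ultimately show ?thesis by blast
qed

lemma iter_partial_gauss:
  "\<exists>p. real_polynomial_function p \<and> iter_partial bs gauss = (\<lambda>x. of_real (p x) * gauss x)"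
proof (induction bs)
  case Nil
  show ?case by (intro exI[of _ "\<lambda>_. 1"]) auto
next
  case (Cons b bs)
  then obtain p where p: "real_polynomial_function p" "iter_partial bs gauss = (\<lambda>x. of_real (p x) * gauss x)"
    by blast
  obtain d where "real_polynomial_function d"
    "\<And>x. ((\<lambda>t. of_real (p (x + t *\<^sub>R b)) * gauss (x + t *\<^sub>R b)) has_vector_derivative
       of_real (d x) * gauss x) (at 0)"
    using polynomial_gauss_deriv[OF p(1)] by blast
  then show ?case
    by (intro exI[of _ d]) (auto simp: iter_partial_Cons partial_deriv_def p(2) fun_eq_iff vector_derivative_at)
qed

lemma gauss_C_infty: "gauss \<in> C_infty"
proof (rule C_inftyI[where G = "\<lambda>bs. iter_partial bs gauss"])
  fix bs :: "'a list"
  obtain p where p: "real_polynomial_function p" "iter_partial bs gauss = (\<lambda>x. of_real (p x) * gauss x)"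
    using iter_partial_gauss by blast
  show "continuous_on UNIV (iter_partial bs gauss)"
    unfolding p(2) gauss_def
    using continuous_real_polymonial_function[OF p(1)]
    by (intro continuous_intros continuous_at_imp_continuous_on) auto
  fix b x
  obtain d where "((\<lambda>t. of_real (p (x + t *\<^sub>R b)) * gauss (x + t *\<^sub>R b)) has_vector_derivative
       of_real (d x) * gauss x) (at 0)"
    using polynomial_gauss_deriv[OF p(1)] by blast
  then show "((\<lambda>t. iter_partial bs gauss (x + t *\<^sub>R b)) has_vector_derivative iter_partial (b # bs) gauss x) (at 0)"
    by (simp add: iter_partial_Cons partial_deriv_def p(2) vector_derivative_at)
qed simp

text \<open>With r = |x|, 1 + r \<le> exp r reduces the claim to k r - r^2 \<le> k^2, which is clear
  separately for r \<le> k and r > k.\<close>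

lemma power_mult_gauss_bounded: "(1 + norm x) ^ k * cmod (gauss x) \<le> exp (real k ^ 2)"
proof -
  define r where "r = norm x"
  have r: "r \<ge> 0" by (simp add: r_def)
  have "(1 + norm x) ^ k * cmod (gauss x) = (1 + r) ^ k * exp (- (r * r))"
    by (simp add: gauss_def r_def dot_square_norm power2_eq_square)
  also have "\<dots> \<le> exp r ^ k * exp (- (r * r))"
    using r by (intro mult_right_mono power_mono) auto
  also have "\<dots> = exp (real k * r - r * r)"
    by (simp add: exp_of_nat_mult[symmetric] exp_diff exp_minus field_simps)
  also have "real k * r - r * r \<le> real k ^ 2"
  proof (cases "r \<le> real k")
    case True
    then have "real k * r \<le> real k ^ 2" by (simp add: power2_eq_square mult_left_mono)
    then show ?thesis using r by (simp add: add_increasing2 diff_le_eq)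
  next
    case False
    then have "real k * r \<le> r * r" using r by (intro mult_right_mono) auto
    then show ?thesis using zero_le_power2[of "real k"] by linarith
  qed
  finally show ?thesis by simp
qed

text \<open>Only finitely many lists of length at most l exist over the finite \<open>Basis\<close>,
  so separate bounds have a maximum.\<close>

lemma deriv_boundI_finite:
  fixes f :: "'a::euclidean_space \<Rightarrow> complex"
  assumes "\<And>bs. set bs \<subseteq> Basis \<Longrightarrow> \<exists>C. \<forall>x. (1 + norm x) powi r * cmod (iter_partial bs f x) \<le> C"
  shows "\<exists>C. deriv_bound r l f C"
proof -
  define L where "L = {bs::'a list. set bs \<subseteq> Basis \<and> length bs \<le> l}"
  have "finite L" unfolding L_def by (rule finite_lists_length_le[OF finite_Basis])
  obtain C where C: "\<And>bs x. bs \<in> L \<Longrightarrow> (1 + norm x) powi r * cmod (iter_partial bs f x) \<le> C bs"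
    using assms unfolding L_def by (simp, metis)
  have "C bs \<le> Max (C ` L)" if "bs \<in> L" for bs using that \<open>finite L\<close> by simp
  then have "deriv_bound r l f (Max (C ` L))"
    using C unfolding deriv_bound_def L_def by (blast intro: order_trans)
  then show ?thesis ..
qed

lemma gauss_schwartz: "gauss \<in> schwartz"
  unfolding schwartz_iff
proof (intro conjI allI gauss_C_infty deriv_boundI_finite)
  fix q :: nat and bs :: "'a list"
  obtain p where p: "real_polynomial_function p" "iter_partial bs gauss = (\<lambda>x. of_real (p x) * gauss x)"
    using iter_partial_gauss by blast
  obtain C k where C: "C \<ge> 0" "\<And>x. \<bar>p x\<bar> \<le> C * (1 + norm x) ^ k"
    using real_polynomial_function_growth[OF p(1)] by blast
  have "(1 + norm x) powi int q * cmod (iter_partial bs gauss x) \<le> C * (exp (real (q + k) ^ 2))" for x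
  proof -
    have "(1 + norm x) powi int q * cmod (iter_partial bs gauss x)
        = (1 + norm x) ^ q * (\<bar>p x\<bar> * cmod (gauss x))"
      by (simp add: p(2) norm_mult)
    also have "\<dots> \<le> (1 + norm x) ^ q * ((C * (1 + norm x) ^ k) * cmod (gauss x))"
      by (intro mult_left_mono mult_right_mono C) auto
    also have "\<dots> = C * ((1 + norm x) ^ (q + k) * cmod (gauss x))"
      by (simp add: power_add)
    also have "\<dots> \<le> C * (exp (real (q + k) ^ 2))"
      by (intro mult_left_mono power_mult_gauss_bounded C)
    finally show ?thesis .
  qed
  then show "\<exists>C. \<forall>x. (1 + norm x) powi int q * cmod (iter_partial bs gauss x) \<le> C" by blast
qed

text \<open>Centre a and width t, without normalisation: the height is kept, and the factor
  \<open>t ^ DIM('b)\<close> appears in the integral instead.\<close>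

definition rescale :: "'a::euclidean_space \<Rightarrow> real \<Rightarrow> ('a \<Rightarrow> complex) \<Rightarrow> 'a \<Rightarrow> complex" where
  "rescale a t f y = f ((y - a) /\<^sub>R t)"

lemma
  assumes f: "f \<in> C_infty"
  shows rescale_C_infty: "rescale a t f \<in> C_infty"
    and iter_partial_rescale: "set bs \<subseteq> Basis \<Longrightarrow>
      iter_partial bs (rescale a t f) = (\<lambda>y. inverse t ^ length bs *\<^sub>R rescale a t (iter_partial bs f) y)"
proof -
  define G where "G bs y = inverse t ^ length bs *\<^sub>R rescale a t (iter_partial bs f) y" for bs y
  have G0: "G [] = rescale a t f" by (simp add: G_def fun_eq_iff)
  have cont: "continuous_on UNIV (G bs)" if "set bs \<subseteq> Basis" for bs
    unfolding G_def rescale_def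
    by (intro continuous_intros continuous_on_compose2[OF C_infty_continuous_on[OF f that, of UNIV]]) auto
  have deriv: "((\<lambda>s. G bs (y + s *\<^sub>R b)) has_vector_derivative G (b # bs) y) (at 0)"
    if bs: "set bs \<subseteq> Basis" "b \<in> Basis" for bs b y
  proof -
    have "((\<lambda>s. s / t) has_vector_derivative inverse t) (at 0)"
      by (auto intro!: derivative_eq_intros simp: divide_inverse)
    moreover have "((\<lambda>s. iter_partial bs f ((y - a) /\<^sub>R t + s *\<^sub>R b)) has_vector_derivative
        iter_partial (b # bs) f ((y - a) /\<^sub>R t)) (at (0 / t))"
      using C_infty_has_vector_derivative[OF f bs, of "(y - a) /\<^sub>R t" 0] by simp
    ultimately have "((\<lambda>s. iter_partial bs f ((y - a) /\<^sub>R t + s *\<^sub>R b)) \<circ> (\<lambda>s. s / t) has_vector_derivative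
        inverse t *\<^sub>R iter_partial (b # bs) f ((y - a) /\<^sub>R t)) (at 0)"
      by (rule vector_diff_chain_at)
    then have "((\<lambda>s. iter_partial bs f ((y + s *\<^sub>R b - a) /\<^sub>R t)) has_vector_derivative
        inverse t *\<^sub>R iter_partial (b # bs) f ((y - a) /\<^sub>R t)) (at 0)"
      by (simp add: o_def algebra_simps divide_inverse)
    from has_vector_derivative_scaleR[OF DERIV_const this, of "inverse t ^ length bs"]
    show ?thesis by (simp add: G_def rescale_def mult.commute)
  qed
  show "rescale a t f \<in> C_infty" by (rule C_inftyI[OF G0 cont deriv])
  show "set bs \<subseteq> Basis \<Longrightarrow>
      iter_partial bs (rescale a t f) = (\<lambda>y. inverse t ^ length bs *\<^sub>R rescale a t (iter_partial bs f) y)"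
    using iter_partial_eqI[OF G0 cont deriv] by (simp add: G_def fun_eq_iff)
qed

text \<open>The centre costs a power of \<open>1 + norm a\<close>, the l derivatives cost
  \<open>inverse t ^ l\<close>. A net of such functions is therefore moderate once centres and
  inverse widths are bounded by powers of 1/\<epsilon>.\<close>

lemma deriv_bound_rescale:
  assumes f: "f \<in> C_infty" and C: "deriv_bound (int q) l f C" and t: "0 < t" "t \<le> 1"
  shows "deriv_bound (int q) l (rescale a t f) (C * (1 + norm a) ^ q * inverse t ^ l)"
  unfolding deriv_bound_def
proof (intro allI impI)
  fix bs :: "'a list" and y :: 'a assume bs: "set bs \<subseteq> Basis" "length bs \<le> l"
  have C0: "C \<ge> 0" using C by (rule deriv_bound_nonneg)
  define u where "u = (y - a) /\<^sub>R t"
  have "norm u = inverse t * norm (y - a)" using t by (simp only: u_def norm_scaleR abs_of_pos positive_imp_inverse_positive)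
  then have "norm (y - a) \<le> norm u"
    using t mult_right_mono[of 1 "inverse t" "norm (y - a)"] by (simp add: one_le_inverse)
  moreover have "1 + norm y \<le> (1 + norm a) * (1 + norm (y - a))"
    using weight_add_le[of a "y - a"] by simp
  ultimately have weight: "1 + norm y \<le> (1 + norm a) * (1 + norm u)"
    by (smt (verit) mult_left_mono norm_ge_zero)
  have inv: "inverse t ^ length bs \<le> inverse t ^ l"
    using t bs by (intro power_increasing) (auto simp: one_le_inverse)
  have u: "(1 + norm u) ^ q * cmod (iter_partial bs f u) \<le> C"
    using deriv_boundD[OF C bs, of u] by simp
  have "(1 + norm y) powi int q * cmod (iter_partial bs (rescale a t f) y)
      = (1 + norm y) ^ q * (inverse t ^ length bs * cmod (iter_partial bs f u))"
    using t by (simp add: iter_partial_rescale[OF f bs(1)] rescale_def u_def)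
  also have "\<dots> \<le> ((1 + norm a) * (1 + norm u)) ^ q * (inverse t ^ l * cmod (iter_partial bs f u))"
    using t by (intro mult_mono power_mono weight mult_right_mono inv) auto
  also have "\<dots> = (1 + norm a) ^ q * inverse t ^ l * ((1 + norm u) ^ q * cmod (iter_partial bs f u))"
    by (simp add: power_mult_distrib)
  also have "\<dots> \<le> (1 + norm a) ^ q * inverse t ^ l * C"
    using t by (intro mult_left_mono u) auto
  finally show "(1 + norm y) powi int q * cmod (iter_partial bs (rescale a t f) y)
      \<le> C * (1 + norm a) ^ q * inverse t ^ l"
    by (simp add: mult_ac)
qed

lemma rescale_schwartz:
  assumes "f \<in> schwartz" "0 < t" "t \<le> 1"
  shows "rescale a t f \<in> schwartz"
  using assms unfolding schwartz_iff by (blast intro: rescale_C_infty deriv_bound_rescale)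

text \<open>Substitution y = a + t u, whose Jacobian is \<open>t ^ DIM('b)\<close>.\<close>

lemma kernel_int_rescale:
  fixes h :: "'a::euclidean_space \<times> 'b::euclidean_space \<Rightarrow> complex"
  assumes h: "h \<in> C_infty" and f: "f \<in> C_infty" and t: "t > 0"
  shows "kernel_int h (rescale a t f) x = t ^ DIM('b) *\<^sub>R (LINT u|lborel. h (x, a + t *\<^sub>R u) * f u)"
proof -
  have meas: "(\<lambda>y. h (x, y) * rescale a t f y) \<in> borel_measurable lborel"
    using kernel_integrand_measurable[OF h rescale_C_infty[OF f], of "[]"] by simp
  have "kernel_int h (rescale a t f) x
      = (LINT y|density (distr lborel borel (\<lambda>u. a + t *\<^sub>R u)) (\<lambda>_. ennreal (\<bar>t\<bar> ^ DIM('b))).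
          h (x, y) * rescale a t f y)"
    unfolding kernel_int_def using t by (subst lborel_affine[of t a]) auto
  also have "\<dots> = (LINT y|distr lborel borel (\<lambda>u. a + t *\<^sub>R u). t ^ DIM('b) *\<^sub>R (h (x, y) * rescale a t f y))"
    using t meas by (subst integral_density) auto
  also have "\<dots> = (LINT u|lborel. t ^ DIM('b) *\<^sub>R (h (x, a + t *\<^sub>R u) * rescale a t f (a + t *\<^sub>R u)))"
    using meas by (subst integral_distr) auto
  also have "\<dots> = t ^ DIM('b) *\<^sub>R (LINT u|lborel. h (x, a + t *\<^sub>R u) * f u)"
    using t by (simp add: rescale_def)
  finally show ?thesis .
qed

text \<open>\<open>C_infty\<close> speaks of partial derivatives only, so the step from z to z + v
  is made one coordinate at a time with the mean value bound. With D the dimension, the number of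
  steps gives one factor D and the weight along the path gives D^q.\<close>

lemma C_infty_increment_bound:
  fixes f :: "'a::euclidean_space \<Rightarrow> complex"
  assumes f: "f \<in> C_infty" and A: "deriv_bound (- int q) 1 f A"
  shows "cmod (f (z + v) - f z) \<le> real DIM('a) ^ (q + 1) * A * norm v * (1 + norm z) ^ q * (1 + norm v) ^ q"
proof -
  define D where "D = real DIM('a)"
  have D: "D \<ge> 1" by (simp add: D_def Suc_leI)
  have A0: "A \<ge> 0" using A by (rule deriv_bound_nonneg)
  \<comment> \<open>A bound for all first partial derivatives along the path: each of its points
    differs from z by at most D |v|.\<close>
  define M where "M = A * (1 + norm z + D * norm v) ^ q"
  have M: "M \<ge> 0" using A0 D by (simp add: M_def)
  have "cmod (f (z + (\<Sum>b\<in>B. (v \<bullet> b) *\<^sub>R b)) - f z) \<le> real (card B) * norm v * M" if "B \<subseteq> Basis" for B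
    using finite_subset[OF that finite_Basis] that
  proof (induction B rule: finite_induct)
    case (insert b B)
    define y where "y = (\<Sum>b\<in>B. (v \<bullet> b) *\<^sub>R b)"
    have b: "b \<in> Basis" using insert by auto
    have vb: "\<bar>v \<bullet> b\<bar> \<le> norm v" using b by (rule Basis_le_norm)
    have y: "norm y \<le> real (card B) * norm v"
      unfolding y_def
    proof (rule sum_norm_bound)
      fix c assume "c \<in> B"
      then have "c \<in> Basis" using insert.prems by auto
      then show "norm ((v \<bullet> c) *\<^sub>R c) \<le> norm v" using Basis_le_norm[of c v] by simp
    qed
    have "card (insert b B) \<le> DIM('a)" using insert.prems by (intro card_mono) auto
    then have card: "real (card B) + 1 \<le> D" using insert.hyps by (simp add: D_def)
    have "cmod (f (z + y + (v \<bullet> b) *\<^sub>R b) - f (z + y + 0 *\<^sub>R b)) \<le> M * \<bar>v \<bullet> b\<bar>"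
    proof (rule mean_value_norm_bound[where u' = "\<lambda>s. iter_partial [b] f (z + y + s *\<^sub>R b)"])
      show "((\<lambda>s. f (z + y + s *\<^sub>R b)) has_vector_derivative iter_partial [b] f (z + y + s *\<^sub>R b)) (at s)" for s
        using C_infty_has_vector_derivative[OF f, of "[]" b] b by simp
      fix s assume s: "\<bar>s\<bar> \<le> \<bar>v \<bullet> b\<bar>"
      have "norm (z + y + s *\<^sub>R b) \<le> norm z + norm y + \<bar>s\<bar>"
        using norm_triangle_ineq[of "z + y" "s *\<^sub>R b"] norm_triangle_ineq[of z y] b by simp
      also have "\<dots> \<le> norm z + (real (card B) + 1) * norm v"
        using y s vb by (simp add: distrib_right)
      also have "\<dots> \<le> norm z + D * norm v" by (intro add_left_mono mult_right_mono card) auto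
      finally have "A * (1 + norm (z + y + s *\<^sub>R b)) ^ q \<le> M"
        unfolding M_def by (intro mult_left_mono power_mono A0) auto
      moreover have "cmod (iter_partial [b] f (z + y + s *\<^sub>R b)) \<le> A * (1 + norm (z + y + s *\<^sub>R b)) ^ q"
        using A b by (simp add: deriv_bound_neg_iff)
      ultimately show "cmod (iter_partial [b] f (z + y + s *\<^sub>R b)) \<le> M" by linarith
    qed
    also have "\<dots> \<le> M * norm v" using vb M by (rule mult_left_mono)
    finally have "cmod (f (z + y + (v \<bullet> b) *\<^sub>R b) - f (z + y)) \<le> M * norm v" by simp
    moreover have "cmod (f (z + y) - f z) \<le> real (card B) * norm v * M"
      using insert unfolding y_def by auto
    ultimately have "cmod (f (z + y + (v \<bullet> b) *\<^sub>R b) - f z) \<le> M * norm v + real (card B) * norm v * M"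
      using norm_triangle_ineq[of "f (z + y + (v \<bullet> b) *\<^sub>R b) - f (z + y)" "f (z + y) - f z"] by simp
    moreover have "z + y + (v \<bullet> b) *\<^sub>R b = z + (\<Sum>b\<in>insert b B. (v \<bullet> b) *\<^sub>R b)"
      using insert.hyps by (simp add: y_def add_ac)
    ultimately show ?case using insert.hyps by (simp add: algebra_simps)
  qed simp
  from this[of Basis] have "cmod (f (z + v) - f z) \<le> D * norm v * M"
    by (simp add: euclidean_representation D_def)
  also have "\<dots> \<le> D * norm v * (A * (D * (1 + norm z) * (1 + norm v)) ^ q)"
  proof -
    have "1 + norm z + D * norm v \<le> D * (1 + norm z) * (1 + norm v)"
    proof -
      have "1 + norm z \<le> D * (1 + norm z)" using D mult_right_mono[of 1 D "1 + norm z"] by simp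
      moreover have "0 \<le> D * norm z * norm v" using D by simp
      ultimately show ?thesis by (simp add: algebra_simps)
    qed
    then show ?thesis unfolding M_def using D by (intro mult_left_mono power_mono A0 mult_nonneg_nonneg) auto
  qed
  finally show ?thesis
    by (simp add: D_def power_mult_distrib mult_ac)
qed

lemma gauss_integrable: "integrable lborel (gauss :: 'a::euclidean_space \<Rightarrow> complex)"
proof -
  \<comment> \<open>The constant kernel 1 turns the integrability of kernel integrands into that of
    the Gaussian.\<close>
  have "(\<lambda>_. 1 :: complex) \<in> (O_M :: ('a \<times> 'a \<Rightarrow> complex) set)"
  proof -
    have "iter_partial bs (\<lambda>_. 1 :: complex) = (\<lambda>_::'a \<times> 'a. if bs = [] then 1 else 0)" if "set bs \<subseteq> Basis" for bs
      using that by (intro iter_partial_eqI[where G = "\<lambda>bs _. if bs = [] then 1 else 0"]) auto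
    then have "deriv_bound (- int 0) l (\<lambda>_::'a \<times> 'a. 1) 1" for l
      by (auto simp: deriv_bound_def)
    moreover have "(\<lambda>_::'a \<times> 'a. 1 :: complex) \<in> C_infty"
      by (rule C_inftyI[where G = "\<lambda>bs _. if bs = [] then 1 else 0"]) auto
    ultimately show ?thesis unfolding O_M_iff by blast
  qed
  from integrable_kernel_integrand[OF this gauss_schwartz, of "[]" 0] show ?thesis by simp
qed

text \<open>The integrand is positive everywhere, so a vanishing integral would make it zero almost
  everywhere. Positivity of c is all that the lower bound below asks of the integral.\<close>

lemma gauss_integral_pos:
  obtains c where "c > 0" "(LINT y|lborel. gauss (y::'a::euclidean_space)) = complex_of_real c"
proof -
  define e where "e y = exp (- (y \<bullet> y))" for y :: 'a
  have gauss: "gauss = (\<lambda>y. complex_of_real (e y))" by (simp add: gauss_def e_def fun_eq_iff)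
  have int: "integrable lborel e"
    using gauss_integrable[where 'a = 'a] unfolding gauss by (simp add: complex_of_real_integrable_eq)
  have "integral\<^sup>L lborel e \<noteq> 0"
  proof
    assume "integral\<^sup>L lborel e = 0"
    then have "AE y in lborel. e y = 0"
      by (subst (asm) integral_nonneg_eq_0_iff_AE[OF int]) (auto simp: e_def)
    then have "AE y in (lborel :: 'a measure). False" by (simp add: e_def)
    then show False by (simp add: eventually_False ae_filter_eq_bot_iff)
  qed
  moreover have "integral\<^sup>L lborel e \<ge> 0" by (rule integral_nonneg_AE) (simp add: e_def)
  moreover have "(LINT y|lborel. gauss (y::'a)) = complex_of_real (integral\<^sup>L lborel e)"
    by (simp add: gauss)
  ultimately show ?thesis using that by (metis less_le)
qed

text \<open>Testing against a Gaussian of width \<open>t\<close> at \<open>a\<close> evaluates the kernel at \<open>a\<close> up to an error of order \<open>t\<close>.\<close>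

lemma kernel_int_gauss_lower:
  fixes q :: nat
  obtains c K where "c > 0" "K \<ge> 0"
    "\<And>h A (a :: 'b::euclidean_space) t x. h \<in> O_M \<Longrightarrow> deriv_bound (- int q) 1 h A \<Longrightarrow> 0 < t \<Longrightarrow> t \<le> 1 \<Longrightarrow>
      t ^ DIM('b) * (c * cmod (h (x, a)) - K * A * t * (1 + norm (x, a)) ^ q)
        \<le> cmod (kernel_int h (rescale a t gauss) (x :: 'a::euclidean_space))"
proof -
  obtain c where c: "c > 0" "(LINT y|lborel. gauss (y::'b)) = complex_of_real c"
    by (rule gauss_integral_pos)
  define n where "n = DIM('b)"
  define D where "D = real DIM('a \<times> 'b) ^ (q + 1)"
  \<comment> \<open>Decay needed: q for the growth of the kernel, 1 for the factor |u| of the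
    increment, n + 2 for integrability.\<close>
  obtain B where B: "deriv_bound (int (q + 1 + n + 2)) 0 (gauss :: 'b \<Rightarrow> complex) B"
    using gauss_schwartz unfolding schwartz_iff by blast
  have B0: "B \<ge> 0" using B by (rule deriv_bound_nonneg)
  define W where "W = weight_integral TYPE('b)"
  have W0: "W \<ge> 0" by (simp add: W_def weight_integral_nonneg)
  have D0: "D \<ge> 0" by (simp add: D_def)
  have gauss_decay: "norm u * (1 + norm u) ^ q * cmod (gauss u) \<le> B * inverse ((1 + norm u) ^ (n + 2))" for u :: 'b
  proof -
    define Y where "Y = 1 + norm u"
    have Y: "Y > 0" by (simp add: Y_def add_pos_nonneg)
    have "Y powi int (q + 1 + n + 2) * cmod (gauss u) \<le> B"
      using deriv_boundD[OF B, of "[]" u] by (simp add: Y_def)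
    then have "Y ^ (q + 1) * cmod (gauss u) * Y ^ (n + 2) \<le> B"
      by (simp only: power_int_of_nat power_add mult_ac)
    then have "Y ^ (q + 1) * cmod (gauss u) \<le> B * inverse (Y ^ (n + 2))"
      using Y by (subst (asm) pos_le_divide_eq[symmetric]) (simp_all add: divide_inverse)
    moreover have "norm u * Y ^ q * cmod (gauss u) \<le> Y ^ (q + 1) * cmod (gauss u)"
      using Y by (intro mult_right_mono) (auto simp: Y_def)
    ultimately show ?thesis unfolding Y_def by linarith
  qed
  have "t ^ n * (c * cmod (h (x, a)) - (D * B * W) * A * t * (1 + norm (x, a)) ^ q)
      \<le> cmod (kernel_int h (rescale a t gauss) x)"
    if h: "h \<in> O_M" "deriv_bound (- int q) 1 h A" and t: "0 < t" "t \<le> 1" for h A t and a :: 'b and x :: 'a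
  proof -
    have hC: "h \<in> C_infty" using h(1) by (simp add: O_M_iff)
    have A0: "A \<ge> 0" using h(2) by (rule deriv_bound_nonneg)
    define w where "w = (1 + norm (x, a)) ^ q"
    have w0: "w \<ge> 0" by (simp add: w_def)
    define E where "E u = (h (x, a + t *\<^sub>R u) - h (x, a)) * gauss u" for u :: 'b
    have E_bound: "cmod (E u) \<le> D * A * t * w * B * inverse ((1 + norm u) ^ (n + 2))" for u
    proof -
      define v where "v = (0 :: 'a, t *\<^sub>R u)"
      have "norm v = t * norm u" using t by (simp add: v_def)
      moreover have "t * norm u \<le> norm u" using t by (simp add: mult_left_le_one_le)
      \<comment> \<open>The linear occurrence of \<open>norm v\<close> keeps its factor t, the gain
        of the estimate; inside the weight t is merely bounded by 1.\<close>
      ultimately have v: "norm v = t * norm u" "1 + norm v \<le> 1 + norm u" by auto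
      have "cmod (h (x, a + t *\<^sub>R u) - h (x, a)) \<le> D * A * norm v * w * (1 + norm v) ^ q"
        using C_infty_increment_bound[OF hC h(2), of "(x, a)" v] unfolding D_def w_def by (simp add: v_def)
      also have "\<dots> \<le> D * A * (t * norm u) * w * (1 + norm u) ^ q"
        using v A0 D0 w0 t by (intro mult_mono power_mono) auto
      finally have "cmod (E u) \<le> D * A * (t * norm u) * w * (1 + norm u) ^ q * cmod (gauss u)"
        unfolding E_def norm_mult by (rule mult_right_mono) simp
      also have "\<dots> = (D * A * t * w) * (norm u * (1 + norm u) ^ q * cmod (gauss u))" by (simp add: mult_ac)
      also have "\<dots> \<le> (D * A * t * w) * (B * inverse ((1 + norm u) ^ (n + 2)))"
        using A0 D0 w0 t by (intro mult_left_mono gauss_decay) auto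
      finally show ?thesis by (simp add: mult_ac)
    qed
    have "continuous_on UNIV h"
      using C_infty_continuous_on[OF hC, of "[]" UNIV] by simp
    then have "continuous_on UNIV (\<lambda>u. h (x, a + t *\<^sub>R u))"
      by (rule continuous_on_compose2) (auto intro!: continuous_intros)
    moreover have "continuous_on UNIV (gauss :: 'b \<Rightarrow> complex)"
      using C_infty_continuous_on[OF gauss_C_infty, of "[]" UNIV] by simp
    ultimately have cont: "continuous_on UNIV E"
      unfolding E_def by (intro continuous_on_mult continuous_on_diff continuous_on_const)
    have bound_int: "integrable lborel (\<lambda>u::'b. D * A * t * w * B * inverse ((1 + norm u) ^ (n + 2)))"
      unfolding n_def by (intro integrable_mult_right integrable_inverse_weight)
    have E_int: "integrable lborel E"
    proof (rule Bochner_Integration.integrable_bound[OF bound_int])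
      show "E \<in> borel_measurable lborel" using cont by (simp add: borel_measurable_continuous_onI)
      show "AE u in lborel. norm (E u) \<le> norm (D * A * t * w * B * inverse ((1 + norm u) ^ (n + 2)))"
        by (intro AE_I2 order_trans[OF E_bound]) (simp only: real_norm_def abs_ge_self)
    qed
    have "cmod (LINT u|lborel. E u) \<le> (LINT u|lborel. D * A * t * w * B * inverse ((1 + norm (u::'b)) ^ (n + 2)))"
      by (rule order_trans[OF integral_norm_bound integral_mono[OF integrable_norm[OF E_int] bound_int E_bound]])
    also have "\<dots> = D * B * W * A * t * w"
      by (simp only: integral_mult_right_zero weight_integral_def W_def n_def mult_ac)
    finally have 1: "cmod (LINT u|lborel. E u) \<le> D * B * W * A * t * w" .
    have "(LINT u|lborel. h (x, a + t *\<^sub>R u) * gauss u)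
        = (LINT u|lborel. E u + h (x, a) * gauss u)"
      by (simp add: E_def algebra_simps)
    also have "\<dots> = (LINT u|lborel. E u) + h (x, a) * complex_of_real c"
      using E_int gauss_integrable[where 'a = 'b] c(2) by simp
    finally have "cmod (h (x, a) * complex_of_real c)
        \<le> cmod (LINT u|lborel. h (x, a + t *\<^sub>R u) * gauss u) + cmod (LINT u|lborel. E u)"
      using norm_triangle_ineq4[of "(LINT u|lborel. E u) + h (x, a) * complex_of_real c" "LINT u|lborel. E u"]
      by simp
    then have "c * cmod (h (x, a)) - D * B * W * A * t * w
        \<le> cmod (LINT u|lborel. h (x, a + t *\<^sub>R u) * gauss u)"
      using 1 c(1) by (simp add: norm_mult mult.commute)
    then have "t ^ n * (c * cmod (h (x, a)) - D * B * W * A * t * w)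
        \<le> t ^ n * cmod (LINT u|lborel. h (x, a + t *\<^sub>R u) * gauss u)"
      using t by (intro mult_left_mono) auto
    also have "\<dots> = cmod (kernel_int h (rescale a t gauss) x)"
      using t by (simp add: kernel_int_rescale[OF hC gauss_C_infty t(1)] n_def)
    finally show ?thesis by (simp add: w_def)
  qed
  moreover have "D * B * W \<ge> 0" using D0 B0 W0 by simp
  ultimately show ?thesis using that[OF c(1), of "D * B * W"] unfolding n_def by blast
qed

section \<open>Kernels annihilating all test nets\<close>

lemma eventually_mult_small:
  assumes "d > 0"
  shows "\<forall>\<^sub>F \<epsilon> in at_right (0::real). X * \<epsilon> < d"
proof -
  have "((\<lambda>\<epsilon>. X * \<epsilon>) \<longlongrightarrow> X * 0) (at_right 0)" by (intro tendsto_intros)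
  then show ?thesis using assms by (intro order_tendstoD(2)) auto
qed

lemma null_tau_if_kernel_int_null:
  fixes h :: "('a::euclidean_space \<times> 'b::euclidean_space) net"
  assumes h: "h \<in> moderate_tau"
    and null: "\<And>\<phi>. \<phi> \<in> moderate_S \<Longrightarrow> (\<lambda>\<epsilon>. kernel_int (h \<epsilon>) (\<phi> \<epsilon>)) \<in> null_tau"
  shows "h \<in> null_tau"
proof -
  obtain q0 N where q0: "net_bound (- int q0) 1 h (- int N)" using h unfolding moderate_tau_iff by blast
  then obtain A where A0: "A \<ge> 0"
    and A: "\<forall>\<^sub>F \<epsilon> in at_right 0. deriv_bound (- int q0) 1 (h \<epsilon>) (A * \<epsilon> powi - int N)"
    by (rule net_boundE)
  obtain c K where c: "c > 0" and K: "K \<ge> 0"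
    and lower: "\<And>h A (a :: 'b) t x. h \<in> O_M \<Longrightarrow> deriv_bound (- int q0) 1 h A \<Longrightarrow> 0 < t \<Longrightarrow> t \<le> 1 \<Longrightarrow>
      t ^ DIM('b) * (c * cmod (h (x, a)) - K * A * t * (1 + norm (x, a)) ^ q0)
        \<le> cmod (kernel_int h (rescale a t gauss) (x :: 'a))"
    by (rule kernel_int_gauss_lower[where 'a = 'a and 'b = 'b and q = q0]) blast
  have "net_bound (- int (q0 + 1)) 0 h (int p)" for p
  proof (rule ccontr)
    assume contr: "\<not> net_bound (- int (q0 + 1)) 0 h (int p)"
    \<comment> \<open>\<open>contr\<close> denies the estimate for every constant; with constant 1
      this means that bad points exist for arbitrarily small \<epsilon>.\<close>
    define bad where "bad \<epsilon> z \<longleftrightarrow> \<epsilon> ^ p * (1 + norm z) ^ (q0 + 1) < cmod (h \<epsilon> z)" for \<epsilon> z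
    have freq: "\<exists>\<^sub>F \<epsilon> in at_right 0. \<exists>z. bad \<epsilon> z"
    proof (rule ccontr)
      assume "\<not> (\<exists>\<^sub>F \<epsilon> in at_right 0. \<exists>z. bad \<epsilon> z)"
      then have "\<forall>\<^sub>F \<epsilon> in at_right 0. \<forall>z. \<not> bad \<epsilon> z"
        by (simp add: frequently_def)
      then have "\<forall>\<^sub>F \<epsilon> in at_right 0. deriv_bound (- int (q0 + 1)) 0 (h \<epsilon>) (1 * \<epsilon> powi int p)"
        by eventually_elim (auto simp only: deriv_bound_neg_iff bad_def not_less le_zero_eq length_0_conv
            iter_partial_Nil power_int_of_nat mult_1)
      then show False using contr unfolding net_bound_def by blast
    qed
    define zz where "zz \<epsilon> = (SOME z. bad \<epsilon> z)" for \<epsilon>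
    have zz: "bad \<epsilon> (zz \<epsilon>)" if "\<exists>z. bad \<epsilon> z" for \<epsilon>
      using that unfolding zz_def by (rule someI_ex)
    \<comment> \<open>Makes the error of the Gaussian test small against the kernel value: the loss
      N of the derivative bound is cancelled, p matches the size at a bad point, and one spare power
      of \<epsilon> beats the constant K A.\<close>
    define s where "s = N + p + 1"
    \<comment> \<open>Bad points exist only for some \<epsilon>; elsewhere 0 completes the
      net.\<close>
    define \<phi> where "\<phi> \<epsilon> = (if \<exists>z. bad \<epsilon> z then rescale (snd (zz \<epsilon>)) (\<epsilon> ^ s) gauss else (\<lambda>_. 0))" for \<epsilon>
    \<comment> \<open>The bad value exceeds \<epsilon> ^ p times the weight to the power
      \<open>q0 + 1\<close>, while the moderate bound allows only the power \<open>q0\<close>.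
      Dividing leaves one factor \<open>1 + norm z\<close>.\<close>
    have located: "1 + norm z \<le> A * inverse (\<epsilon> ^ (N + p))"
      if \<epsilon>: "0 < \<epsilon>" and A: "deriv_bound (- int q0) 1 (h \<epsilon>) (A * \<epsilon> powi - int N)" and bad: "bad \<epsilon> z" for \<epsilon> z
    proof -
      define w where "w = (1 + norm z) ^ q0"
      have w: "w > 0" by (simp add: w_def add_pos_nonneg)
      have "cmod (h \<epsilon> z) \<le> A * \<epsilon> powi - int N * w"
        unfolding w_def by (rule deriv_bound_neg_zeroD[OF A])
      with bad have "(\<epsilon> ^ p * (1 + norm z)) * w \<le> (A * inverse (\<epsilon> ^ N)) * w"
        by (simp add: bad_def w_def power_int_minus mult_ac)
      then have "\<epsilon> ^ p * (1 + norm z) \<le> A * inverse (\<epsilon> ^ N)"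
        using w by (rule mult_right_le_imp_le)
      then show ?thesis
        using \<epsilon> by (simp add: power_add field_simps)
    qed
    have "\<phi> \<in> moderate_S"
      unfolding moderate_S_iff
    proof (intro conjI ballI allI)
      fix \<epsilon> :: real assume "\<epsilon> \<in> {0<..1}"
      then show "\<phi> \<epsilon> \<in> schwartz"
        using null_S_zero unfolding \<phi>_def null_S_iff
        by (auto intro!: rescale_schwartz gauss_schwartz simp: power_le_one)
    next
      fix q' l
      obtain C where C: "deriv_bound (int q') l (gauss :: 'b \<Rightarrow> complex) C"
        using gauss_schwartz unfolding schwartz_iff by blast
      have C0: "C \<ge> 0" using C by (rule deriv_bound_nonneg)
      \<comment> \<open>\<open>(N + p) * q'\<close> accounts for the centres, \<open>s * l\<close>
        for the widths.\<close>
      define M where "M = (N + p) * q' + s * l"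
      have "\<forall>\<^sub>F \<epsilon> in at_right 0. deriv_bound (int q') l (\<phi> \<epsilon>) (C * A ^ q' * \<epsilon> powi - int M)"
        using A eventually_at_right_0_1
      proof eventually_elim
        case (elim \<epsilon>)
        then have \<epsilon>: "0 < \<epsilon>" "\<epsilon> \<le> 1" by auto
        show ?case
        proof (cases "\<exists>z. bad \<epsilon> z")
          case True
          define a where "a = snd (zz \<epsilon>)"
          have "norm a \<le> norm (zz \<epsilon>)" unfolding a_def by (metis norm_snd_le prod.collapse)
          then have a: "1 + norm a \<le> A * inverse (\<epsilon> ^ (N + p))"
            using located[OF \<epsilon>(1) elim(1) zz[OF True]] by linarith
          have "C * (1 + norm a) ^ q' * inverse (\<epsilon> ^ s) ^ l
              \<le> C * (A * inverse (\<epsilon> ^ (N + p))) ^ q' * inverse (\<epsilon> ^ s) ^ l"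
            using \<epsilon> C0 by (intro mult_left_mono mult_right_mono power_mono a) auto
          also have "\<dots> = C * A ^ q' * \<epsilon> powi - int M"
            by (simp add: M_def power_int_minus power_mult_distrib power_add power_mult power_inverse
                flip: of_nat_add of_nat_mult)
          finally show ?thesis
            unfolding \<phi>_def using True \<epsilon>
            by (simp flip: a_def)
               (rule deriv_bound_mono[OF deriv_bound_rescale[OF gauss_C_infty C]],
                 auto simp: power_le_one)
        next
          case False
          then show ?thesis
            unfolding \<phi>_def using C0 A0 \<epsilon>
            by (simp, intro deriv_bound_mono[OF deriv_bound_zero]) auto
        qed
      qed
      then show "\<exists>N. net_bound (int q') l \<phi> (- int N)" unfolding net_bound_def by blast
    qed
    then obtain q1 where q1: "\<And>p'. net_bound (- int q1) 0 (\<lambda>\<epsilon>. kernel_int (h \<epsilon>) (\<phi> \<epsilon>)) (int p')"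
      using null unfolding null_tau_iff by blast
    define n where "n = DIM('b)"
    \<comment> \<open>\<open>(N + p) * q1\<close> pays for the weight at x, \<open>s * n\<close> for
      the Jacobian, p for the size of the bad value; the last 1 leaves a factor \<epsilon> for the
      contradiction.\<close>
    define P where "P = (N + p) * q1 + s * n + p + 1"
    obtain C where C0: "C \<ge> 0"
      and C: "\<forall>\<^sub>F \<epsilon> in at_right 0. deriv_bound (- int q1) 0 (kernel_int (h \<epsilon>) (\<phi> \<epsilon>)) (C * \<epsilon> powi int P)"
      using q1[of P] by (rule net_boundE)
    \<comment> \<open>The first smallness lets the error take at most half of the lower bound
      \<open>c * H\<close>; the second makes the negligible upper bound smaller than the remaining
      half.\<close>
    have small: "\<forall>\<^sub>F \<epsilon> in at_right 0. K * A * \<epsilon> < c / 2" "\<forall>\<^sub>F \<epsilon> in at_right 0. C * A ^ q1 * \<epsilon> < c / 2"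
      by (rule eventually_mult_small, simp add: c)+
    have "\<forall>\<^sub>F \<epsilon> in at_right 0. \<not> (\<exists>z. bad \<epsilon> z)"
      using A C eventually_at_right_0_1 small
    proof eventually_elim
      case (elim \<epsilon>)
      note A = elim(1) and C = elim(2) and \<epsilon>01 = elim(3) and small = elim(4,5)
      show ?case
      proof
        assume ex: "\<exists>z. bad \<epsilon> z"
        have \<epsilon>: "0 < \<epsilon>" "\<epsilon> \<le> 1" using \<epsilon>01 by auto
        obtain x a where z: "zz \<epsilon> = (x, a)" by (cases "zz \<epsilon>")
        have bad: "bad \<epsilon> (x, a)" using zz[OF ex] by (simp add: z)
        define w where "w = (1 + norm (x, a)) ^ q0"
        have w: "w > 0" by (simp add: w_def add_pos_nonneg)
        define H where "H = cmod (h \<epsilon> (x, a))"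
        \<comment> \<open>Two weakenings of badness: with the weight, to absorb the error term, and
          without it, for the final contradiction.\<close>
        have "\<epsilon> ^ p * w \<le> \<epsilon> ^ p * (1 + norm (x, a)) ^ (q0 + 1)" "\<epsilon> ^ p * 1 \<le> \<epsilon> ^ p * (1 + norm (x, a)) ^ (q0 + 1)"
          unfolding w_def using \<epsilon> by (intro mult_left_mono power_increasing one_le_power; simp)+
        with bad have H: "\<epsilon> ^ p * w \<le> H" "\<epsilon> ^ p \<le> H" by (auto simp: bad_def H_def)
        have \<phi>: "\<phi> \<epsilon> = rescale a (\<epsilon> ^ s) gauss" using ex by (simp add: \<phi>_def z)
        have hO: "h \<epsilon> \<in> O_M" using h \<epsilon>01 unfolding moderate_tau_iff by blast
        have "K * (A * \<epsilon> powi - int N) * \<epsilon> ^ s * w = (K * A * \<epsilon>) * (\<epsilon> ^ p * w)"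
          using \<epsilon> by (simp add: s_def power_int_minus power_add field_simps)
        also have "\<dots> \<le> c / 2 * H"
          using small(1) H c \<epsilon> w by (intro mult_mono) auto
        finally have "c / 2 * H \<le> c * H - K * (A * \<epsilon> powi - int N) * \<epsilon> ^ s * w"
          by (simp add: mult.commute)
        then have "(\<epsilon> ^ s) ^ n * (c / 2 * H) \<le> (\<epsilon> ^ s) ^ n * (c * H - K * (A * \<epsilon> powi - int N) * \<epsilon> ^ s * w)"
          using \<epsilon> by (intro mult_left_mono) auto
        also have "\<dots> \<le> cmod (kernel_int (h \<epsilon>) (\<phi> \<epsilon>) x)"
          unfolding \<phi> H_def w_def n_def using \<epsilon> by (intro lower hO A) (auto simp: power_le_one)
        also have "\<dots> \<le> C * \<epsilon> powi int P * (1 + norm x) ^ q1"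
          by (rule deriv_bound_neg_zeroD[OF C])
        also have "\<dots> \<le> C * \<epsilon> powi int P * (A * inverse (\<epsilon> ^ (N + p))) ^ q1"
        proof -
          have "norm x \<le> norm (x, a)" by (rule norm_fst_le)
          then have "1 + norm x \<le> A * inverse (\<epsilon> ^ (N + p))"
            using located[OF \<epsilon>(1) A bad] by linarith
          then show ?thesis using C0 \<epsilon> by (intro mult_left_mono power_mono) auto
        qed
        also have "\<dots> = (\<epsilon> ^ s) ^ n * (C * A ^ q1 * \<epsilon> * \<epsilon> ^ p)"
          unfolding power_int_of_nat using \<epsilon> power_mult[of \<epsilon> n s] power_mult[of \<epsilon> s n]
          by (simp add: P_def power_add power_mult power_mult_distrib power_inverse field_simps)
        finally have "c / 2 * H \<le> C * A ^ q1 * \<epsilon> * \<epsilon> ^ p"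
          by (rule mult_left_le_imp_le) (use \<epsilon> in auto)
        also have "\<dots> < c / 2 * \<epsilon> ^ p" using small(2) \<epsilon> by (intro mult_strict_right_mono) auto
        finally have "H < \<epsilon> ^ p" using c by simp
        with H(2) show False by simp
      qed
    qed
    with freq show False by (simp add: frequently_def)
  qed
  then show ?thesis by (rule null_tauI_order_zero[OF h])
qed

section \<open>The integral operator\<close>

lemma kernel_int_lincomb_left:
  assumes "h \<in> O_M" "h' \<in> O_M" "\<phi> \<in> schwartz"
  shows "kernel_int (\<lambda>z. a * h z + b * h' z) \<phi> = (\<lambda>x. a * kernel_int h \<phi> x + b * kernel_int h' \<phi> x)"
proof
  fix x
  have "integrable lborel (\<lambda>y. h (x, y) * \<phi> y)" "integrable lborel (\<lambda>y. h' (x, y) * \<phi> y)"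
    using assms integrable_kernel_integrand[of _ \<phi> "[]" x] by auto
  then show "kernel_int (\<lambda>z. a * h z + b * h' z) \<phi> x = a * kernel_int h \<phi> x + b * kernel_int h' \<phi> x"
    by (simp add: kernel_int_def distrib_right mult.assoc)
qed

lemma kernel_int_lincomb_right:
  assumes "h \<in> O_M" "\<phi> \<in> schwartz" "\<psi> \<in> schwartz"
  shows "kernel_int h (\<lambda>y. a * \<phi> y + b * \<psi> y) = (\<lambda>x. a * kernel_int h \<phi> x + b * kernel_int h \<psi> x)"
proof
  fix x
  have "integrable lborel (\<lambda>y. h (x, y) * \<phi> y)" "integrable lborel (\<lambda>y. h (x, y) * \<psi> y)"
    using assms integrable_kernel_integrand[of h _ "[]" x] by auto
  then show "kernel_int h (\<lambda>y. a * \<phi> y + b * \<psi> y) x = a * kernel_int h \<phi> x + b * kernel_int h \<psi> x"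
    by (simp add: kernel_int_def distrib_left mult.left_commute)
qed

text \<open>Identities between kernel integrals rest on integrability, which is known only for
  \<epsilon> in (0,1]; this lemma transports negligibility along them.\<close>

lemma null_tau_cong:
  assumes f: "f \<in> null_tau" and eq: "\<And>\<epsilon>. \<epsilon> \<in> {0<..1} \<Longrightarrow> f \<epsilon> = g \<epsilon>"
  shows "g \<in> null_tau"
proof -
  have "net_bound r l g k" if bound: "net_bound r l f k" for r l k
  proof -
    obtain C where C: "\<forall>\<^sub>F \<epsilon> in at_right 0. deriv_bound r l (f \<epsilon>) (C * \<epsilon> powi k)"
      using bound unfolding net_bound_def by blast
    have "\<forall>\<^sub>F \<epsilon> in at_right 0. deriv_bound r l (g \<epsilon>) (C * \<epsilon> powi k)"
      using C eventually_at_right_0_1 by eventually_elim (simp add: eq)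
    then show ?thesis unfolding net_bound_def by blast
  qed
  moreover have "\<forall>\<epsilon>\<in>{0<..1}. g \<epsilon> \<in> O_M"
  proof
    fix \<epsilon> :: real assume "\<epsilon> \<in> {0<..1}"
    then show "g \<epsilon> \<in> O_M" using f eq[of \<epsilon>] unfolding null_tau_iff by metis
  qed
  ultimately show ?thesis using f unfolding null_tau_iff by blast
qed

lemma class_tau_eq_iff: "class_tau f = class_tau g \<longleftrightarrow> (\<lambda>\<epsilon> x. f \<epsilon> x - g \<epsilon> x) \<in> null_tau"
  unfolding class_tau_def by (rule tau.cls_eq_iff)

lemma class_tau_cong:
  assumes "\<And>\<epsilon>. \<epsilon> \<in> {0<..1} \<Longrightarrow> f \<epsilon> = g \<epsilon>"
  shows "class_tau f = class_tau g"
  unfolding class_tau_eq_iff by (rule null_tau_cong[OF null_tau_zero]) (simp add: assms fun_eq_iff)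

text \<open>Bilinearity splits the difference into (h' - h) against \<phi>' plus h against (\<phi>'
  - \<phi>), each with one null factor.\<close>

lemma class_kernel_int_cong:
  fixes h h' :: "('a::euclidean_space \<times> 'b::euclidean_space) net"
  assumes h: "h \<in> moderate_tau" "h' \<in> tau.cls h" and \<phi>: "\<phi> \<in> moderate_S" "\<phi>' \<in> S.cls \<phi>"
  shows "class_tau (\<lambda>\<epsilon>. kernel_int (h' \<epsilon>) (\<phi>' \<epsilon>)) = class_tau (\<lambda>\<epsilon>. kernel_int (h \<epsilon>) (\<phi> \<epsilon>))"
  unfolding class_tau_eq_iff
proof (rule null_tau_cong)
  have h': "h' \<in> moderate_tau" using tau.cls_subset[OF h(1)] h(2) by blast
  have \<phi>': "\<phi>' \<in> moderate_S" using S.cls_subset[OF \<phi>(1)] \<phi>(2) by blast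
  define dh where "dh = (\<lambda>\<epsilon> z. h' \<epsilon> z - h \<epsilon> z)"
  define d\<phi> where "d\<phi> = (\<lambda>\<epsilon> y. \<phi>' \<epsilon> y - \<phi> \<epsilon> y)"
  have dh: "dh \<in> null_tau" using h(2) by (simp add: tau.mem_cls_iff dh_def)
  have d\<phi>: "d\<phi> \<in> null_S" using \<phi>(2) by (simp add: S.mem_cls_iff d\<phi>_def)
  show "(\<lambda>\<epsilon> x. kernel_int (dh \<epsilon>) (\<phi>' \<epsilon>) x + kernel_int (h \<epsilon>) (d\<phi> \<epsilon>) x) \<in> null_tau"
    by (intro tau.null_add kernel_int_null_left kernel_int_null_right dh d\<phi> \<phi>' h)
  fix \<epsilon> :: real assume "\<epsilon> \<in> {0<..1}"
  then have "h \<epsilon> \<in> O_M" "h' \<epsilon> \<in> O_M" "\<phi> \<epsilon> \<in> schwartz" "\<phi>' \<epsilon> \<in> schwartz"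
    using h(1) h' \<phi>(1) \<phi>' unfolding moderate_tau_iff moderate_S_iff by auto
  then show "(\<lambda>x. kernel_int (dh \<epsilon>) (\<phi>' \<epsilon>) x + kernel_int (h \<epsilon>) (d\<phi> \<epsilon>) x)
      = (\<lambda>x. kernel_int (h' \<epsilon>) (\<phi>' \<epsilon>) x - kernel_int (h \<epsilon>) (\<phi> \<epsilon>) x)"
    using kernel_int_lincomb_left[of "h' \<epsilon>" "h \<epsilon>" "\<phi>' \<epsilon>" 1 "-1"]
      kernel_int_lincomb_right[of "h \<epsilon>" "\<phi>' \<epsilon>" "\<phi> \<epsilon>" 1 "-1"]
    by (simp add: dh_def d\<phi>_def)
qed

lemma carrier_G_tau: "carrier G_tau = class_tau ` moderate_tau"
  unfolding G_tau_def tau.carrier_FactModule class_tau_def ..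

lemma carrier_G_S: "carrier G_S = S.cls ` moderate_S"
  unfolding G_S_def by (rule S.carrier_FactModule)

text \<open>All cosets in the defining union agree by \<open>class_kernel_int_cong\<close>, so the
  operator can be computed on representatives.\<close>

lemma integral_op_class:
  fixes h :: "('a::euclidean_space \<times> 'b::euclidean_space) net"
  assumes h: "h \<in> moderate_tau" and \<phi>: "\<phi> \<in> moderate_S"
  shows "integral_op (class_tau h) (S.cls \<phi>) = class_tau (\<lambda>\<epsilon>. kernel_int (h \<epsilon>) (\<phi> \<epsilon>))"
proof -
  have "integral_op (class_tau h) (S.cls \<phi>)
      = (\<Union>h'\<in>tau.cls h. \<Union>\<phi>'\<in>S.cls \<phi>. class_tau (\<lambda>\<epsilon>. kernel_int (h' \<epsilon>) (\<phi>' \<epsilon>)))"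
    using \<phi> by (simp add: integral_op_def carrier_G_S kernel_int_def[abs_def] class_tau_def)
  also have "\<dots> = (\<Union>h'\<in>tau.cls h. \<Union>\<phi>'\<in>S.cls \<phi>. class_tau (\<lambda>\<epsilon>. kernel_int (h \<epsilon>) (\<phi> \<epsilon>)))"
    by (intro SUP_cong refl class_kernel_int_cong h \<phi>)
  also have "\<dots> = class_tau (\<lambda>\<epsilon>. kernel_int (h \<epsilon>) (\<phi> \<epsilon>))"
    using tau.self_mem_cls[of h] S.self_mem_cls[of \<phi>] by auto
  finally show ?thesis .
qed

text \<open>On representatives linearity is that of the integral for each \<epsilon> in (0,1], and
  \<open>class_tau_cong\<close> disregards all other parameters.\<close>

lemma integral_op_linear:
  fixes H :: "('a::euclidean_space \<times> 'b::euclidean_space) net set"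
  assumes "H \<in> carrier G_tau"
  shows "integral_op H \<in> linear_maps gen_const G_S G_tau"
proof -
  obtain h where h: "h \<in> moderate_tau" and H: "H = class_tau h" using assms by (auto simp: carrier_G_tau)
  have hO: "h \<epsilon> \<in> O_M" if "\<epsilon> \<in> {0<..1}" for \<epsilon> using h that unfolding moderate_tau_iff by blast
  have schwartz: "\<phi> \<epsilon> \<in> schwartz" if "\<phi> \<in> moderate_S" "\<epsilon> \<in> {0<..1}" for \<phi> :: "'b net" and \<epsilon>
    using that unfolding moderate_S_iff by blast
  have maps: "integral_op H \<in> carrier G_S \<rightarrow>\<^sub>E carrier G_tau"
  proof (rule PiE_I)
    fix u :: "'b net set" assume "u \<in> carrier G_S"
    then obtain \<phi> where "\<phi> \<in> moderate_S" "u = S.cls \<phi>" by (auto simp: carrier_G_S)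
    then show "integral_op H u \<in> carrier G_tau"
      using kernel_int_moderate[OF h] by (auto simp: H integral_op_class[OF h] carrier_G_tau)
  \<comment> \<open>Extensionality: the operator is defined as a function restricted to the
    carrier.\<close>
  qed (simp add: integral_op_def)
  have add: "integral_op H (u \<oplus>\<^bsub>G_S\<^esub> v) = integral_op H u \<oplus>\<^bsub>G_tau\<^esub> integral_op H v"
    if uv: "u \<in> carrier G_S" "v \<in> carrier G_S" for u v
  proof -
    obtain \<phi> \<psi> where \<phi>: "\<phi> \<in> moderate_S" "u = S.cls \<phi>" and \<psi>: "\<psi> \<in> moderate_S" "v = S.cls \<psi>"
      using uv by (auto simp: carrier_G_S)
    have "integral_op H (u \<oplus>\<^bsub>G_S\<^esub> v) = class_tau (\<lambda>\<epsilon>. kernel_int (h \<epsilon>) (\<lambda>y. \<phi> \<epsilon> y + \<psi> \<epsilon> y))"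
      unfolding G_S_def \<phi>(2) \<psi>(2) S.add_FactModule H by (rule integral_op_class[OF h S.add[OF \<phi>(1) \<psi>(1)]])
    also have "\<dots> = class_tau (\<lambda>\<epsilon> x. kernel_int (h \<epsilon>) (\<phi> \<epsilon>) x + kernel_int (h \<epsilon>) (\<psi> \<epsilon>) x)"
      using kernel_int_lincomb_right[OF hO schwartz[OF \<phi>(1)] schwartz[OF \<psi>(1)], of _ _ _ 1 1]
      by (intro class_tau_cong) simp
    also have "\<dots> = integral_op H u \<oplus>\<^bsub>G_tau\<^esub> integral_op H v"
      unfolding H \<phi>(2) \<psi>(2) integral_op_class[OF h \<phi>(1)] integral_op_class[OF h \<psi>(1)]
      unfolding G_tau_def class_tau_def tau.add_FactModule ..
    finally show ?thesis .
  qed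
  have smult: "integral_op H (a \<odot>\<^bsub>G_S\<^esub> u) = a \<odot>\<^bsub>G_tau\<^esub> integral_op H u"
    if a: "a \<in> carrier gen_const" and u: "u \<in> carrier G_S" for a u
  proof -
    obtain \<phi> where \<phi>: "\<phi> \<in> moderate_S" "u = S.cls \<phi>" using u by (auto simp: carrier_G_S)
    obtain c where c: "c \<in> carrier moderate_const" "c \<in> a"
      "\<forall>d\<in>a. d \<in> carrier moderate_const \<and> (\<lambda>\<epsilon>. d \<epsilon> - c \<epsilon>) \<in> null_const"
      using a by (rule carrier_gen_const)
    have "integral_op H (a \<odot>\<^bsub>G_S\<^esub> u) = class_tau (\<lambda>\<epsilon>. kernel_int (h \<epsilon>) (\<lambda>y. c \<epsilon> * \<phi> \<epsilon> y))"
      unfolding G_S_def \<phi>(2) S.smult_FactModule[OF \<phi>(1) c] H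
      by (rule integral_op_class[OF h S.smult[OF \<phi>(1) c(1)]])
    also have "\<dots> = class_tau (\<lambda>\<epsilon> x. c \<epsilon> * kernel_int (h \<epsilon>) (\<phi> \<epsilon>) x)"
    proof (rule class_tau_cong)
      fix \<epsilon> :: real assume "\<epsilon> \<in> {0<..1}"
      then show "kernel_int (h \<epsilon>) (\<lambda>y. c \<epsilon> * \<phi> \<epsilon> y) = (\<lambda>x. c \<epsilon> * kernel_int (h \<epsilon>) (\<phi> \<epsilon>) x)"
        using kernel_int_lincomb_right[OF hO schwartz[OF \<phi>(1)] schwartz[OF \<phi>(1)], of \<epsilon> \<epsilon> \<epsilon> "c \<epsilon>" 0] by simp
    qed
    also have "\<dots> = a \<odot>\<^bsub>G_tau\<^esub> integral_op H u"
      unfolding H \<phi>(2) integral_op_class[OF h \<phi>(1)]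
      unfolding G_tau_def class_tau_def tau.smult_FactModule[OF kernel_int_moderate[OF h \<phi>(1)] c] ..
    finally show ?thesis .
  qed
  show ?thesis using maps add smult by (simp add: linear_maps_def)
qed

text \<open>Equal operators mean that the difference of two kernel representatives integrates every
  moderate test net to a null net, which forces the difference to be null.\<close>

lemma inj_on_integral_op:
  "inj_on (integral_op :: ('a::euclidean_space \<times> 'b::euclidean_space) net set \<Rightarrow> _) (carrier G_tau)"
proof (rule inj_onI)
  fix H H' :: "('a \<times> 'b) net set"
  assume "H \<in> carrier G_tau" "H' \<in> carrier G_tau" and eq: "integral_op H = integral_op H'"
  then obtain h h' where h: "h \<in> moderate_tau" "H = class_tau h" and h': "h' \<in> moderate_tau" "H' = class_tau h'"
    by (auto simp: carrier_G_tau)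
  have "(\<lambda>\<epsilon> z. h \<epsilon> z - h' \<epsilon> z) \<in> null_tau"
  proof (rule null_tau_if_kernel_int_null[OF tau.diff[OF h(1) h'(1)]])
    fix \<phi> :: "'b net" assume \<phi>: "\<phi> \<in> moderate_S"
    have "class_tau (\<lambda>\<epsilon>. kernel_int (h \<epsilon>) (\<phi> \<epsilon>)) = class_tau (\<lambda>\<epsilon>. kernel_int (h' \<epsilon>) (\<phi> \<epsilon>))"
      using eq unfolding h(2) h'(2) integral_op_class[OF h(1) \<phi>, symmetric] integral_op_class[OF h'(1) \<phi>, symmetric]
      by simp
    then have "(\<lambda>\<epsilon> x. kernel_int (h \<epsilon>) (\<phi> \<epsilon>) x - kernel_int (h' \<epsilon>) (\<phi> \<epsilon>) x) \<in> null_tau"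
      by (simp add: class_tau_eq_iff)
    then show "(\<lambda>\<epsilon>. kernel_int (\<lambda>z. h \<epsilon> z - h' \<epsilon> z) (\<phi> \<epsilon>)) \<in> null_tau"
    proof (rule null_tau_cong)
      fix \<epsilon> :: real assume "\<epsilon> \<in> {0<..1}"
      then have "h \<epsilon> \<in> O_M" "h' \<epsilon> \<in> O_M" "\<phi> \<epsilon> \<in> schwartz"
        using h(1) h'(1) \<phi> unfolding moderate_tau_iff moderate_S_iff by auto
      from kernel_int_lincomb_left[OF this, of 1 "-1"]
      show "(\<lambda>x. kernel_int (h \<epsilon>) (\<phi> \<epsilon>) x - kernel_int (h' \<epsilon>) (\<phi> \<epsilon>) x)
          = kernel_int (\<lambda>z. h \<epsilon> z - h' \<epsilon> z) (\<phi> \<epsilon>)"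
        by simp
    qed
  qed
  then show "H = H'" unfolding h(2) h'(2) class_tau_eq_iff .
qed

theorem proposition14:
  shows "(\<forall>H \<in> carrier (G_tau :: (_, ((real ^ 'm) \<times> (real ^ 'n)) net set) module).
            integral_op H \<in> linear_maps gen_const G_S G_tau) \<and>
         inj_on (integral_op :: ((real ^ 'm) \<times> (real ^ 'n)) net set \<Rightarrow> _) (carrier G_tau)"
  using integral_op_linear inj_on_integral_op by blast

end
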